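(* Suppose $p>1$ and that $f$ in addition satisfies (Lip): there is a constant $c$ such that $|f(x,v)-f(y,v)|\le c|x-y||v|^p$ for all $x,y\in D$, $v\in\mathbb R^d$. There is an event of probability $1$ such that, for every realization $\{X_i\}$ in this event, the following holds. (1) $\displaystyle\lim_{n\to\infty}\min_{\mathbf v\in V_n(a,b)}H_n(\mathbf v)=\min_{\gamma\in\Omega(a,b)}F(\gamma).$ (2) Let $\mathbf w^{(n)}\in\operatorname{argmin}H_n$ be optimal discrete paths ($n$ large), with linear interpolations $l_{\mathbf w^{(n)}}$. For any subsequence of $\{l_{\mathbf w^{(n)}}\}$, and correspondingly of $\{\mathbf w^{(n)}\}$, there is a further subsequence along which the linear paths converge uniformly to a limit path $\gamma\in\operatorname{argmin}F$ and the discrete paths converge in the Hausdorff metric to $S_\gamma$. (3) If $F$ has a unique minimizer $\gamma$ on $\Omega(a,b)$, then the whole sequence $l_{\mathbf w^{(n)}}$ converges uniformly to $\gamma$, and the whole sequence $\mathbf w^{(n)}$ converges in the Hausdorff metric to $S_\gamma$.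
   Context: Let $d\ge1$ and let $D\subset\mathbb R^d$ be the closure of a nonempty open, bounded, convex set; $|\cdot|$ is the Euclidean norm. The function $f:D\times\mathbb R^d\to[0,\infty)$ satisfies, for some $p\ge1$: (A0) $f$ is continuous on $D\times\mathbb R^d$ and $C^1$ on $D\times(\mathbb R^d\setminus\{0\})$; (A1) $f(x,v)$ is convex in $v$; (A2) $f(x,\lambda v)=\lambda^pf(x,v)$ for $\lambda>0$; (A3) there are $m_1,m_2>0$ with $m_1|v|^p\le f(x,v)\le m_2|v|^p$ for all $x\in D$, $v\in\mathbb R^d$. Fix $a,b\in D$. $\Omega(a,b)$ is the set of Lipschitz paths $\gamma:[0,1]\to D$ with $\gamma(0)=a$, $\gamma(1)=b$, and $F(\gamma)=\int_0^1f(\gamma(t),\dot\gamma(t))\,dt$ for $\gamma\in\Omega(a,b)$ (the minimum of $F$ on $\Omega(a,b)$ is attained). Let $X_1,X_2,\dots$ be i.i.d. points in $D$ whose law has Lebesgue density $\rho$ satisfying $c_0\le\rho(x)\le c_0^{-1}$ for all $x\in D$ and some $c_0>0$. Put $\mathcal X_n=\{X_1,\dots,X_n\}$. Let $\epsilon_n>0$ satisfy $\lim_n\epsilon_n=0$ and $\limsup_{n\to\infty}\frac{(\log n)^{1/d}}{n^{1/d}}\frac1{\epsilon_n}=0$. The graph $\mathcal G_n(a,b)$ has vertex set $\mathcal X_n\cup\{a,b\}$, with an edge between $u,v$ iff $0<|u-v|<\epsilon_n$. $V_n(a,b)$ is the set of paths $\mathbf v=(v_0,\dots,v_m)$ ($m\ge1$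 steps, $m$ arbitrary) of vertices with $v_0=a$, $v_m=b$ and an edge between $v_i$ and $v_{i+1}$ for $0\le i<m$; almost surely $V_n(a,b)\neq\emptyset$ for all large $n$. For $\mathbf v=(v_0,\dots,v_m)\in V_n(a,b)$ put $$H_n(\mathbf v)=\frac1m\sum_{i=0}^{m-1}f(v_i,m(v_{i+1}-v_i)),$$ and let $l_{\mathbf v}\in\Omega(a,b)$ be the piecewise linear path $l_{\mathbf v}(t)=(1-(mt-i))v_i+(mt-i)v_{i+1}$ for $i/m\le t\le(i+1)/m$. For $\gamma\in\Omega(a,b)$, $S_\gamma=\{\gamma(t):0\le t\le1\}$. For compact $A,B\subset D$, the Hausdorff metric is $d_{haus}(A,B)=\max\{\sup_{x\in A}\inf_{y\in B}|x-y|,\ \sup_{y\in B}\inf_{x\in A}|x-y|\}$; a discrete path $(v_0,\dots,v_m)$ is identified with the set $\{v_0,\dots,v_m\}$ in Hausdorff statements. *)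

theory Defs
  imports "HOL-Probability.Probability"
begin

(* C^1 regularity on a set S that need not be open: a derivative relative to S exists at
   every point of S and depends continuously on the point.  For the sets D x (R^d - {0})
   considered here (D the closure of an open convex set) the relative derivative is unique,
   and this agrees with being C^1 in the interior with derivative extending continuously
   to all of S. *)
definition C1_on :: "'a::real_normed_vector set \<Rightarrow> ('a \<Rightarrow> real) \<Rightarrow> bool" where
  "C1_on S g \<longleftrightarrow>
    (\<exists>g' :: 'a \<Rightarrow> ('a \<Rightarrow>\<^sub>L real).
       (\<forall>z\<in>S. (g has_derivative blinfun_apply (g' z)) (at z within S)) \<and>
       continuous_on S g')"

(* Omega(a,b).  Paths are total functions of which only the values on [0,1] are relevant. *)
definition lipschitz_paths :: "'a::euclidean_space set \<Rightarrow> 'a \<Rightarrow> 'a \<Rightarrow> (real \<Rightarrow> 'a) set" where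
  "lipschitz_paths D a b =
    {\<gamma>. (\<exists>L. L-lipschitz_on {0..1} \<gamma>) \<and> \<gamma> ` {0..1} \<subseteq> D \<and> \<gamma> 0 = a \<and> \<gamma> 1 = b}"

(* F.  A Lipschitz path is differentiable almost everywhere; on the exceptional null set
   vector_derivative is arbitrary, which does not affect the integral. *)
definition path_cost :: "('a::euclidean_space \<Rightarrow> 'a \<Rightarrow> real) \<Rightarrow> (real \<Rightarrow> 'a) \<Rightarrow> real" where
  "path_cost f \<gamma> =
    integral {0..1} (\<lambda>t. f (\<gamma> t) (vector_derivative \<gamma> (at t within {0..1})))"

definition sample_points :: "(nat \<Rightarrow> 'w \<Rightarrow> 'a) \<Rightarrow> nat \<Rightarrow> 'w \<Rightarrow> 'a set" where
  "sample_points X n \<omega> = (\<lambda>i. X i \<omega>) ` {1..n}"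

(* A discrete path (v_0, ..., v_m) is the list of its m + 1 vertices. *)
definition steps :: "'a list \<Rightarrow> nat" where
  "steps v = length v - 1"

(* V_n(a,b), for the graph on S \<union> {a, b} whose edges join the distinct points at distance < r. *)
definition graph_paths ::
    "'a::euclidean_space set \<Rightarrow> real \<Rightarrow> 'a \<Rightarrow> 'a \<Rightarrow> 'a list set" where
  "graph_paths S r a b =
    {v. length v \<ge> 2 \<and> set v \<subseteq> S \<union> {a, b} \<and> v ! 0 = a \<and> v ! steps v = b \<and>
        (\<forall>i < steps v. 0 < norm (v ! i - v ! Suc i) \<and> norm (v ! i - v ! Suc i) < r)}"

(* H_n; its dependence on n is only through the domain graph_paths. *)
definition discrete_cost :: "('a::euclidean_space \<Rightarrow> 'a \<Rightarrow> real) \<Rightarrow> 'a list \<Rightarrow> real" where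
  "discrete_cost f v =
    (1 / real (steps v)) *
      (\<Sum>i < steps v. f (v ! i) (real (steps v) *\<^sub>R (v ! Suc i - v ! i)))"

(* l_v.  The index i of the piece containing t is floor (m t), except that t = 1 belongs to
   the last piece i = m - 1; see linear_interp_piece below. *)
definition linear_interp :: "'a::euclidean_space list \<Rightarrow> real \<Rightarrow> 'a" where
  "linear_interp v t =
    (let m = steps v; i = min (nat \<lfloor>real m * t\<rfloor>) (m - 1) in
       (1 - (real m * t - real i)) *\<^sub>R (v ! i) + (real m * t - real i) *\<^sub>R (v ! Suc i))"

lemma linear_interp_piece:
  fixes v :: "'a::euclidean_space list"
  assumes "i < steps v"
    and "real i / real (steps v) \<le> t" and "t \<le> (real i + 1) / real (steps v)"
  shows "linear_interp v t =
    (1 - (real (steps v) * t - real i)) *\<^sub>R (v ! i) +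
    (real (steps v) * t - real i) *\<^sub>R (v ! Suc i)"
proof -
  define m where "m = steps v"
  have m: "i < m" using assms(1) by (simp add: m_def)
  have lo: "real i \<le> real m * t" and hi: "real m * t \<le> real i + 1"
    using assms(2,3) m unfolding m_def[symmetric] by (simp_all add: field_simps)
  show ?thesis
  proof (cases "real m * t = real i + 1")
    case True
    then have fl: "nat \<lfloor>real m * t\<rfloor> = Suc i"
      by (metis floor_of_nat nat_int of_nat_Suc add.commute)
    show ?thesis
    proof (cases "Suc i = m")
      case True
      then have "min (nat \<lfloor>real m * t\<rfloor>) (m - 1) = i" using fl by simp
      then show ?thesis by (simp add: linear_interp_def m_def[symmetric] Let_def)
    next
      case False
      then have "min (nat \<lfloor>real m * t\<rfloor>) (m - 1) = Suc i" using fl m by simp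
      then show ?thesis using True
        by (simp add: linear_interp_def m_def[symmetric] Let_def)
    qed
  next
    case False
    then have "\<lfloor>real m * t\<rfloor> = int i" using lo hi by (simp add: floor_eq_iff)
    then have "min (nat \<lfloor>real m * t\<rfloor>) (m - 1) = i" using m by simp
    then show ?thesis by (simp add: linear_interp_def m_def[symmetric] Let_def)
  qed
qed

definition hausdorff_distance :: "'a::metric_space set \<Rightarrow> 'a set \<Rightarrow> real" where
  "hausdorff_distance A B =
    max (SUP x\<in>A. INF y\<in>B. dist x y) (SUP y\<in>B. INF x\<in>A. dist x y)"

definition argmin_set :: "('b \<Rightarrow> real) \<Rightarrow> 'b set \<Rightarrow> 'b set" where
  "argmin_set g S = {x. is_arg_min g (\<lambda>y. y \<in> S) x}"

end

theory Submission
  imports Defs "HOL-Complex_Analysis.Great_Picard" "HOL-Real_Asymp.Real_Asymp"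
begin

text \<open>
  Both halves of the comparison between discrete and continuous paths rest on one estimate. By
  the Lipschitz condition, together with the lower growth bound, moving the base point of the
  Lagrangian by a distance \<open>r\<close> changes its value by a factor of at most \<open>1 + c r / m\<^sub>1\<close>
  (\<open>f_le_f_at_nearby_point\<close>). The edges of the random graph are shorter than \<open>\<epsilon> n\<close>, so the
  linear interpolation of a discrete path \<open>v\<close> costs at most \<open>1 + c \<epsilon> n / m\<^sub>1\<close> times the
  discrete cost of \<open>v\<close> (\<open>path_cost_linear_interp_le\<close>). Hence the discrete minima are
  asymptotically not below the continuous one. If in addition they are asymptotically not above
  it, then the interpolations of optimal discrete paths form a minimizing sequence of the
  continuous problem, and everything about limits of optimal discrete paths becomes a
  statement about minimizing sequences of Lipschitz paths.

  Such a sequence has a uniformly convergent subsequence whose limit is a minimizer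
  (\<open>minimizing_sequence_subconverges\<close>). Since \<open>p > 1\<close>, bounded cost gives a uniform Hoelder
  bound, hence equicontinuity, and the theorem of Arzela and Ascoli applies. That the limit
  is Lipschitz, not just Hoelder continuous, comes from the homogeneity of the Lagrangian. The
  \<open>p\<close>-th root of the minimal cost satisfies the triangle inequality, like the length of a
  shortest path, and the cost of crossing a distance \<open>l\<close> in time \<open>\<tau>\<close> is at least
  \<open>l powr p / \<tau> powr (p - 1)\<close>. A path which spends too little time on one of its pieces
  therefore pays strictly more than the minimum, and so near-minimizers have bounded speed
  between any two given times (\<open>near_minimizer_speed\<close>). Lower semicontinuity comes from
  Jensen's inequality on short time intervals with the base point frozen
  (\<open>path_cost_lower_semicontinuous\<close>). The same argument, applied to an arbitrary minimizing
  sequence, shows that a minimizer exists.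

  The integral enters only through the fact that the cost of a Lipschitz path is the limit of the
  costs of its inscribed polygons (\<open>chord_cost_tendsto\<close>). This is dominated convergence,
  and it requires that a Lipschitz path is differentiable almost everywhere
  (\<open>Lipschitz_imp_differentiable_ae\<close>).

  For the upper bound on the discrete minima one follows a minimizer and replaces the vertices of a
  fine inscribed polygon by nearby sample points (\<open>recovery_path\<close>). This works as soon as every
  point of \<open>D\<close> has a sample point within a distance which is small compared with \<open>\<epsilon> n\<close>. Almost
  surely the distance \<open>(K ln n / n) powr (1 / d)\<close> suffices for all large \<open>n\<close>: a union bound over a
  finite net and the lemma of Borel and Cantelli give \<open>sample_dense_ae\<close>, and the assumption on
  the rate of \<open>\<epsilon>\<close> says that this distance is negligible. From there on the argument is
  deterministic and takes place in the locale \<open>dense_proximity_graphs\<close>.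
\<close>

section \<open>Differentiability of Lipschitz paths almost everywhere\<close>

text \<open>
  The Stieltjes measures of \<open>F\<close> and \<open>G\<close> add up to \<open>K\<close> times Lebesgue measure, since the two
  sides agree on half-open intervals. Each summand is therefore dominated by Lebesgue measure.
\<close>

lemma absolutely_continuous_interval_measure:
  fixes F G :: "real \<Rightarrow> real"
  assumes F: "mono F" "continuous_on UNIV F" and G: "mono G" "continuous_on UNIV G"
    and FG: "\<And>x. F x + G x = K * x" and K: "K > 0"
  shows "absolutely_continuous lborel (interval_measure F)"
proof -
  let ?S = "\<lambda>A. emeasure (interval_measure F) A + emeasure (interval_measure G) A"
  define N where "N = measure_of (UNIV :: real set) (sets borel) ?S"
  have sets_N [simp]: "sets N = sets borel"
    unfolding N_def by (metis sets.sets_measure_of_eq space_borel)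
  have em_N: "emeasure N A = ?S A" if "A \<in> sets borel" for A
    unfolding N_def
  proof (rule emeasure_measure_of_sigma)
    show "sigma_algebra UNIV (sets borel :: real set set)"
      using sets.sigma_algebra_axioms[of "borel :: real measure"] by simp
    show "positive (sets borel) ?S" by (simp add: positive_def)
    show "countably_additive (sets borel) ?S"
    proof (rule countably_additiveI)
      fix A :: "nat \<Rightarrow> real set"
      assume A: "range A \<subseteq> sets borel" "disjoint_family A"
      have "(\<Sum>i. ?S (A i)) = (\<Sum>i. emeasure (interval_measure F) (A i)) + (\<Sum>i. emeasure (interval_measure G) (A i))"
        by (rule suminf_add[symmetric]) auto
      also have "\<dots> = ?S (\<Union>i. A i)"
        using A by (simp add: suminf_emeasure)
      finally show "(\<Sum>i. ?S (A i)) = ?S (\<Union>i. A i)" .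
    qed
    show "A \<in> sets borel" by fact
  qed
  have Ioc: "emeasure N {x<..y} = emeasure (density lborel (\<lambda>_. ennreal K)) {x<..y}" if "x \<le> y" for x y
  proof -
    have "emeasure N {x<..y} = ennreal (F y - F x) + ennreal (G y - G x)"
      using F G that by (subst em_N) (auto simp: emeasure_interval_measure_Ioc monoD continuous_on_eq_continuous_within
          continuous_at_imp_continuous_at_within)
    also have "\<dots> = ennreal ((F y - F x) + (G y - G x))"
      using F G that by (intro ennreal_plus[symmetric]) (auto simp: monoD)
    also have "(F y - F x) + (G y - G x) = K * (y - x)"
      using FG[of x] FG[of y] by (simp add: algebra_simps)
    also have "ennreal (K * (y - x)) = emeasure (density lborel (\<lambda>_. ennreal K)) {x<..y}"
      using that K by (simp add: emeasure_density ennreal_mult nn_integral_cmult)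
    finally show ?thesis .
  qed
  have sigma: "sets borel = sigma_sets UNIV (range (\<lambda>(x, y). {x<..y::real}))"
    by (subst borel_sigma_sets_Ioc) (rule sets_measure_of, simp)
  have eq: "N = density lborel (\<lambda>_. ennreal K)"
  proof (rule measure_eqI_generator_eq[where E="range (\<lambda>(x,y). {x<..y::real})" and \<Omega>=UNIV
        and A="\<lambda>n. {- real n<..real n}"])
    show "Int_stable (range (\<lambda>(x, y). {x<..y::real}))"
      by (auto simp: Int_stable_def)
    show "emeasure N X = emeasure (density lborel (\<lambda>_. ennreal K)) X" if "X \<in> range (\<lambda>(x, y). {x<..y})" for X
    proof -
      obtain x y where X: "X = {x<..y}" using \<open>X \<in> _\<close> by auto
      show ?thesis using Ioc[of x y] by (cases "x \<le> y") (auto simp: X)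
    qed
    show "sets N = sigma_sets UNIV (range (\<lambda>(x, y). {x<..y}))"
      by (rule trans[OF sets_N sigma])
    show "sets (density lborel (\<lambda>_. ennreal K)) = sigma_sets UNIV (range (\<lambda>(x, y). {x<..y::real}))"
      by (rule trans[OF _ sigma]) simp
    show "(\<Union>i. {- real i<..real i}) = UNIV"
    proof safe
      fix x :: real
      obtain n where "\<bar>x\<bar> < real n" using reals_Archimedean2 by blast
      then show "x \<in> (\<Union>i. {- real i<..real i})" by (auto intro!: exI[of _ n])
    qed simp
    show "emeasure N {- real i<..real i} \<noteq> \<infinity>" for i
      using K by (subst Ioc) (auto simp: emeasure_density nn_integral_cmult ennreal_mult_eq_top_iff)
  qed (auto)
  show ?thesis
    unfolding absolutely_continuous_def
  proof safe
    fix A assume A: "A \<in> null_sets (lborel :: real measure)"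
    then have "emeasure N A = 0"
      using null_setsD1[OF A] null_setsD2[OF A]
      unfolding eq by (subst emeasure_density) (auto simp: nn_integral_cmult_indicator)
    then show "A \<in> null_sets (interval_measure F)"
      using A em_N[of A] by (auto simp: null_sets_def)
  qed
qed

text \<open>
  Adding a linear function with a large slope to \<open>g\<close>, or to \<open>- g\<close>, gives two nondecreasing functions
  with a linear sum. The density of the Stieltjes measure of the first one, less the slope, has \<open>g\<close>
  as its indefinite integral.
\<close>

lemma Lipschitz_imp_indefinite_integral:
  fixes g :: "real \<Rightarrow> real"
  assumes g: "L-lipschitz_on UNIV g"
  obtains h where "\<And>x y. x \<le> y \<Longrightarrow> (h has_integral (g y - g x)) {x..y}"
proof -
  define F where "F = (\<lambda>x. (L + 1) * x + g x)"
  define G where "G = (\<lambda>x. (L + 1) * x - g x)"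
  have L: "0 \<le> L" using g lipschitz_on_nonneg by blast
  have lip: "\<bar>g x - g y\<bar> \<le> L * \<bar>x - y\<bar>" for x y
    using lipschitz_onD[OF g, of x y] by (simp add: dist_real_def)
  have cont: "continuous_on UNIV g" using g lipschitz_on_continuous_on by blast
  have mF: "F x \<le> F y" and mG: "G x \<le> G y" if "x \<le> y" for x y
    using lip[of x y] that L by (auto simp: F_def G_def algebra_simps abs_if split: if_splits)
  have monoF: "mono F" "mono G" using mF mG by (auto simp: mono_def)
  have contF: "continuous_on UNIV F" "continuous_on UNIV G"
    unfolding F_def G_def by (intro continuous_intros cont)+
  have ac: "absolutely_continuous lborel (interval_measure F)"
    by (rule absolutely_continuous_interval_measure[OF monoF(1) contF(1) monoF(2) contF(2), of "2 * (L + 1)"])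
      (use L in \<open>auto simp: F_def G_def algebra_simps\<close>)
  obtain d where d: "d \<in> borel_measurable lborel" "density lborel d = interval_measure F"
    using sigma_finite_measure.Radon_Nikodym[OF sigma_finite_lborel ac] by auto
  have rc: "\<And>a. continuous (at_right a) F"
    using contF by (simp add: continuous_on_eq_continuous_within continuous_at_imp_continuous_at_within)
  have "sigma_finite_measure (interval_measure F)"
    by (rule sigma_finite_interval_measure) (use mF rc in auto)
  then have "AE x in lborel. d x \<noteq> \<infinity>"
    using sigma_finite_measure.sigma_finite_iff_density_finite[OF sigma_finite_lborel, of d] d by simp
  then have dfin: "AE x in lborel. d x = ennreal (enn2real (d x))"
    by eventually_elim (auto simp: less_top)
  define h0 where "h0 = (\<lambda>x. enn2real (d x))"
  have h0m: "h0 \<in> borel_measurable lborel" unfolding h0_def using d(1) by measurable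
  have h0: "(h0 has_integral (F y - F x)) {x..y}" if "x \<le> y" for x y
  proof -
    have "(\<integral>\<^sup>+t. ennreal (h0 t * indicator {x<..y} t) \<partial>lborel) = (\<integral>\<^sup>+t. d t * indicator {x<..y} t \<partial>lborel)"
      by (rule nn_integral_cong_AE, use dfin in eventually_elim) (auto simp: h0_def indicator_def)
    also have "\<dots> = emeasure (interval_measure F) {x<..y}"
      using d by (subst d(2)[symmetric], subst emeasure_density) auto
    also have "\<dots> = ennreal (F y - F x)"
      using that by (subst emeasure_interval_measure_Ioc) (use mF rc in auto)
    finally have "((\<lambda>t. h0 t * indicator {x<..y} t) has_integral (F y - F x)) UNIV"
      using h0m mF[OF that] by (intro nn_integral_has_integral) (auto simp: h0_def)
    then have "((\<lambda>t. if t \<in> {x<..y} then h0 t else 0) has_integral (F y - F x)) UNIV"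
      by (rule has_integral_eq[rotated]) (auto simp: indicator_def)
    then have "(h0 has_integral (F y - F x)) {x<..y}"
      by (simp only: has_integral_restrict_UNIV)
    then show ?thesis
      by (subst has_integral_spike_set_eq[where T="{x<..y}"])
        (auto intro: negligible_subset[of "{x}"])
  qed
  have "((\<lambda>t. h0 t - (L + 1)) has_integral (g y - g x)) {x..y}" if "x \<le> y" for x y
  proof -
    have "((\<lambda>t. h0 t - (L + 1)) has_integral ((F y - F x) - (y - x) *\<^sub>R (L + 1))) {x..y}"
      using has_integral_diff[OF h0[OF that] has_integral_const_real[of "L + 1" x y]] that by simp
    then show ?thesis by (simp add: F_def algebra_simps)
  qed
  then show ?thesis using that by blast
qed


text \<open>
  The differentiation theorem for integrals over \<open>{x..x + k}\<close> yields right derivatives only.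
  Applying it also to the reflected density yields the left derivatives, with the same value.
\<close>

lemma Lipschitz_imp_differentiable_ae_real:
  fixes g :: "real \<Rightarrow> real"
  assumes g: "L-lipschitz_on UNIV g"
  obtains N where "negligible N" "\<And>x. x \<notin> N \<Longrightarrow> g differentiable (at x)"
proof -
  obtain h where h: "\<And>x y. x \<le> y \<Longrightarrow> (h has_integral (g y - g x)) {x..y}"
    using Lipschitz_imp_indefinite_integral[OF g] by blast
  have h': "((\<lambda>t. h (- t)) has_integral (g (- x) - g (- y))) {x..y}" if "x \<le> y" for x y
    using h[of "-y" "-x"] that has_integral_reflect_real[of h _ "- x" "-y"] by simp
  have int: "h integrable_on cbox x y" "(\<lambda>t. h (- t)) integrable_on cbox x y" for x y
    using h[of x y] h'[of x y] by (cases "x \<le> y"; force simp: integrable_on_def)+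
  obtain N1 where N1: "negligible N1" and lim1: "\<And>x e. \<lbrakk>x \<notin> N1; 0 < e\<rbrakk> \<Longrightarrow>
      \<exists>d>0. \<forall>k. 0 < k \<and> k < d \<longrightarrow> norm (integral (cbox x (x + k *\<^sub>R One)) h /\<^sub>R k ^ DIM(real) - h x) < e"
    using integrable_ccontinuous_explicit[OF int(1)] by blast
  obtain N2 where N2: "negligible N2" and lim2: "\<And>x e. \<lbrakk>x \<notin> N2; 0 < e\<rbrakk> \<Longrightarrow>
      \<exists>d>0. \<forall>k. 0 < k \<and> k < d \<longrightarrow> norm (integral (cbox x (x + k *\<^sub>R One)) (\<lambda>t. h (- t)) /\<^sub>R k ^ DIM(real) - h (- x)) < e"
    using integrable_ccontinuous_explicit[OF int(2)] by blast
  show ?thesis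
  proof
    show "negligible (N1 \<union> uminus ` N2)"
      using N1 N2 by (intro negligible_Un negligible_differentiable_image_negligible) (auto intro!: derivative_intros)
    fix x assume x: "x \<notin> N1 \<union> uminus ` N2"
    then have x2: "- x \<notin> N2" by force
    have "((\<lambda>k. (g (x + k) - g x) / k) \<longlongrightarrow> h x) (at 0)"
    proof (rule LIM_I)
      fix e :: real assume e: "0 < e"
      obtain d1 where d1: "d1 > 0" "\<And>k. 0 < k \<Longrightarrow> k < d1 \<Longrightarrow> \<bar>(g (x + k) - g x) / k - h x\<bar> < e"
      proof -
        obtain d1 where "d1 > 0" and d: "\<And>k. 0 < k \<and> k < d1 \<Longrightarrow>
            norm (integral (cbox x (x + k *\<^sub>R One)) h /\<^sub>R k ^ DIM(real) - h x) < e"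
          using lim1[of x e] x e by blast
        moreover have "integral (cbox x (x + k *\<^sub>R One)) h = g (x + k) - g x" if "0 < k" for k
          using h[of x "x + k"] that by (simp add: integral_unique)
        ultimately show ?thesis
          using that[of d1] by (simp add: divide_inverse mult.commute)
      qed
      obtain d2 where d2: "d2 > 0" "\<And>k. 0 < k \<Longrightarrow> k < d2 \<Longrightarrow> \<bar>(g x - g (x - k)) / k - h x\<bar> < e"
      proof -
        obtain d1 where "d1 > 0" and d: "\<And>k. 0 < k \<and> k < d1 \<Longrightarrow>
            norm (integral (cbox (- x) (- x + k *\<^sub>R One)) (\<lambda>t. h (- t)) /\<^sub>R k ^ DIM(real) - h (- (- x))) < e"
          using lim2[of "- x" e] x2 e by blast
        moreover have "integral (cbox (- x) (- x + k *\<^sub>R One)) (\<lambda>t. h (- t)) = g x - g (x - k)" if "0 < k" for k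
          using h'[of "- x" "- x + k"] that by (simp add: integral_unique)
        ultimately show ?thesis
          using that[of d1] by (simp add: divide_inverse mult.commute)
      qed
      show "\<exists>s>0. \<forall>k. k \<noteq> 0 \<and> norm (k - 0) < s \<longrightarrow> norm ((g (x + k) - g x) / k - h x) < e"
      proof (intro exI[of _ "min d1 d2"] conjI allI impI)
        fix k :: real assume k: "k \<noteq> 0 \<and> norm (k - 0) < min d1 d2"
        show "norm ((g (x + k) - g x) / k - h x) < e"
        proof (cases "k > 0")
          case True
          then show ?thesis using d1(2)[of k] k by simp
        next
          case False
          moreover have "(g (x + k) - g x) / k = (g x - g (x + k)) / (- k)"
            by (simp add: divide_simps minus_divide_left)
          ultimately show ?thesis using d2(2)[of "- k"] k by simp
        qed
      qed (use d1 d2 in auto)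
    qed
    then have "DERIV g x :> h x" by (simp add: DERIV_def)
    then show "g differentiable (at x)"
      using real_differentiable_def by blast
  qed
qed

lemma Lipschitz_imp_differentiable_ae:
  fixes \<gamma> :: "real \<Rightarrow> 'a::euclidean_space"
  assumes \<gamma>: "L-lipschitz_on {a..b} \<gamma>"
  obtains N where "negligible N" "\<And>t. t \<in> {a<..<b} - N \<Longrightarrow> \<gamma> differentiable (at t)"
proof (cases "a \<le> b")
  case False
  then show ?thesis using that[of "{}"] by auto
next
  case True
  have "\<exists>N. negligible N \<and> (\<forall>t\<in>{a<..<b} - N. (\<lambda>t. \<gamma> t \<bullet> i) differentiable (at t))"
    if i: "i \<in> Basis" for i :: 'a
  proof -
    define g where "g = (\<lambda>t. \<gamma> (max a (min b t)) \<bullet> i)"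
    have "L-lipschitz_on UNIV g"
    proof (rule lipschitz_onI)
      show "0 \<le> L" using \<gamma> lipschitz_on_nonneg by blast
      fix x y :: real
      let ?c = "\<lambda>t. max a (min b t)"
      have "dist (g x) (g y) \<le> dist (\<gamma> (?c x)) (\<gamma> (?c y))"
        unfolding g_def dist_norm inner_diff_left[symmetric] real_norm_def
        using i by (rule Basis_le_norm)
      also have "\<dots> \<le> L * dist (?c x) (?c y)"
        using True by (intro lipschitz_onD[OF \<gamma>]) auto
      also have "\<dots> \<le> L * dist x y"
        using \<open>0 \<le> L\<close> by (intro mult_left_mono) (auto simp: dist_real_def)
      finally show "dist (g x) (g y) \<le> L * dist x y" .
    qed
    then obtain N where N: "negligible N" "\<And>x. x \<notin> N \<Longrightarrow> g differentiable (at x)"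
      using Lipschitz_imp_differentiable_ae_real by blast
    have "(\<lambda>t. \<gamma> t \<bullet> i) differentiable (at t)" if t: "t \<in> {a<..<b} - N" for t
    proof -
      obtain D where "(g has_derivative D) (at t)"
        using N(2)[of t] t by (auto simp: differentiable_def)
      then have "((\<lambda>t. \<gamma> t \<bullet> i) has_derivative D) (at t)"
        by (rule has_derivative_transform_within_open[where s="{a<..<b}"]) (use t in \<open>auto simp: g_def\<close>)
      then show ?thesis by (auto simp: differentiable_def)
    qed
    then show ?thesis using N by blast
  qed
  then obtain N where N: "\<And>i. i \<in> Basis \<Longrightarrow> negligible (N i)"
    "\<And>i t. i \<in> (Basis :: 'a set) \<Longrightarrow> t \<in> {a<..<b} - N i \<Longrightarrow> (\<lambda>t. \<gamma> t \<bullet> i) differentiable (at t)"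
    by metis
  show ?thesis
  proof
    show "negligible (\<Union>i\<in>Basis. N i)"
      using N(1) by (intro negligible_Union) auto
    fix t assume t: "t \<in> {a<..<b} - (\<Union>i\<in>Basis. N i)"
    show "\<gamma> differentiable (at t)"
      by (subst differentiable_componentwise_within) (use t N(2) in auto)
  qed
qed

section \<open>Costs of Lipschitz paths\<close>

text \<open>
  The discrete cost of the polygon inscribed in a path at the times \<open>i / m\<close>.
\<close>

definition chord_cost :: "('a::euclidean_space \<Rightarrow> 'a \<Rightarrow> real) \<Rightarrow> (real \<Rightarrow> 'a) \<Rightarrow> nat \<Rightarrow> real" where
  "chord_cost f \<gamma> m = (1 / real m) *
     (\<Sum>i<m. f (\<gamma> (real i / real m)) (real m *\<^sub>R (\<gamma> (real (Suc i) / real m) - \<gamma> (real i / real m))))"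

lemma has_integral_step_function:
  fixes h :: "nat \<Rightarrow> real"
  assumes m: "m > 0"
  shows "((\<lambda>t. h (nat \<lfloor>real m * t\<rfloor>)) has_integral (1 / real m) * (\<Sum>i<m. h i)) {0..1}"
proof -
  have "((\<lambda>t. h (nat \<lfloor>real m * t\<rfloor>)) has_integral (1 / real m) * (\<Sum>i<k. h i)) {0..real k / real m}" for k
  proof (induction k)
    case 0
    show ?case using has_integral_refl(1)[of "\<lambda>t. h (nat \<lfloor>real m * t\<rfloor>)" 0] by simp
  next
    case (Suc k)
    have "((\<lambda>t. h (nat \<lfloor>real m * t\<rfloor>)) has_integral (1 / real m) * h k) {real k / real m..real (Suc k) / real m}"
    proof (rule has_integral_spike_finite[where S="{real (Suc k) / real m}" and f="\<lambda>_. h k"])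
      have "real (Suc k) / real m - real k / real m = 1 / real m"
        using m by (simp add: field_simps)
      then show "((\<lambda>_. h k) has_integral (1 / real m) * h k) {real k / real m..real (Suc k) / real m}"
        using has_integral_const_real[of "h k" "real k / real m" "real (Suc k) / real m"] m
        by (simp add: divide_right_mono)
      fix t assume "t \<in> {real k / real m..real (Suc k) / real m} - {real (Suc k) / real m}"
      then have "real k \<le> real m * t" "real m * t < real k + 1"
        using m by (auto simp: field_simps)
      then have "\<lfloor>real m * t\<rfloor> = int k" by (simp add: floor_eq_iff)
      then show "h (nat \<lfloor>real m * t\<rfloor>) = h k" by simp
    qed simp
    from has_integral_combine[OF _ _ Suc this] show ?case
      using m by (simp add: algebra_simps divide_right_mono)
  qed
  from this[of m] show ?thesis using m by simp
qed

text \<open>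
  Difference quotients over intervals that contain the point, but need not begin or end there.
\<close>

lemma has_vector_derivative_straddle:
  fixes \<gamma> :: "real \<Rightarrow> 'a::real_normed_vector" and s r :: "nat \<Rightarrow> real"
  assumes d: "(\<gamma> has_vector_derivative v) (at t)"
    and s: "s \<longlonglongrightarrow> t" and r: "r \<longlonglongrightarrow> t"
    and sr: "\<And>m. s m \<le> t" "\<And>m. t \<le> r m" "\<And>m. s m < r m"
  shows "(\<lambda>m. (\<gamma> (r m) - \<gamma> (s m)) /\<^sub>R (r m - s m)) \<longlonglongrightarrow> v"
proof (rule LIMSEQ_I)
  fix e :: real assume e: "0 < e"
  obtain \<delta> where \<delta>: "\<delta> > 0" "\<And>y. \<bar>y - t\<bar> < \<delta> \<Longrightarrow> norm (\<gamma> y - \<gamma> t - (y - t) *\<^sub>R v) \<le> e / 2 * \<bar>y - t\<bar>"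
    using d e unfolding has_vector_derivative_def has_derivative_at_alt real_norm_def by (metis half_gt_zero)
  obtain n1 where n1: "\<And>m. m \<ge> n1 \<Longrightarrow> \<bar>s m - t\<bar> < \<delta>" using LIMSEQ_D[OF s \<delta>(1)] by auto
  obtain n2 where n2: "\<And>m. m \<ge> n2 \<Longrightarrow> \<bar>r m - t\<bar> < \<delta>" using LIMSEQ_D[OF r \<delta>(1)] by auto
  show "\<exists>no. \<forall>m\<ge>no. norm ((\<gamma> (r m) - \<gamma> (s m)) /\<^sub>R (r m - s m) - v) < e"
  proof (intro exI[of _ "max n1 n2"] allI impI)
    fix m assume m: "max n1 n2 \<le> m"
    have "norm (\<gamma> (r m) - \<gamma> (s m) - (r m - s m) *\<^sub>R v) =
        norm ((\<gamma> (r m) - \<gamma> t - (r m - t) *\<^sub>R v) - (\<gamma> (s m) - \<gamma> t - (s m - t) *\<^sub>R v))"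
      by (simp add: algebra_simps)
    also have "\<dots> \<le> e / 2 * \<bar>r m - t\<bar> + e / 2 * \<bar>s m - t\<bar>"
      using norm_triangle_ineq4 \<delta>(2) n1 n2 m by (smt (verit, best) max.bounded_iff)
    also have "\<dots> = e / 2 * (r m - s m)" using sr[of m] by (simp add: field_simps)
    finally have 1: "norm (\<gamma> (r m) - \<gamma> (s m) - (r m - s m) *\<^sub>R v) \<le> e / 2 * (r m - s m)" .
    have "(\<gamma> (r m) - \<gamma> (s m)) /\<^sub>R (r m - s m) - v = (\<gamma> (r m) - \<gamma> (s m) - (r m - s m) *\<^sub>R v) /\<^sub>R (r m - s m)"
      using sr(3)[of m] by (simp add: scaleR_diff_right)
    also have "norm \<dots> = norm (\<gamma> (r m) - \<gamma> (s m) - (r m - s m) *\<^sub>R v) / (r m - s m)"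
      using sr(3)[of m] by (simp add: divide_inverse mult.commute)
    also have "\<dots> \<le> e / 2" using 1 sr(3)[of m] by (simp add: divide_le_eq)
    also have "\<dots> < e" using e by simp
    finally show "norm ((\<gamma> (r m) - \<gamma> (s m)) /\<^sub>R (r m - s m) - v) < e" .
  qed
qed

text \<open>
  The graph of a convex power lies above its tangents, including the tangent at \<open>0\<close> and the value
  at \<open>0\<close>. This is the form in which the growth of the cost with the speed is used below.
\<close>

lemma powr_tangent:
  fixes x l p :: real
  assumes p: "p > 1" and x: "x \<ge> 0" and l: "l \<ge> 0"
  shows "l powr p + p * l powr (p - 1) * (x - l) \<le> x powr p"
proof -
  consider "l = 0" | "l > 0" "x = 0" | "l > 0" "x > 0" using x l by linarith
  then show ?thesis
  proof cases
    case 2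
    have "l powr (p - 1) * l = l powr p"
      using 2 powr_add[of l "p - 1" 1] by simp
    then have "l powr p + p * l powr (p - 1) * (0 - l) = (1 - p) * l powr p"
      by (simp add: algebra_simps)
    then show ?thesis using 2 p by (simp add: mult_nonpos_nonneg)
  next
    case 3
    have "x powr p - l powr p \<ge> p * l powr (p - 1) * (x - l)"
    proof (rule convex_on_imp_above_tangent)
      show "convex_on {0<..} (\<lambda>x. x powr p)" using p by (intro powr_convex) simp
      show "l \<in> interior {0<..}" using 3 by (simp add: interior_open)
      show "((\<lambda>x. x powr p) has_field_derivative p * l powr (p - 1)) (at l within {0<..})"
        using 3 by (auto intro!: derivative_eq_intros)
    qed (use 3 in auto)
    then show ?thesis by simp
  qed simp
qed

lemma convex_on_norm_powr:
  fixes p :: real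
  assumes p: "p > 1"
  shows "convex_on UNIV (\<lambda>v :: 'a::real_normed_vector. norm v powr p)"
proof (rule convex_onI)
  fix t :: real and x y :: 'a
  assume t: "0 < t" "t < 1"
  define z where "z = (1 - t) * norm x + t * norm y"
  have z0: "0 \<le> z" using t by (simp add: z_def)
  have "norm ((1 - t) *\<^sub>R x + t *\<^sub>R y) \<le> z"
    unfolding z_def using t norm_triangle_ineq[of "(1 - t) *\<^sub>R x" "t *\<^sub>R y"] by simp
  then have "norm ((1 - t) *\<^sub>R x + t *\<^sub>R y) powr p \<le> z powr p"
    using p by (intro powr_mono2) auto
  also have "\<dots> = (1 - t) * (z powr p + p * z powr (p - 1) * (norm x - z)) + t * (z powr p + p * z powr (p - 1) * (norm y - z))"
  proof -
    have "(1 - t) * (z powr p + p * z powr (p - 1) * (norm x - z)) + t * (z powr p + p * z powr (p - 1) * (norm y - z))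
       = z powr p + p * z powr (p - 1) * (((1 - t) * norm x + t * norm y) - z)"
      by (simp add: algebra_simps)
    then show ?thesis by (simp add: z_def)
  qed
  also have "\<dots> \<le> (1 - t) * norm x powr p + t * norm y powr p"
    using t by (intro add_mono mult_left_mono powr_tangent[OF p]) (auto simp: z0)
  finally show "norm ((1 - t) *\<^sub>R x + t *\<^sub>R y) powr p \<le> (1 - t) * norm x powr p + t * norm y powr p" .
qed simp

lemma path_cost_cong:
  assumes eq: "\<And>t. t \<in> {0..1} \<Longrightarrow> \<gamma> t = \<eta> t"
  shows "path_cost f \<gamma> = path_cost f \<eta>"
  unfolding path_cost_def
proof (rule integral_cong)
  fix t :: real assume t: "t \<in> {0..1}"
  have "(\<gamma> has_vector_derivative v) (at t within {0..1}) \<longleftrightarrow> (\<eta> has_vector_derivative v) (at t within {0..1})" for v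
    using t eq by (metis has_vector_derivative_transform)
  then show "f (\<gamma> t) (vector_derivative \<gamma> (at t within {0..1})) = f (\<eta> t) (vector_derivative \<eta> (at t within {0..1}))"
    using eq[OF t] by (simp add: vector_derivative_def)
qed

lemma linepath_in_lipschitz_paths:
  assumes "convex D" "x \<in> D" "y \<in> D"
  shows "linepath x y \<in> lipschitz_paths D x y"
proof -
  have "(norm (y - x))-lipschitz_on {0..1} (linepath x y)"
  proof (rule lipschitz_onI)
    fix s t :: real
    have "linepath x y s - linepath x y t = (s - t) *\<^sub>R (y - x)"
      by (simp add: linepath_def algebra_simps)
    then show "dist (linepath x y s) (linepath x y t) \<le> norm (y - x) * dist s t"
      by (simp add: dist_norm mult.commute)
  qed simp
  moreover have "linepath x y ` {0..1} \<subseteq> D"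
    using assms closed_segment_subset linepath_image_01 by metis
  ultimately show ?thesis by (auto simp: lipschitz_paths_def linepath_def)
qed

locale homogeneous_lagrangian =
  fixes D :: "'a::euclidean_space set" and f :: "'a \<Rightarrow> 'a \<Rightarrow> real"
    and p m\<^sub>1 m\<^sub>2 c :: real
  assumes compact_D: "compact D" and convex_D: "convex D"
    and p: "p > 1"
    and cont_f: "continuous_on (D \<times> UNIV) (\<lambda>(x, v). f x v)"
    and convex_f: "\<And>x. x \<in> D \<Longrightarrow> convex_on UNIV (f x)"
    and homogeneous: "\<And>x v r. x \<in> D \<Longrightarrow> r > 0 \<Longrightarrow> f x (r *\<^sub>R v) = r powr p * f x v"
    and m1: "m\<^sub>1 > 0" and m2: "m\<^sub>2 > 0"
    and lower: "\<And>x v. x \<in> D \<Longrightarrow> m\<^sub>1 * norm v powr p \<le> f x v"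
    and upper: "\<And>x v. x \<in> D \<Longrightarrow> f x v \<le> m\<^sub>2 * norm v powr p"
    and c: "0 \<le> c"
    and Lip: "\<And>x y v. x \<in> D \<Longrightarrow> y \<in> D \<Longrightarrow> \<bar>f x v - f y v\<bar> \<le> c * norm (x - y) * norm v powr p"
begin

lemma f_nonneg: "x \<in> D \<Longrightarrow> 0 \<le> f x v"
  using lower[of x v] m1 by (smt (verit, best) mult_nonneg_nonneg powr_ge_zero)

lemma f_zero: "x \<in> D \<Longrightarrow> f x 0 = 0"
  using upper[of x 0] f_nonneg[of x 0] by simp

text \<open>
  The Lipschitz condition bounds the difference by a multiple of \<open>norm v powr p\<close>, and the growth
  condition turns this into a multiple of \<open>f x v\<close>. A relative error is what makes the later
  estimates uniform in the speed of the paths.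
\<close>

lemma f_le_f_at_nearby_point:
  assumes "x \<in> D" "y \<in> D" "norm (x - y) \<le> r"
  shows "f y v \<le> (1 + c * r / m\<^sub>1) * f x v"
proof -
  have "f y v \<le> f x v + c * norm (x - y) * norm v powr p"
    using Lip[OF assms(1,2), of v] by simp
  also have "c * norm (x - y) * norm v powr p \<le> c * r * (f x v / m\<^sub>1)"
    using assms c lower[OF assms(1), of v] m1
    by (intro mult_mono) (auto simp: field_simps intro!: mult_nonneg_nonneg order_trans[OF norm_ge_zero assms(3)])
  finally show ?thesis by (simp add: algebra_simps)
qed

text \<open>
  The chord cost is the integral of a step function. At a point where the path is differentiable
  the slopes of the chords around it converge to the velocity, so the step functions converge almost
  everywhere to the integrand, and the Lipschitz constant gives a uniform bound.
\<close>

lemma path_cost_integrable_and_chord_cost_tendsto: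
  assumes \<gamma>: "\<gamma> \<in> lipschitz_paths D a b"
  shows path_cost_integrable: "(\<lambda>t. f (\<gamma> t) (vector_derivative \<gamma> (at t within {0..1}))) integrable_on {0..1}"
    and chord_cost_tendsto: "chord_cost f \<gamma> \<longlonglongrightarrow> path_cost f \<gamma>"
proof -
  obtain L where L: "L-lipschitz_on {0..1} \<gamma>" and \<gamma>D: "\<And>t. t \<in> {0..1} \<Longrightarrow> \<gamma> t \<in> D"
    using \<gamma> unfolding lipschitz_paths_def by blast
  obtain N0 where N0: "negligible N0" "\<And>t. t \<in> {0<..<1} - N0 \<Longrightarrow> \<gamma> differentiable (at t)"
    using Lipschitz_imp_differentiable_ae[OF L] by blast
  \<comment> \<open>Dominated convergence needs convergence everywhere, so everything is set to \<open>0\<close> on \<open>N\<close>.\<close>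
  define N where "N = N0 \<union> {0, 1}"
  have N: "negligible N" using N0 by (simp add: N_def)
  define d where "d = (\<lambda>m i. real m *\<^sub>R (\<gamma> (real (Suc i) / real m) - \<gamma> (real i / real m)))"
  \<comment> \<open>The value \<open>0\<close> for \<open>i \<ge> m\<close> matters only at \<open>t = 1\<close>, where the step function would
      leave the interval.\<close>
  define h where "h = (\<lambda>m i. if i < m then f (\<gamma> (real i / real m)) (d m i) else 0)"
  let ?F = "\<lambda>t. f (\<gamma> t) (vector_derivative \<gamma> (at t within {0..1}))"
  let ?q = "\<lambda>m t. if t \<in> N then 0 else h m (nat \<lfloor>real m * t\<rfloor>)"
  let ?g = "\<lambda>t. if t \<in> N then 0 else ?F t"
  have L0: "0 \<le> L" using L lipschitz_on_nonneg by blast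
  have dn: "norm (d m i) \<le> L" if "i < m" for m i
  proof -
    have "norm (\<gamma> (real (Suc i) / real m) - \<gamma> (real i / real m)) \<le> L * \<bar>real (Suc i) / real m - real i / real m\<bar>"
      using lipschitz_onD[OF L, of "real (Suc i) / real m" "real i / real m"] that
      by (simp add: dist_norm dist_real_def divide_le_eq)
    also have "\<bar>real (Suc i) / real m - real i / real m\<bar> = 1 / real m" using that by (simp add: field_simps)
    finally show ?thesis unfolding d_def norm_scaleR using that by (simp add: field_simps)
  qed
  have hb: "norm (h m i) \<le> m\<^sub>2 * L powr p" for m i
  proof (cases "i < m")
    case True
    then have x: "\<gamma> (real i / real m) \<in> D" by (intro \<gamma>D) (auto simp: divide_le_eq)
    have "f (\<gamma> (real i / real m)) (d m i) \<le> m\<^sub>2 * norm (d m i) powr p" by (rule upper[OF x])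
    also have "\<dots> \<le> m\<^sub>2 * L powr p" using dn[OF True] m2 p by (intro mult_left_mono powr_mono2) auto
    finally show ?thesis using f_nonneg[OF x] True by (simp add: h_def)
  qed (use m2 in \<open>simp add: h_def\<close>)
  have intq0: "((\<lambda>t. h m (nat \<lfloor>real m * t\<rfloor>)) has_integral chord_cost f \<gamma> m) {0..1}" if "m > 0" for m
    using has_integral_step_function[OF that, of "h m"] by (simp add: h_def d_def chord_cost_def)
  have intq: "(?q m has_integral chord_cost f \<gamma> m) {0..1}" if "m > 0" for m
    by (rule has_integral_spike[OF N _ intq0[OF that]]) auto
  have lim: "(\<lambda>m. ?q (Suc m) t) \<longlonglongrightarrow> ?g t" if t: "t \<in> {0..1}" for t
  proof (cases "t \<in> N")
    case False
    then have t01: "0 < t" "t < 1" and tN0: "t \<notin> N0" using t by (auto simp: N_def)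
    then obtain v where v: "(\<gamma> has_vector_derivative v) (at t)"
      using N0(2)[of t] by (auto simp: vector_derivative_works)
    have vd: "vector_derivative \<gamma> (at t within {0..1}) = v"
      using vector_derivative_at_within_ivl[OF v] t01 by simp
    define i where "i = (\<lambda>m. nat \<lfloor>real (Suc m) * t\<rfloor>)"
    define s where "s = (\<lambda>m. real (i m) / real (Suc m))"
    define r where "r = (\<lambda>m. real (Suc (i m)) / real (Suc m))"
    have ri: "real (i m) = of_int \<lfloor>real (Suc m) * t\<rfloor>" for m using t01 by (simp add: i_def)
    have b1: "real (i m) \<le> real (Suc m) * t" and b2: "real (Suc m) * t < real (Suc (i m))" for m
      unfolding of_nat_Suc[of "i m"] ri by linarith+
    have im: "i m < Suc m" for m
    proof -
      have "real (Suc m) * t < real (Suc m) * 1" using t01 by (intro mult_strict_left_mono) auto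
      then have "real (i m) < real (Suc m)" using le_less_trans[OF b1[of m]] by simp
      then show ?thesis by linarith
    qed
    have st: "s m \<le> t" and rt: "t \<le> r m" and sr: "s m < r m" "r m - s m = 1 / real (Suc m)" for m
      using b1[of m] b2[of m] by (auto simp: s_def r_def field_simps)
    have inv: "(\<lambda>m. 1 / real (Suc m)) \<longlonglongrightarrow> 0" by (rule LIMSEQ_Suc[OF lim_1_over_n])
    have slim: "s \<longlonglongrightarrow> t"
    proof (rule tendsto_sandwich[where f="\<lambda>m. t - 1 / real (Suc m)" and h="\<lambda>_. t"])
      show "\<forall>\<^sub>F m in sequentially. t - 1 / real (Suc m) \<le> s m"
        using rt sr by (intro always_eventually allI) (smt (verit))
      show "(\<lambda>m. t - 1 / real (Suc m)) \<longlonglongrightarrow> t" using tendsto_diff[OF tendsto_const inv, of t] by simp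
    qed (use st in auto)
    have rlim: "r \<longlonglongrightarrow> t"
    proof -
      have "r = (\<lambda>m. s m + 1 / real (Suc m))" using sr(2) by (intro ext) (simp add: algebra_simps)
      then show ?thesis using tendsto_add[OF slim inv] by simp
    qed
    have dlim: "(\<lambda>m. d (Suc m) (i m)) \<longlonglongrightarrow> v"
    proof -
      have "d (Suc m) (i m) = (\<gamma> (r m) - \<gamma> (s m)) /\<^sub>R (r m - s m)" for m
        unfolding sr(2) by (simp add: d_def r_def s_def)
      then show ?thesis using has_vector_derivative_straddle[OF v slim rlim st rt sr(1)] by simp
    qed
    have glim: "(\<lambda>m. \<gamma> (s m)) \<longlonglongrightarrow> \<gamma> t"
      using v slim by (intro continuous_imp_tendsto isCont_tendsto_compose[of _ \<gamma>] has_vector_derivative_continuous) auto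
    have sD: "\<gamma> (s m) \<in> D" for m
      using im[of m] by (intro \<gamma>D) (auto simp: s_def divide_le_eq)
    have "(\<lambda>m. case (\<gamma> (s m), d (Suc m) (i m)) of (x, v) \<Rightarrow> f x v) \<longlonglongrightarrow> (case (\<gamma> t, v) of (x, v) \<Rightarrow> f x v)"
      by (rule continuous_on_tendsto_compose[OF cont_f tendsto_Pair[OF glim dlim]]) (use \<gamma>D[OF t] sD in auto)
    then show ?thesis
      using False im by (simp add: vd h_def s_def i_def)
  qed simp
  have int: "?q (Suc m) integrable_on {0..1}" for m
    using intq[of "Suc m"] by blast
  have bnd: "norm (?q (Suc m) t) \<le> m\<^sub>2 * L powr p" for m t
    using hb[of "Suc m" "nat \<lfloor>real (Suc m) * t\<rfloor>"] m2 by auto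
  note dom = dominated_convergence[where f="\<lambda>m. ?q (Suc m)" and g="?g", OF int integrable_const_ivl bnd lim]
  have "integral {0..1} (?q (Suc m)) = chord_cost f \<gamma> (Suc m)" for m
    using intq[of "Suc m"] by (simp add: integral_unique)
  moreover have "integral {0..1} ?g = integral {0..1} ?F"
    by (rule integral_spike[OF N]) auto
  ultimately have "(\<lambda>m. chord_cost f \<gamma> (Suc m)) \<longlonglongrightarrow> path_cost f \<gamma>"
    using dom(2) by (simp add: path_cost_def)
  then show "chord_cost f \<gamma> \<longlonglongrightarrow> path_cost f \<gamma>" by (rule LIMSEQ_imp_Suc)
  show "?F integrable_on {0..1}"
    by (rule integrable_spike[OF dom(1) N]) auto
qed

lemma path_cost_nonneg:
  assumes "\<gamma> \<in> lipschitz_paths D a b"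
  shows "0 \<le> path_cost f \<gamma>"
  unfolding path_cost_def
  using assms path_cost_integrable[OF assms]
  by (intro integral_nonneg f_nonneg) (auto simp: lipschitz_paths_def)

text \<open>
  Jensen's inequality. It passes through the inscribed polygons, for which it is the finite
  inequality for a telescoping sum of chords.
\<close>

lemma convex_minorant_le_path_cost:
  assumes \<gamma>: "\<gamma> \<in> lipschitz_paths D a b" and g: "convex_on UNIV g"
    and le: "\<And>t v. t \<in> {0..1} \<Longrightarrow> g v \<le> f (\<gamma> t) v"
  shows "g (b - a) \<le> path_cost f \<gamma>"
proof (rule LIMSEQ_le_const[OF chord_cost_tendsto[OF \<gamma>]], intro exI[of _ 1] allI impI)
  fix m :: nat assume m: "1 \<le> m"
  let ?d = "\<lambda>i. real m *\<^sub>R (\<gamma> (real (Suc i) / real m) - \<gamma> (real i / real m))"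
  have "(\<Sum>i<m. (1 / real m) *\<^sub>R ?d i) = (\<Sum>i<m. \<gamma> (real (Suc i) / real m) - \<gamma> (real i / real m))"
    using m by simp
  also have "\<dots> = b - a"
    using sum_lessThan_telescope[of "\<lambda>i. \<gamma> (real i / real m)" m] m \<gamma> by (simp add: lipschitz_paths_def)
  finally have "g (b - a) = g (\<Sum>i<m. (1 / real m) *\<^sub>R ?d i)" by simp
  also have "\<dots> \<le> (\<Sum>i<m. (1 / real m) * g (?d i))"
    using m by (intro convex_on_sum[OF _ _ g]) (auto simp: lessThan_empty_iff)
  also have "\<dots> \<le> (\<Sum>i<m. (1 / real m) * f (\<gamma> (real i / real m)) (?d i))"
    by (intro sum_mono mult_left_mono le) (auto simp: divide_le_eq)
  also have "\<dots> = chord_cost f \<gamma> m" by (simp add: chord_cost_def sum_distrib_left)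
  finally show "g (b - a) \<le> chord_cost f \<gamma> m" .
qed

lemma norm_powr_le_path_cost:
  assumes \<gamma>: "\<gamma> \<in> lipschitz_paths D a b"
  shows "m\<^sub>1 * norm (b - a) powr p \<le> path_cost f \<gamma>"
proof (rule convex_minorant_le_path_cost[OF \<gamma>, where g="\<lambda>v. m\<^sub>1 * norm v powr p"])
  show "convex_on UNIV (\<lambda>v::'a. m\<^sub>1 * norm v powr p)"
    using m1 by (intro convex_on_cmul convex_on_norm_powr p) simp
qed (use \<gamma> in \<open>auto intro!: lower simp: lipschitz_paths_def\<close>)

lemma frozen_cost_le_path_cost:
  assumes \<gamma>: "\<gamma> \<in> lipschitz_paths D a b" and x: "x \<in> D"
    and near: "\<And>t. t \<in> {0..1} \<Longrightarrow> norm (\<gamma> t - x) \<le> r"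
  shows "f x (b - a) \<le> (1 + c * r / m\<^sub>1) * path_cost f \<gamma>"
proof -
  have "0 \<le> r" using near[of 0] norm_ge_zero order_trans by (metis atLeastAtMost_iff order_refl zero_le_one)
  then have pos: "0 < 1 + c * r / m\<^sub>1" using c m1 by (intro add_pos_nonneg) auto
  have "(1 / (1 + c * r / m\<^sub>1)) * f x (b - a) \<le> path_cost f \<gamma>"
  proof (rule convex_minorant_le_path_cost[OF \<gamma>, where g="\<lambda>v. (1 / (1 + c * r / m\<^sub>1)) * f x v"])
    show "convex_on UNIV (\<lambda>v. 1 / (1 + c * r / m\<^sub>1) * f x v)"
      using pos by (intro convex_on_cmul convex_f x) simp
    fix t :: real and v assume t: "t \<in> {0..1}"
    have "f x v \<le> (1 + c * r / m\<^sub>1) * f (\<gamma> t) v"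
      using \<gamma> t near[OF t] x by (intro f_le_f_at_nearby_point) (auto simp: lipschitz_paths_def)
    then show "1 / (1 + c * r / m\<^sub>1) * f x v \<le> f (\<gamma> t) v"
      using pos by (simp add: divide_le_eq mult.commute)
  qed
  then show ?thesis using pos by (simp add: divide_le_eq mult.commute)
qed

definition segment_cost :: "(real \<Rightarrow> 'a) \<Rightarrow> real \<Rightarrow> real \<Rightarrow> real" where
  "segment_cost \<gamma> s t = integral {s..t} (\<lambda>t. f (\<gamma> t) (vector_derivative \<gamma> (at t within {0..1})))"

lemma segment_cost_0_1: "segment_cost \<gamma> 0 1 = path_cost f \<gamma>"
  by (simp add: segment_cost_def path_cost_def)

lemma segment_cost_refl: "segment_cost \<gamma> s s = 0"
  by (simp add: segment_cost_def)

lemma segment_cost_integrable: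
  assumes "\<gamma> \<in> lipschitz_paths D a b" "0 \<le> s" "t \<le> 1"
  shows "(\<lambda>t. f (\<gamma> t) (vector_derivative \<gamma> (at t within {0..1}))) integrable_on {s..t}"
  using integrable_on_subinterval[OF path_cost_integrable[OF assms(1)]] assms by auto

lemma segment_cost_combine:
  assumes "\<gamma> \<in> lipschitz_paths D a b" "0 \<le> s" "s \<le> t" "t \<le> u" "u \<le> 1"
  shows "segment_cost \<gamma> s t + segment_cost \<gamma> t u = segment_cost \<gamma> s u"
  unfolding segment_cost_def
  using assms by (intro Henstock_Kurzweil_Integration.integral_combine segment_cost_integrable) auto

lemma segment_cost_nonneg:
  assumes "\<gamma> \<in> lipschitz_paths D a b" "0 \<le> s" "t \<le> 1"
  shows "0 \<le> segment_cost \<gamma> s t"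
  unfolding segment_cost_def using assms
  by (intro integral_nonneg f_nonneg segment_cost_integrable) (auto simp: lipschitz_paths_def)

lemma segment_cost_le_path_cost:
  assumes "\<gamma> \<in> lipschitz_paths D a b" "0 \<le> s" "s \<le> t" "t \<le> 1"
  shows "segment_cost \<gamma> s t \<le> path_cost f \<gamma>"
  using segment_cost_combine[OF assms(1), of 0 s 1] segment_cost_combine[OF assms(1), of s t 1]
    segment_cost_nonneg[OF assms(1), of 0 s] segment_cost_nonneg[OF assms(1), of t 1] assms
  by (simp add: segment_cost_0_1)

text \<open>
  Running through the piece of a path between times \<open>s\<close> and \<open>t\<close> in unit time multiplies its velocity by
  \<open>t - s\<close>. By homogeneity this multiplies the integrand by \<open>(t - s) powr p\<close>, of which the change of
  variables takes back one factor.
\<close>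

lemma subpath_rescaled:
  assumes \<gamma>: "\<gamma> \<in> lipschitz_paths D a b" and s: "0 \<le> s" and st: "s < t" and t: "t \<le> 1"
  shows subpath_in_lipschitz_paths: "(\<lambda>u. \<gamma> (s + (t - s) * u)) \<in> lipschitz_paths D (\<gamma> s) (\<gamma> t)"
    and path_cost_subpath: "path_cost f (\<lambda>u. \<gamma> (s + (t - s) * u)) = (t - s) powr (p - 1) * segment_cost \<gamma> s t"
proof -
  define \<eta> where "\<eta> = (\<lambda>u. \<gamma> (s + (t - s) * u))"
  obtain L where L: "L-lipschitz_on {0..1} \<gamma>" and \<gamma>D: "\<And>t. t \<in> {0..1} \<Longrightarrow> \<gamma> t \<in> D"
    using \<gamma> unfolding lipschitz_paths_def by blast
  have in01: "s + (t - s) * u \<in> {0..1}" if "u \<in> {0..1}" for u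
  proof -
    have "(t - s) * u \<le> t - s" using that st by (simp add: mult_left_le)
    moreover have "0 \<le> (t - s) * u" using that st by simp
    ultimately have "0 \<le> s + (t - s) * u" "s + (t - s) * u \<le> 1" using s t by linarith+
    then show ?thesis by simp
  qed
  have "((t - s) * L)-lipschitz_on {0..1} \<eta>"
  proof (rule lipschitz_onI)
    show "0 \<le> (t - s) * L" using st lipschitz_on_nonneg[OF L] by simp
    fix u w :: real assume "u \<in> {0..1}" "w \<in> {0..1}"
    then have "dist (\<eta> u) (\<eta> w) \<le> L * dist (s + (t - s) * u) (s + (t - s) * w)"
      unfolding \<eta>_def by (intro lipschitz_onD[OF L] in01)
    also have "dist (s + (t - s) * u) (s + (t - s) * w) = (t - s) * dist u w"
      using st by (simp add: dist_real_def abs_mult flip: right_diff_distrib)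
    finally show "dist (\<eta> u) (\<eta> w) \<le> (t - s) * L * dist u w" by (simp add: mult_ac)
  qed
  then show "(\<lambda>u. \<gamma> (s + (t - s) * u)) \<in> lipschitz_paths D (\<gamma> s) (\<gamma> t)"
    using \<gamma>D in01 by (auto simp: lipschitz_paths_def \<eta>_def image_subset_iff)
  obtain N where N: "negligible N" "\<And>t. t \<in> {0<..<1} - N \<Longrightarrow> \<gamma> differentiable (at t)"
    using Lipschitz_imp_differentiable_ae[OF L] by blast
  let ?F = "\<lambda>t. f (\<gamma> t) (vector_derivative \<gamma> (at t within {0..1}))"
  define N' where "N' = (\<lambda>x. (x - s) / (t - s)) ` N \<union> {0, 1}"
  have N': "negligible N'"
    unfolding N'_def using N(1)
    by (intro negligible_Un negligible_differentiable_image_negligible)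
      (auto simp: divide_inverse intro!: derivative_intros)
  have "(?F has_integral segment_cost \<gamma> s t) (cbox s t)"
    using segment_cost_integrable[OF \<gamma> s t] by (simp add: segment_cost_def integrable_integral)
  from has_integral_affinity'[OF this, of "t - s" s]
  have "((\<lambda>u. ?F ((t - s) * u + s)) has_integral segment_cost \<gamma> s t / (t - s)) {0..1}"
    using st by (simp add: divide_inverse mult.commute)
  from has_integral_mult_right[OF this, of "(t - s) powr p"]
  have "((\<lambda>u. (t - s) powr p * ?F ((t - s) * u + s)) has_integral (t - s) powr (p - 1) * segment_cost \<gamma> s t) {0..1}"
    using st by (simp add: powr_diff)
  then have "((\<lambda>u. f (\<eta> u) (vector_derivative \<eta> (at u within {0..1}))) has_integral (t - s) powr (p - 1) * segment_cost \<gamma> s t) {0..1}"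
  proof (rule has_integral_spike[OF N', rotated])
    fix u assume u: "u \<in> {0..1} - N'"
    define w where "w = s + (t - s) * u"
    have u01: "0 < u" "u < 1" using u by (auto simp: N'_def)
    have "(t - s) * u < (t - s) * 1" using u01 st by (intro mult_strict_left_mono) auto
    moreover have "0 < (t - s) * u" using u01 st by simp
    ultimately have w01: "0 < w" "w < 1" using s t by (simp_all add: w_def)
    have "w \<notin> N"
    proof
      assume "w \<in> N"
      then have "(w - s) / (t - s) \<in> N'" unfolding N'_def by blast
      then show False using u st by (simp add: w_def)
    qed
    then obtain v where v: "(\<gamma> has_vector_derivative v) (at w)"
      using N(2)[of w] w01 by (auto simp: vector_derivative_works)
    have "((\<gamma> \<circ> (\<lambda>u. s + (t - s) * u)) has_vector_derivative ((t - s) *\<^sub>R v)) (at u)"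
      by (rule vector_diff_chain_at) (use v in \<open>auto simp: w_def intro!: derivative_eq_intros\<close>)
    then have "(\<eta> has_vector_derivative ((t - s) *\<^sub>R v)) (at u)" by (simp add: \<eta>_def o_def)
    then have "vector_derivative \<eta> (at u within {0..1}) = (t - s) *\<^sub>R v"
      using u01 by (intro vector_derivative_at_within_ivl) auto
    moreover have "vector_derivative \<gamma> (at w within {0..1}) = v"
      using w01 by (intro vector_derivative_at_within_ivl[OF v]) auto
    moreover have "\<eta> u = \<gamma> w" by (simp add: \<eta>_def w_def)
    moreover have "f (\<gamma> w) ((t - s) *\<^sub>R v) = (t - s) powr p * f (\<gamma> w) v"
      using w01 st by (intro homogeneous \<gamma>D) auto
    ultimately show "f (\<eta> u) (vector_derivative \<eta> (at u within {0..1})) = (t - s) powr p * ?F ((t - s) * u + s)"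
      by (simp add: w_def add.commute)
  qed
  then show "path_cost f (\<lambda>u. \<gamma> (s + (t - s) * u)) = (t - s) powr (p - 1) * segment_cost \<gamma> s t"
    unfolding path_cost_def \<eta>_def by (rule integral_unique)
qed

lemma concatenation:
  assumes \<alpha>: "\<alpha> \<in> lipschitz_paths D x y" and \<beta>: "\<beta> \<in> lipschitz_paths D y z" and \<theta>: "0 < \<theta>" "\<theta> < 1"
  obtains \<gamma> where "\<gamma> \<in> lipschitz_paths D x z"
    "path_cost f \<gamma> = path_cost f \<alpha> / \<theta> powr (p - 1) + path_cost f \<beta> / (1 - \<theta>) powr (p - 1)"
proof -
  define \<gamma> where "\<gamma> = (\<lambda>t. if t \<le> \<theta> then \<alpha> (t / \<theta>) else \<beta> ((t - \<theta>) / (1 - \<theta>)))"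
  obtain A where A: "A-lipschitz_on {0..1} \<alpha>" using \<alpha> by (auto simp: lipschitz_paths_def)
  obtain B where B: "B-lipschitz_on {0..1} \<beta>" using \<beta> by (auto simp: lipschitz_paths_def)
  have ends: "\<alpha> 0 = x" "\<alpha> 1 = y" "\<beta> 0 = y" "\<beta> 1 = z" using \<alpha> \<beta> by (auto simp: lipschitz_paths_def)
  have lA: "(A / \<theta>)-lipschitz_on {0..\<theta>} (\<lambda>t. \<alpha> (t / \<theta>))"
  proof (rule lipschitz_onI)
    show "0 \<le> A / \<theta>" using \<theta> lipschitz_on_nonneg[OF A] by simp
    fix u w assume "u \<in> {0..\<theta>}" "w \<in> {0..\<theta>}"
    then have "dist (\<alpha> (u / \<theta>)) (\<alpha> (w / \<theta>)) \<le> A * dist (u / \<theta>) (w / \<theta>)"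
      using \<theta> by (intro lipschitz_onD[OF A]) auto
    also have "dist (u / \<theta>) (w / \<theta>) = dist u w / \<theta>"
      using \<theta> by (simp add: dist_real_def flip: diff_divide_distrib)
    finally show "dist (\<alpha> (u / \<theta>)) (\<alpha> (w / \<theta>)) \<le> A / \<theta> * dist u w" by simp
  qed
  have lB: "(B / (1 - \<theta>))-lipschitz_on {\<theta>..1} (\<lambda>t. \<beta> ((t - \<theta>) / (1 - \<theta>)))"
  proof (rule lipschitz_onI)
    show "0 \<le> B / (1 - \<theta>)" using \<theta> lipschitz_on_nonneg[OF B] by simp
    fix u w assume "u \<in> {\<theta>..1}" "w \<in> {\<theta>..1}"
    then have "dist (\<beta> ((u - \<theta>) / (1 - \<theta>))) (\<beta> ((w - \<theta>) / (1 - \<theta>))) \<le> B * dist ((u - \<theta>) / (1 - \<theta>)) ((w - \<theta>) / (1 - \<theta>))"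
      using \<theta> by (intro lipschitz_onD[OF B]) auto
    also have "dist ((u - \<theta>) / (1 - \<theta>)) ((w - \<theta>) / (1 - \<theta>)) = dist u w / (1 - \<theta>)"
      using \<theta> by (simp add: dist_real_def flip: diff_divide_distrib)
    finally show "dist (\<beta> ((u - \<theta>) / (1 - \<theta>))) (\<beta> ((w - \<theta>) / (1 - \<theta>))) \<le> B / (1 - \<theta>) * dist u w" by simp
  qed
  have "(max (A / \<theta>) (B / (1 - \<theta>)))-lipschitz_on {0..1} \<gamma>"
    unfolding \<gamma>_def by (rule lipschitz_on_concat_max[OF lA lB]) (use ends \<theta> in auto)
  moreover have "\<gamma> t \<in> D" if "t \<in> {0..1}" for t
  proof (cases "t \<le> \<theta>")
    case True
    then have "t / \<theta> \<in> {0..1}" using that \<theta> by auto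
    then show ?thesis using True \<alpha> by (auto simp: \<gamma>_def lipschitz_paths_def)
  next
    case False
    then have "(t - \<theta>) / (1 - \<theta>) \<in> {0..1}" using that \<theta> by auto
    then show ?thesis using False \<beta> by (auto simp: \<gamma>_def lipschitz_paths_def)
  qed
  moreover have "\<gamma> 0 = x" "\<gamma> 1 = z" using ends \<theta> by (auto simp: \<gamma>_def)
  ultimately have \<gamma>: "\<gamma> \<in> lipschitz_paths D x z"
    unfolding lipschitz_paths_def by blast
  have "path_cost f \<alpha> = path_cost f (\<lambda>u. \<gamma> (0 + (\<theta> - 0) * u))"
    by (rule path_cost_cong) (use \<theta> in \<open>auto simp: \<gamma>_def mult_left_le\<close>)
  also have "\<dots> = \<theta> powr (p - 1) * segment_cost \<gamma> 0 \<theta>"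
    using path_cost_subpath[OF \<gamma>, of 0 \<theta>] \<theta> by simp
  finally have a: "segment_cost \<gamma> 0 \<theta> = path_cost f \<alpha> / \<theta> powr (p - 1)" using \<theta> by simp
  have "path_cost f \<beta> = path_cost f (\<lambda>u. \<gamma> (\<theta> + (1 - \<theta>) * u))"
  proof (rule path_cost_cong)
    fix u :: real assume u: "u \<in> {0..1}"
    show "\<beta> u = \<gamma> (\<theta> + (1 - \<theta>) * u)"
    proof (cases "u = 0")
      case True
      then show ?thesis using ends \<theta> by (simp add: \<gamma>_def)
    next
      case False
      then have "0 < (1 - \<theta>) * u" using u \<theta> by simp
      then show ?thesis using \<theta> by (simp add: \<gamma>_def)
    qed
  qed
  also have "\<dots> = (1 - \<theta>) powr (p - 1) * segment_cost \<gamma> \<theta> 1"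
    using path_cost_subpath[OF \<gamma>, of \<theta> 1] \<theta> by simp
  finally have b: "segment_cost \<gamma> \<theta> 1 = path_cost f \<beta> / (1 - \<theta>) powr (p - 1)" using \<theta> by simp
  have "path_cost f \<gamma> = segment_cost \<gamma> 0 \<theta> + segment_cost \<gamma> \<theta> 1"
    using segment_cost_combine[OF \<gamma>, of 0 \<theta> 1] \<theta> by (simp add: segment_cost_0_1)
  then show ?thesis using that[OF \<gamma>] a b by simp
qed

end

section \<open>Minimizing sequences\<close>

context homogeneous_lagrangian
begin

definition action :: "'a \<Rightarrow> 'a \<Rightarrow> real" where
  "action x y = (INF \<gamma>\<in>lipschitz_paths D x y. path_cost f \<gamma>)"

text \<open>
  With this exponent the minimal cost behaves like the length of a shortest path: it obeys the
  triangle inequality, and travelling in time \<open>\<tau>\<close> costs at least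
  \<open>optimal_length x y powr p / \<tau> powr (p - 1)\<close>.
\<close>

definition optimal_length :: "'a \<Rightarrow> 'a \<Rightarrow> real" where
  "optimal_length x y = action x y powr (1 / p)"

lemma bdd_below_path_cost: "bdd_below (path_cost f ` lipschitz_paths D x y)"
  using path_cost_nonneg by (intro bdd_belowI[of _ 0]) auto

lemma lipschitz_paths_nonempty: "x \<in> D \<Longrightarrow> y \<in> D \<Longrightarrow> lipschitz_paths D x y \<noteq> {}"
  using linepath_in_lipschitz_paths[OF convex_D] by blast

lemma action_le: "\<gamma> \<in> lipschitz_paths D x y \<Longrightarrow> action x y \<le> path_cost f \<gamma>"
  unfolding action_def by (rule cINF_lower[OF bdd_below_path_cost])

lemma action_approx:
  assumes "x \<in> D" "y \<in> D" "action x y < B"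
  obtains \<gamma> where "\<gamma> \<in> lipschitz_paths D x y" "path_cost f \<gamma> < B"
  using assms cINF_less_iff[OF lipschitz_paths_nonempty bdd_below_path_cost, of x y B]
  unfolding action_def by blast

lemma action_ge: "x \<in> D \<Longrightarrow> y \<in> D \<Longrightarrow> m\<^sub>1 * norm (y - x) powr p \<le> action x y"
  unfolding action_def by (intro cINF_greatest lipschitz_paths_nonempty norm_powr_le_path_cost)

lemma action_nonneg: "x \<in> D \<Longrightarrow> y \<in> D \<Longrightarrow> 0 \<le> action x y"
  using action_ge[of x y] m1 by (smt (verit, best) mult_nonneg_nonneg powr_ge_zero)

lemma optimal_length_nonneg: "0 \<le> optimal_length x y"
  by (simp add: optimal_length_def)

lemma optimal_length_powr: "x \<in> D \<Longrightarrow> y \<in> D \<Longrightarrow> optimal_length x y powr p = action x y"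
  using p action_nonneg[of x y] by (simp add: optimal_length_def powr_powr)

lemma optimal_length_le:
  assumes "x \<in> D" "y \<in> D" "0 \<le> A" "action x y \<le> A powr p"
  shows "optimal_length x y \<le> A"
proof -
  have "optimal_length x y \<le> (A powr p) powr (1 / p)"
    unfolding optimal_length_def using assms p action_nonneg by (intro powr_mono2) auto
  then show ?thesis using assms p by (simp add: powr_powr)
qed

lemma optimal_length_refl:
  assumes "x \<in> D"
  shows "optimal_length x x = 0"
proof -
  have path: "(\<lambda>_. x) \<in> lipschitz_paths D x x"
    using assms by (auto simp: lipschitz_paths_def intro: lipschitz_on_constant)
  have "vector_derivative (\<lambda>_. x) (at t within {0..1}) = 0" if "t \<in> {0..1}" for t :: real
    using that by (intro vector_derivative_within_closed_interval) auto
  then have "path_cost f (\<lambda>_. x) = integral {0..1} (\<lambda>_::real. 0::real)"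
    unfolding path_cost_def by (intro integral_cong) (simp add: f_zero assms)
  then have "action x x \<le> 0" using action_le[OF path] by simp
  then show ?thesis using action_nonneg[OF assms assms] by (simp add: optimal_length_def)
qed

lemma norm_le_optimal_length:
  assumes "x \<in> D" "y \<in> D"
  shows "m\<^sub>1 powr (1 / p) * norm (y - x) \<le> optimal_length x y"
proof -
  have "(m\<^sub>1 * norm (y - x) powr p) powr (1 / p) \<le> optimal_length x y"
    unfolding optimal_length_def using action_ge[OF assms] m1 p by (intro powr_mono2) auto
  then show ?thesis using m1 p by (simp add: powr_mult powr_powr)
qed

text \<open>
  Concatenate nearly optimal paths, giving each a share of the unit time proportional to its length.
  For lengths \<open>A\<close> and \<open>B\<close> the total cost is then exactly \<open>(A + B) powr p\<close>.
\<close>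

lemma optimal_length_triangle:
  assumes D: "x \<in> D" "y \<in> D" "z \<in> D"
  shows "optimal_length x z \<le> optimal_length x y + optimal_length y z"
proof (rule field_le_epsilon)
  fix e :: real assume e: "0 < e"
  define A where "A = optimal_length x y + e / 2"
  define B where "B = optimal_length y z + e / 2"
  have A: "0 < A" "optimal_length x y < A" and B: "0 < B" "optimal_length y z < B"
    using e optimal_length_nonneg[of x y] optimal_length_nonneg[of y z] by (auto simp: A_def B_def)
  have "action x y < A powr p"
    using powr_less_mono2[OF _ optimal_length_nonneg A(2), of p] p D by (simp add: optimal_length_powr)
  then obtain \<alpha> where \<alpha>: "\<alpha> \<in> lipschitz_paths D x y" "path_cost f \<alpha> < A powr p"
    using action_approx[OF D(1,2)] by blast
  have "action y z < B powr p"
    using powr_less_mono2[OF _ optimal_length_nonneg B(2), of p] p D by (simp add: optimal_length_powr)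
  then obtain \<beta> where \<beta>: "\<beta> \<in> lipschitz_paths D y z" "path_cost f \<beta> < B powr p"
    using action_approx[OF D(2,3)] by blast
  define \<theta> where "\<theta> = A / (A + B)"
  have \<theta>: "0 < \<theta>" "\<theta> < 1" "1 - \<theta> = B / (A + B)" using A B by (auto simp: \<theta>_def field_simps)
  obtain \<gamma> where \<gamma>: "\<gamma> \<in> lipschitz_paths D x z"
    "path_cost f \<gamma> = path_cost f \<alpha> / \<theta> powr (p - 1) + path_cost f \<beta> / (1 - \<theta>) powr (p - 1)"
    using concatenation[OF \<alpha>(1) \<beta>(1) \<theta>(1,2)] by blast
  have eq: "C powr p / (C / (A + B)) powr (p - 1) = C * (A + B) powr (p - 1)" if "0 < C" for C
    using that A B by (simp add: powr_divide powr_diff divide_simps)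
  have "action x z \<le> path_cost f \<gamma>" by (rule action_le[OF \<gamma>(1)])
  also have "\<dots> \<le> A powr p / \<theta> powr (p - 1) + B powr p / (1 - \<theta>) powr (p - 1)"
    unfolding \<gamma>(2) using \<alpha>(2) \<beta>(2) by (intro add_mono divide_right_mono) auto
  also have "\<dots> = (A + B) * (A + B) powr (p - 1)"
    unfolding \<theta>(3) unfolding \<theta>_def by (simp add: eq A B algebra_simps)
  also have "\<dots> = (A + B) powr p"
    using A B by (simp add: powr_diff)
  finally have "optimal_length x z \<le> A + B" using D A B by (intro optimal_length_le) auto
  then show "optimal_length x z \<le> optimal_length x y + optimal_length y z + e" by (simp add: A_def B_def)
qed

lemma lipschitz_path_in_D: "\<gamma> \<in> lipschitz_paths D a b \<Longrightarrow> t \<in> {0..1} \<Longrightarrow> \<gamma> t \<in> D"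
  by (auto simp: lipschitz_paths_def)

lemma action_le_segment_cost:
  assumes \<gamma>: "\<gamma> \<in> lipschitz_paths D a b" and "0 \<le> s" "s < t" "t \<le> 1"
  shows "action (\<gamma> s) (\<gamma> t) \<le> (t - s) powr (p - 1) * segment_cost \<gamma> s t"
  using action_le[OF subpath_in_lipschitz_paths[OF assms]] path_cost_subpath[OF assms] by simp

text \<open>
  The lower bound for the cost of a segment, linearized around speed \<open>l\<close>. In this form it adds up over
  consecutive segments and also holds for a degenerate segment.
\<close>

lemma segment_cost_tangent:
  assumes \<gamma>: "\<gamma> \<in> lipschitz_paths D a b" and s: "0 \<le> s" "s \<le> t" "t \<le> 1" and l: "0 \<le> l"
  shows "(t - s) * l powr p + p * l powr (p - 1) * (optimal_length (\<gamma> s) (\<gamma> t) - (t - s) * l) \<le> segment_cost \<gamma> s t"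
proof (cases "s = t")
  case True
  then show ?thesis using optimal_length_refl[OF lipschitz_path_in_D[OF \<gamma>, of t]] s by (simp add: segment_cost_refl)
next
  case False
  define \<tau> where "\<tau> = t - s"
  have \<tau>: "0 < \<tau>" using False s by (simp add: \<tau>_def)
  let ?e = "optimal_length (\<gamma> s) (\<gamma> t)"
  have D: "\<gamma> s \<in> D" "\<gamma> t \<in> D" using lipschitz_path_in_D[OF \<gamma>] s by auto
  have "\<tau> * l powr p + p * l powr (p - 1) * (?e - \<tau> * l) = \<tau> * (l powr p + p * l powr (p - 1) * (?e / \<tau> - l))"
    using \<tau> by (simp add: field_simps)
  also have "\<dots> \<le> \<tau> * (?e / \<tau>) powr p"
    using \<tau> optimal_length_nonneg by (intro mult_left_mono powr_tangent[OF p _ l]) auto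
  also have "\<dots> = action (\<gamma> s) (\<gamma> t) / \<tau> powr (p - 1)"
    using \<tau> optimal_length_nonneg D by (simp add: powr_divide optimal_length_powr powr_diff)
  also have "\<dots> \<le> segment_cost \<gamma> s t"
    using action_le_segment_cost[OF \<gamma>, of s t] s False \<tau> by (simp add: divide_le_eq \<tau>_def mult.commute)
  finally show ?thesis by (simp add: \<tau>_def)
qed

text \<open>
  Linearize the cost of the parts before \<open>s\<close> and after \<open>t\<close> around the optimal speed \<open>l\<close>, and use the
  triangle inequality to bound their lengths from below by \<open>l - B\<close>, where \<open>B\<close> is the length of the
  middle part. What remains for the average speed \<open>\<beta>\<close> on the middle part is an inequality
  \<open>\<beta> powr p \<le> const + const * \<beta>\<close>, which bounds \<open>\<beta>\<close> because \<open>p > 1\<close>.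
\<close>

lemma near_minimizer_speed:
  assumes \<gamma>: "\<gamma> \<in> lipschitz_paths D a b" and ab: "a \<in> D" "b \<in> D" and s: "0 \<le> s" "s < t" "t \<le> 1"
    and \<delta>: "path_cost f \<gamma> \<le> action a b + (t - s)"
  shows "optimal_length (\<gamma> s) (\<gamma> t) \<le>
    (t - s) * max 1 ((1 + optimal_length a b powr p + p * optimal_length a b powr (p - 1)) powr (1 / (p - 1)))"
proof -
  define l where "l = optimal_length a b"
  define \<tau> where "\<tau> = t - s"
  define B where "B = optimal_length (\<gamma> s) (\<gamma> t)"
  define \<beta> where "\<beta> = B / \<tau>"
  define T where "T = 1 + l powr p + p * l powr (p - 1)"
  have \<tau>: "0 < \<tau>" using s by (simp add: \<tau>_def)
  have l0: "0 \<le> l" and B0: "0 \<le> B" by (simp_all add: l_def B_def optimal_length_nonneg)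
  have D: "\<gamma> s \<in> D" "\<gamma> t \<in> D" using lipschitz_path_in_D[OF \<gamma>] s by auto
  have ends: "\<gamma> 0 = a" "\<gamma> 1 = b" using \<gamma> by (auto simp: lipschitz_paths_def)
  have "l \<le> optimal_length a (\<gamma> s) + B + optimal_length (\<gamma> t) b"
    unfolding l_def B_def
    using optimal_length_triangle[OF ab(1) D(1) ab(2)] optimal_length_triangle[OF D(1) D(2) ab(2)] by linarith
  then have tri: "p * l powr (p - 1) * (l - B) \<le> p * l powr (p - 1) * (optimal_length a (\<gamma> s) + optimal_length (\<gamma> t) b)"
    using p by (intro mult_left_mono) auto
  have e1: "s * l powr p + p * l powr (p - 1) * (optimal_length a (\<gamma> s) - s * l) \<le> segment_cost \<gamma> 0 s"
    using segment_cost_tangent[OF \<gamma> _ _ _ l0, of 0 s] s ends by simp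
  have e2: "(1 - t) * l powr p + p * l powr (p - 1) * (optimal_length (\<gamma> t) b - (1 - t) * l) \<le> segment_cost \<gamma> t 1"
    using segment_cost_tangent[OF \<gamma> _ _ _ l0, of t 1] s ends by simp
  have e3: "\<tau> * \<beta> powr p \<le> segment_cost \<gamma> s t"
  proof -
    have "\<tau> * \<beta> powr p = action (\<gamma> s) (\<gamma> t) / \<tau> powr (p - 1)"
      using \<tau> B0 D by (simp add: \<beta>_def B_def powr_divide optimal_length_powr powr_diff)
    then show ?thesis
      using action_le_segment_cost[OF \<gamma> s] \<tau> by (simp add: divide_le_eq \<tau>_def mult.commute)
  qed
  have tot: "segment_cost \<gamma> 0 s + segment_cost \<gamma> s t + segment_cost \<gamma> t 1 = path_cost f \<gamma>"
    using segment_cost_combine[OF \<gamma>, of 0 s t] segment_cost_combine[OF \<gamma>, of 0 t 1] s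
    by (simp add: segment_cost_0_1)
  have la: "action a b = l powr p" using ab by (simp add: l_def optimal_length_powr)
  define P where "P = p * l powr (p - 1)"
  have P0: "0 \<le> P" using p by (simp add: P_def)
  have "s * l powr p + P * optimal_length a (\<gamma> s) - s * (P * l) + ((1 - t) * l powr p + P * optimal_length (\<gamma> t) b - (1 - t) * (P * l)) + \<tau> * \<beta> powr p
      \<le> l powr p + \<tau>"
    using e1 e2 e3 tot \<delta> la unfolding \<tau>_def P_def by (simp add: algebra_simps)
  moreover have "P * l - P * B \<le> P * optimal_length a (\<gamma> s) + P * optimal_length (\<gamma> t) b"
    using tri by (simp add: P_def algebra_simps)
  ultimately have "\<tau> * \<beta> powr p + \<tau> * (P * l) \<le> \<tau> + \<tau> * l powr p + P * B"
    unfolding \<tau>_def by (simp add: algebra_simps)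
  moreover have "P * B = \<tau> * (P * \<beta>)" using \<tau> by (simp add: \<beta>_def)
  moreover have "0 \<le> \<tau> * (P * l)" using \<tau> P0 l0 by simp
  moreover have "\<tau> * (1 + l powr p + P * \<beta>) = \<tau> + \<tau> * l powr p + \<tau> * (P * \<beta>)"
    by (simp add: algebra_simps)
  ultimately have "\<tau> * \<beta> powr p \<le> \<tau> * (1 + l powr p + P * \<beta>)" by linarith
  then have main: "\<beta> powr p \<le> 1 + l powr p + P * \<beta>" using \<tau> by simp
  have "\<beta> \<le> max 1 (T powr (1 / (p - 1)))"
  proof (cases "\<beta> \<le> 1")
    case False
    have "\<beta> * \<beta> powr (p - 1) = \<beta> powr p" using False by (simp add: powr_diff)
    also have "\<dots> \<le> \<beta> * (1 + l powr p) + P * \<beta>"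
    proof -
      have "1 * (1 + l powr p) \<le> \<beta> * (1 + l powr p)" using False by (intro mult_right_mono) auto
      then show ?thesis using main by simp
    qed
    also have "\<dots> = \<beta> * T" by (simp add: T_def P_def algebra_simps)
    finally have "\<beta> powr (p - 1) \<le> T" using False by simp
    then have "(\<beta> powr (p - 1)) powr (1 / (p - 1)) \<le> T powr (1 / (p - 1))"
      using p by (intro powr_mono2) auto
    then show ?thesis using False p by (simp add: powr_powr)
  qed simp
  then have "\<tau> * \<beta> \<le> \<tau> * max 1 (T powr (1 / (p - 1)))" using \<tau> by (intro mult_left_mono) auto
  then show ?thesis using \<tau> by (simp add: \<beta>_def \<tau>_def B_def T_def l_def)
qed

lemma path_cost_eq_sum_segments:
  assumes \<gamma>: "\<gamma> \<in> lipschitz_paths D a b" and m: "m > 0"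
  shows "path_cost f \<gamma> = (\<Sum>i<m. segment_cost \<gamma> (real i / real m) (real (Suc i) / real m))"
proof -
  have "(\<Sum>i<k. segment_cost \<gamma> (real i / real m) (real (Suc i) / real m)) = segment_cost \<gamma> 0 (real k / real m)"
    if "k \<le> m" for k
    using that
  proof (induction k)
    case (Suc k)
    then show ?case
      using segment_cost_combine[OF \<gamma>, of 0 "real k / real m" "real (Suc k) / real m"] m
      by (simp add: divide_right_mono del: of_nat_Suc)
  qed (simp add: segment_cost_refl)
  from this[of m] m show ?thesis by (simp add: segment_cost_0_1)
qed

text \<open>
  Jensen's inequality on each of \<open>m\<close> pieces of equal duration, with the base point frozen at \<open>x i\<close>
  on the \<open>i\<close>-th one. In the application the points \<open>x i\<close> lie on
  a limit path nearby.
\<close>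

lemma frozen_sum_le_path_cost:
  assumes \<gamma>: "\<gamma> \<in> lipschitz_paths D a b" and m: "m > 0"
    and x: "\<And>i. i < m \<Longrightarrow> x i \<in> D"
    and near: "\<And>i t. i < m \<Longrightarrow> real i / real m \<le> t \<Longrightarrow> t \<le> real (Suc i) / real m \<Longrightarrow> norm (\<gamma> t - x i) \<le> r"
  shows "(1 / real m) * (\<Sum>i<m. f (x i) (real m *\<^sub>R (\<gamma> (real (Suc i) / real m) - \<gamma> (real i / real m))))
    \<le> (1 + c * r / m\<^sub>1) * path_cost f \<gamma>"
proof -
  let ?t = "\<lambda>i. real i / real m"
  have "(1 / real m) * f (x i) (real m *\<^sub>R (\<gamma> (?t (Suc i)) - \<gamma> (?t i)))
      \<le> (1 + c * r / m\<^sub>1) * segment_cost \<gamma> (?t i) (?t (Suc i))" if i: "i < m" for i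
  proof -
    have t: "0 \<le> ?t i" "?t i < ?t (Suc i)" "?t (Suc i) \<le> 1" "?t (Suc i) - ?t i = 1 / real m"
      using i by (auto simp: field_simps)
    let ?\<eta> = "\<lambda>u. \<gamma> (?t i + (?t (Suc i) - ?t i) * u)"
    have "f (x i) (\<gamma> (?t (Suc i)) - \<gamma> (?t i)) \<le> (1 + c * r / m\<^sub>1) * path_cost f ?\<eta>"
    proof (rule frozen_cost_le_path_cost[OF subpath_in_lipschitz_paths[OF \<gamma> t(1-3)] x[OF i]])
      fix u :: real assume u: "u \<in> {0..1}"
      have "(1 / real m) * u \<le> 1 / real m" using u by (simp add: mult_left_le divide_right_mono)
      then show "norm (?\<eta> u - x i) \<le> r"
        using t u by (intro near i) (auto simp: t(4))
    qed
    also have "path_cost f ?\<eta> = (1 / real m) powr (p - 1) * segment_cost \<gamma> (?t i) (?t (Suc i))"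
      using path_cost_subpath[OF \<gamma> t(1-3)] unfolding t(4) .
    finally have *: "f (x i) (\<gamma> (?t (Suc i)) - \<gamma> (?t i))
        \<le> (1 + c * r / m\<^sub>1) * ((1 / real m) powr (p - 1) * segment_cost \<gamma> (?t i) (?t (Suc i)))" .
    have pw: "real m powr (p - 1) * (1 / real m) powr (p - 1) = 1"
      using m by (simp flip: powr_mult)
    have "(1 / real m) * f (x i) (real m *\<^sub>R (\<gamma> (?t (Suc i)) - \<gamma> (?t i)))
        = real m powr (p - 1) * f (x i) (\<gamma> (?t (Suc i)) - \<gamma> (?t i))"
      using m by (subst homogeneous[OF x[OF i]]) (auto simp: powr_diff)
    also have "\<dots> \<le> real m powr (p - 1) * ((1 + c * r / m\<^sub>1) * ((1 / real m) powr (p - 1) * segment_cost \<gamma> (?t i) (?t (Suc i))))"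
      using * by (intro mult_left_mono) auto
    also have "\<dots> = (real m powr (p - 1) * (1 / real m) powr (p - 1)) * ((1 + c * r / m\<^sub>1) * segment_cost \<gamma> (?t i) (?t (Suc i)))"
      by (simp only: mult_ac)
    finally show ?thesis unfolding pw by simp
  qed
  then have "(\<Sum>i<m. (1 / real m) * f (x i) (real m *\<^sub>R (\<gamma> (?t (Suc i)) - \<gamma> (?t i))))
      \<le> (\<Sum>i<m. (1 + c * r / m\<^sub>1) * segment_cost \<gamma> (?t i) (?t (Suc i)))"
    by (intro sum_mono) auto
  then show ?thesis
    unfolding path_cost_eq_sum_segments[OF \<gamma> m] sum_distrib_left .
qed


text \<open>
  Covering the distance \<open>l\<close> in time \<open>\<tau>\<close> costs at least \<open>m\<^sub>1 * l powr p / \<tau> powr (p - 1)\<close>. A bound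
  on the cost therefore gives Hoelder continuity with exponent \<open>(p - 1) / p\<close>.
\<close>

lemma near_minimizers_equicontinuous:
  assumes \<gamma>: "\<And>n :: nat. \<gamma> n \<in> lipschitz_paths D a b" and C: "\<And>n. path_cost f (\<gamma> n) \<le> C" and e: "0 < e"
  obtains d where "0 < d" "\<And>n s t. s \<in> {0..1} \<Longrightarrow> t \<in> {0..1} \<Longrightarrow> \<bar>s - t\<bar> < d \<Longrightarrow> norm (\<gamma> n s - \<gamma> n t) < e"
proof -
  define C' where "C' = \<bar>C\<bar> + 1"
  have C': "0 < C'" "C \<le> C'" by (auto simp: C'_def)
  \<comment> \<open>The solution of \<open>m\<^sub>1 * e powr p = d powr (p - 1) * C'\<close>.\<close>
  define d where "d = (e powr p * m\<^sub>1 / C') powr (1 / (p - 1))"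
  have d: "0 < d" using e m1 C' by (simp add: d_def)
  have dp: "d powr (p - 1) = e powr p * m\<^sub>1 / C'"
    using p e m1 C' by (simp add: d_def powr_powr)
  have *: "norm (\<gamma> n t - \<gamma> n s) < e" if st: "s \<in> {0..1}" "t \<in> {0..1}" "s < t" "t - s < d" for n s t
  proof -
    have "m\<^sub>1 * norm (\<gamma> n t - \<gamma> n s) powr p \<le> action (\<gamma> n s) (\<gamma> n t)"
      using st by (intro action_ge lipschitz_path_in_D[OF \<gamma>])
    also have "\<dots> \<le> (t - s) powr (p - 1) * segment_cost (\<gamma> n) s t"
      using st by (intro action_le_segment_cost[OF \<gamma>]) auto
    also have "\<dots> \<le> (t - s) powr (p - 1) * C'"
      using segment_cost_le_path_cost[OF \<gamma>, of s t n] C[of n] C' st by (intro mult_left_mono) auto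
    also have "\<dots> < d powr (p - 1) * C'"
      using st p C' by (intro mult_strict_right_mono powr_less_mono2) auto
    also have "\<dots> = m\<^sub>1 * e powr p" using C' by (simp add: dp)
    finally have "norm (\<gamma> n t - \<gamma> n s) powr p < e powr p" using m1 by simp
    then show ?thesis
      using powr_mono2[of p e "norm (\<gamma> n t - \<gamma> n s)"] p e by (smt (verit))
  qed
  show ?thesis
  proof (rule that[OF d])
    fix n s t assume st: "s \<in> {0..1::real}" "t \<in> {0..1}" "\<bar>s - t\<bar> < d"
    consider "s < t" | "t < s" | "s = t" by linarith
    then show "norm (\<gamma> n s - \<gamma> n t) < e"
    proof cases
      case 1
      then show ?thesis using *[of s t n] st by (simp add: norm_minus_commute)
    next
      case 2
      then show ?thesis using *[of t s n] st by simp
    qed (use e in simp)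
  qed
qed

text \<open>
  For a fixed pair of times the excess cost eventually drops below their difference, so
  \<open>near_minimizer_speed\<close> applies with a constant independent of the pair.
\<close>

lemma uniform_limit_of_near_minimizers_Lipschitz:
  assumes ab: "a \<in> D" "b \<in> D" and \<gamma>: "\<And>n :: nat. \<gamma> n \<in> lipschitz_paths D a b"
    and cost: "(\<lambda>n. path_cost f (\<gamma> n)) \<longlonglongrightarrow> action a b"
    and lim: "\<And>t. t \<in> {0..1} \<Longrightarrow> (\<lambda>n. \<gamma> n t) \<longlonglongrightarrow> \<eta> t"
  shows "\<eta> \<in> lipschitz_paths D a b"
proof -
  define K where "K = max 1 ((1 + optimal_length a b powr p + p * optimal_length a b powr (p - 1)) powr (1 / (p - 1)))"
  define M where "M = m\<^sub>1 powr (1 / p)"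
  have M: "0 < M" using m1 by (simp add: M_def)
  have K: "0 \<le> K" by (simp add: K_def)
  have inc: "norm (\<eta> t - \<eta> s) \<le> K / M * (t - s)" if st: "0 \<le> s" "s < t" "t \<le> 1" for s t
  proof -
    have "\<forall>\<^sub>F n in sequentially. path_cost f (\<gamma> n) < action a b + (t - s)"
      using order_tendstoD(2)[OF cost, of "action a b + (t - s)"] st by simp
    then have "\<forall>\<^sub>F n in sequentially. norm (\<gamma> n t - \<gamma> n s) \<le> K / M * (t - s)"
    proof eventually_elim
      case (elim n)
      have "M * norm (\<gamma> n t - \<gamma> n s) \<le> optimal_length (\<gamma> n s) (\<gamma> n t)"
        unfolding M_def using st by (intro norm_le_optimal_length lipschitz_path_in_D[OF \<gamma>]) auto
      also have "\<dots> \<le> (t - s) * K"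
        unfolding K_def using elim by (intro near_minimizer_speed[OF \<gamma> ab st]) auto
      finally show ?case using M by (simp add: field_simps)
    qed
    moreover have "(\<lambda>n. norm (\<gamma> n t - \<gamma> n s)) \<longlonglongrightarrow> norm (\<eta> t - \<eta> s)"
      using st by (intro tendsto_norm tendsto_diff lim) auto
    ultimately show ?thesis by (intro tendsto_upperbound[where F=sequentially]) auto
  qed
  have "(K / M)-lipschitz_on {0..1} \<eta>"
  proof (rule lipschitz_onI)
    fix s t :: real assume st: "s \<in> {0..1}" "t \<in> {0..1}"
    consider "s < t" | "t < s" | "s = t" by linarith
    then show "dist (\<eta> s) (\<eta> t) \<le> K / M * dist s t"
    proof cases
      case 1
      then show ?thesis using inc[of s t] st by (simp add: dist_norm norm_minus_commute)
    next
      case 2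
      then show ?thesis using inc[of t s] st by (simp add: dist_norm)
    qed simp
  qed (use K M in simp)
  moreover have "\<eta> t \<in> D" if "t \<in> {0..1}" for t
    by (rule closed_sequentially[OF compact_imp_closed[OF compact_D] _ lim[OF that]])
      (use lipschitz_path_in_D[OF \<gamma> that] in auto)
  moreover have "\<gamma> n 0 = a" "\<gamma> n 1 = b" for n using \<gamma>[of n] by (auto simp: lipschitz_paths_def)
  then have "\<eta> 0 = a" "\<eta> 1 = b"
    using LIMSEQ_unique[OF lim[of 0], of a] LIMSEQ_unique[OF lim[of 1], of b] by auto
  ultimately show ?thesis unfolding lipschitz_paths_def by blast
qed

text \<open>
  Compare \<open>\<gamma> n\<close> with the polygon of \<open>m\<close> chords of \<open>\<gamma> n\<close>, with base points frozen on the limit path. As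
  \<open>n\<close> grows this tends to the chord cost of the limit, and as \<open>m\<close> grows the relative error vanishes.
\<close>

lemma path_cost_lower_semicontinuous:
  assumes \<gamma>: "\<And>n :: nat. \<gamma> n \<in> lipschitz_paths D a b" and \<eta>: "\<eta> \<in> lipschitz_paths D a b"
    and lim: "uniform_limit {0..1} \<gamma> \<eta> sequentially"
    and cost: "(\<lambda>n. path_cost f (\<gamma> n)) \<longlonglongrightarrow> A"
  shows "path_cost f \<eta> \<le> A"
proof -
  obtain L where L: "L-lipschitz_on {0..1} \<eta>" using \<eta> by (auto simp: lipschitz_paths_def)
  have L0: "0 \<le> L" using lipschitz_on_nonneg[OF L] .
  \<comment> \<open>The radius \<open>(L + 1) / m\<close> is the sum of \<open>L / m\<close>, the drift of \<open>\<eta>\<close> on one piece, and \<open>1 / m\<close>, a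
      bound for the uniform distance of \<open>\<gamma> n\<close> and \<open>\<eta>\<close>.\<close>
  have "chord_cost f \<eta> m \<le> (1 + c * ((L + 1) / real m) / m\<^sub>1) * A" if m: "m > 0" for m
  proof -
    let ?t = "\<lambda>i. real i / real m"
    have t01: "?t i \<in> {0..1}" if "i \<le> m" for i using that m by (simp add: divide_le_eq)
    let ?S = "\<lambda>n. (1 / real m) * (\<Sum>i<m. f (\<eta> (?t i)) (real m *\<^sub>R (\<gamma> n (?t (Suc i)) - \<gamma> n (?t i))))"
    have "\<forall>\<^sub>F n in sequentially. \<forall>t\<in>{0..1}. dist (\<gamma> n t) (\<eta> t) < 1 / real m"
      using uniform_limitD[OF lim, of "1 / real m"] m by simp
    then have "\<forall>\<^sub>F n in sequentially. ?S n \<le> (1 + c * ((L + 1) / real m) / m\<^sub>1) * path_cost f (\<gamma> n)"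
    proof eventually_elim
      case (elim n)
      show ?case
      proof (rule frozen_sum_le_path_cost[OF \<gamma> m])
        show "\<eta> (?t i) \<in> D" if "i < m" for i using lipschitz_path_in_D[OF \<eta> t01[of i]] that by simp
        fix i t assume i: "i < m" and t: "?t i \<le> t" "t \<le> ?t (Suc i)"
        have "?t i \<in> {0..1}" by (rule t01) (use i in simp)
        moreover have "?t (Suc i) \<in> {0..1}" by (rule t01) (use i in simp)
        ultimately have tt: "t \<in> {0..1}" using t unfolding atLeastAtMost_iff by linarith
        have "norm (\<gamma> n t - \<eta> (?t i)) \<le> dist (\<gamma> n t) (\<eta> t) + dist (\<eta> t) (\<eta> (?t i))"
          unfolding dist_norm[symmetric] by (rule dist_triangle)
        also have "dist (\<eta> t) (\<eta> (?t i)) \<le> L * dist t (?t i)"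
          using lipschitz_onD[OF L tt t01[of i]] i by simp
        also have "L * dist t (?t i) \<le> L * (1 / real m)"
          using t L0 by (intro mult_left_mono) (auto simp: dist_real_def add_divide_distrib)
        also have "dist (\<gamma> n t) (\<eta> t) \<le> 1 / real m" using elim tt by (intro less_imp_le) blast
        finally show "norm (\<gamma> n t - \<eta> (?t i)) \<le> (L + 1) / real m" by (simp add: add_divide_distrib add.commute)
      qed
    qed
    moreover have "?S \<longlonglongrightarrow> chord_cost f \<eta> m"
      unfolding chord_cost_def
    proof (intro tendsto_mult_left tendsto_sum)
      fix i assume "i \<in> {..<m}"
      then have i: "i < m" by simp
      have pt: "(\<lambda>n. \<gamma> n t) \<longlonglongrightarrow> \<eta> t" if "t \<in> {0..1}" for t
        using tendsto_uniform_limitI[OF lim that] .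
      have "(\<lambda>n. real m *\<^sub>R (\<gamma> n (?t (Suc i)) - \<gamma> n (?t i))) \<longlonglongrightarrow> real m *\<^sub>R (\<eta> (?t (Suc i)) - \<eta> (?t i))"
        using i by (intro tendsto_intros pt t01) auto
      then have "(\<lambda>n. case (\<eta> (?t i), real m *\<^sub>R (\<gamma> n (?t (Suc i)) - \<gamma> n (?t i))) of (x, v) \<Rightarrow> f x v)
          \<longlonglongrightarrow> (case (\<eta> (?t i), real m *\<^sub>R (\<eta> (?t (Suc i)) - \<eta> (?t i))) of (x, v) \<Rightarrow> f x v)"
        using i lipschitz_path_in_D[OF \<eta> t01[of i]]
        by (intro continuous_on_tendsto_compose[OF cont_f] tendsto_Pair tendsto_const) auto
      then show "(\<lambda>n. f (\<eta> (?t i)) (real m *\<^sub>R (\<gamma> n (?t (Suc i)) - \<gamma> n (?t i))))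
          \<longlonglongrightarrow> f (\<eta> (?t i)) (real m *\<^sub>R (\<eta> (?t (Suc i)) - \<eta> (?t i)))" by simp
    qed
    ultimately show ?thesis
      by (intro tendsto_le[OF _ tendsto_mult_left[OF cost]]) auto
  qed
  then have "\<forall>\<^sub>F m in sequentially. chord_cost f \<eta> m \<le> (1 + c * ((L + 1) * (1 / real m)) / m\<^sub>1) * A"
    by (intro eventually_mono[OF eventually_gt_at_top[of 0]]) simp
  moreover have "(\<lambda>m. (1 + c * ((L + 1) * (1 / real m)) / m\<^sub>1) * A) \<longlonglongrightarrow> (1 + c * ((L + 1) * 0) / m\<^sub>1) * A"
    by (intro tendsto_intros lim_1_over_n) (use m1 in auto)
  ultimately show ?thesis
    using tendsto_le[OF _ _ chord_cost_tendsto[OF \<eta>]] by simp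
qed

theorem minimizing_sequence_subconverges:
  assumes ab: "a \<in> D" "b \<in> D" and \<gamma>: "\<And>n :: nat. \<gamma> n \<in> lipschitz_paths D a b"
    and cost: "(\<lambda>n. path_cost f (\<gamma> n)) \<longlonglongrightarrow> action a b"
  obtains s \<eta> where "strict_mono (s :: nat \<Rightarrow> nat)" "\<eta> \<in> lipschitz_paths D a b"
    "path_cost f \<eta> = action a b" "uniform_limit {0..1} (\<lambda>k. \<gamma> (s k)) \<eta> sequentially"
proof -
  obtain C where C: "\<And>n. path_cost f (\<gamma> n) \<le> C"
  proof -
    have "Bseq (\<lambda>n. path_cost f (\<gamma> n))" using cost by (intro convergent_imp_Bseq convergentI)
    then obtain C where "\<And>n. norm (path_cost f (\<gamma> n)) \<le> C" unfolding Bseq_def by blast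
    then show ?thesis using that[of C] by (auto simp: abs_le_iff)
  qed
  obtain R where R: "\<And>x. x \<in> D \<Longrightarrow> norm x \<le> R"
    using compact_imp_bounded[OF compact_D] by (auto simp: bounded_iff)
  obtain \<eta> s where s: "strict_mono (s :: nat \<Rightarrow> nat)"
    and u: "\<And>e. 0 < e \<Longrightarrow> \<exists>N. \<forall>n x. n \<ge> N \<and> x \<in> {0..1} \<longrightarrow> norm (\<gamma> (s n) x - \<eta> x) < e"
  proof (rule Arzela_Ascoli[of "{0..1::real}" \<gamma> R])
    show "compact {0..1::real}" by simp
    show "norm (\<gamma> n x) \<le> R" if "x \<in> {0..1}" for n x
      using that by (intro R lipschitz_path_in_D[OF \<gamma>])
    show "\<exists>d. 0 < d \<and> (\<forall>n y. y \<in> {0..1} \<and> norm (x - y) < d \<longrightarrow> norm (\<gamma> n x - \<gamma> n y) < e)"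
      if xe: "x \<in> {0..1}" "0 < e" for x e
    proof -
      obtain d where "0 < d" "\<And>n s t. s \<in> {0..1} \<Longrightarrow> t \<in> {0..1} \<Longrightarrow> \<bar>s - t\<bar> < d \<Longrightarrow> norm (\<gamma> n s - \<gamma> n t) < e"
        using near_minimizers_equicontinuous[of \<gamma> a b C e] \<gamma> C xe(2) by blast
      then show ?thesis using xe(1) by auto
    qed
  qed (use that in blast)
  have ul: "uniform_limit {0..1} (\<lambda>k. \<gamma> (s k)) \<eta> sequentially"
    unfolding uniform_limit_iff eventually_sequentially dist_norm using u by blast
  have cost_s: "(\<lambda>k. path_cost f (\<gamma> (s k))) \<longlonglongrightarrow> action a b"
    using LIMSEQ_subseq_LIMSEQ[OF cost s] by (simp add: o_def)
  have \<eta>: "\<eta> \<in> lipschitz_paths D a b"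
    by (rule uniform_limit_of_near_minimizers_Lipschitz[OF ab \<gamma> cost_s])
      (rule tendsto_uniform_limitI[OF ul])
  have "path_cost f \<eta> = action a b"
    using path_cost_lower_semicontinuous[OF \<gamma> \<eta> ul cost_s] action_le[OF \<eta>] by simp
  then show ?thesis using that s \<eta> ul by blast
qed

lemma argmin_path_cost_iff:
  assumes ab: "a \<in> D" "b \<in> D"
  shows "\<gamma> \<in> argmin_set (path_cost f) (lipschitz_paths D a b) \<longleftrightarrow>
    \<gamma> \<in> lipschitz_paths D a b \<and> path_cost f \<gamma> = action a b"
proof
  assume "\<gamma> \<in> argmin_set (path_cost f) (lipschitz_paths D a b)"
  then have \<gamma>: "\<gamma> \<in> lipschitz_paths D a b"
    and min: "\<And>\<eta>. \<eta> \<in> lipschitz_paths D a b \<Longrightarrow> path_cost f \<gamma> \<le> path_cost f \<eta>"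
    by (auto simp: argmin_set_def is_arg_min_def not_less)
  have "path_cost f \<gamma> \<le> action a b"
    unfolding action_def using min \<gamma> by (intro cINF_greatest) auto
  then show "\<gamma> \<in> lipschitz_paths D a b \<and> path_cost f \<gamma> = action a b"
    using \<gamma> action_le[OF \<gamma>] by simp
next
  assume "\<gamma> \<in> lipschitz_paths D a b \<and> path_cost f \<gamma> = action a b"
  then show "\<gamma> \<in> argmin_set (path_cost f) (lipschitz_paths D a b)"
    using action_le by (auto simp: argmin_set_def is_arg_min_def not_less)
qed

theorem minimizer_exists:
  assumes ab: "a \<in> D" "b \<in> D"
  shows "argmin_set (path_cost f) (lipschitz_paths D a b) \<noteq> {}"
proof -
  have "\<exists>\<gamma>\<in>lipschitz_paths D a b. path_cost f \<gamma> < action a b + 1 / real (Suc n)" for n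
    using action_approx[OF ab, of "action a b + 1 / real (Suc n)"] by fastforce
  then obtain \<gamma> where \<gamma>: "\<And>n. \<gamma> n \<in> lipschitz_paths D a b"
    "\<And>n. path_cost f (\<gamma> n) < action a b + 1 / real (Suc n)" by metis
  have lim: "(\<lambda>n. path_cost f (\<gamma> n)) \<longlonglongrightarrow> action a b"
  proof (rule tendsto_sandwich[where f="\<lambda>_. action a b" and h="\<lambda>n. action a b + 1 / real (Suc n)"])
    show "(\<lambda>n. action a b + 1 / real (Suc n)) \<longlonglongrightarrow> action a b"
      using tendsto_add[OF tendsto_const LIMSEQ_Suc[OF lim_1_over_n], of "action a b"] by simp
    show "\<forall>\<^sub>F n in sequentially. path_cost f (\<gamma> n) \<le> action a b + 1 / real (Suc n)"
      using \<gamma>(2) by (intro always_eventually allI less_imp_le)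
  qed (use \<gamma>(1) action_le in auto)
  obtain \<eta> where "\<eta> \<in> lipschitz_paths D a b" "path_cost f \<eta> = action a b"
    using minimizing_sequence_subconverges[OF ab \<gamma>(1) lim] by blast
  then show ?thesis using argmin_path_cost_iff[OF ab] by blast
qed

end

section \<open>Discrete paths\<close>

text \<open>
  Nonnegativity is included because it needs the suprema to be bounded, as they are here.
\<close>

lemma hausdorff_distance_bounds:
  fixes A B :: "'a::metric_space set"
  assumes A: "A \<noteq> {}" and B: "B \<noteq> {}"
    and AB: "\<And>x. x \<in> A \<Longrightarrow> \<exists>y\<in>B. dist x y \<le> e" and BA: "\<And>y. y \<in> B \<Longrightarrow> \<exists>x\<in>A. dist x y \<le> e"
  shows hausdorff_distance_nonneg: "0 \<le> hausdorff_distance A B"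
    and hausdorff_distance_le: "hausdorff_distance A B \<le> e"
proof -
  have lo: "0 \<le> (INF y\<in>B. dist x y)" for x using B by (intro cINF_greatest) auto
  have up1: "(INF y\<in>B. dist x y) \<le> e" if "x \<in> A" for x
  proof -
    obtain y where "y \<in> B" "dist x y \<le> e" using AB[OF \<open>x \<in> A\<close>] by blast
    then show ?thesis by (intro cINF_lower2[where x=y]) (auto intro!: bdd_belowI[of _ 0])
  qed
  have up2: "(INF x\<in>A. dist x y) \<le> e" if "y \<in> B" for y
  proof -
    obtain x where "x \<in> A" "dist x y \<le> e" using BA[OF \<open>y \<in> B\<close>] by blast
    then show ?thesis by (intro cINF_lower2[where x=x]) (auto intro!: bdd_belowI[of _ 0])
  qed
  show "hausdorff_distance A B \<le> e"
    unfolding hausdorff_distance_def using A B up1 up2 by (intro max.boundedI cSUP_least) auto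
  obtain x where x: "x \<in> A" using A by blast
  have "0 \<le> (INF y\<in>B. dist x y)" by (rule lo)
  also have "\<dots> \<le> (SUP x\<in>A. INF y\<in>B. dist x y)"
    using x up1 by (intro cSUP_upper) (auto intro!: bdd_aboveI[of _ e])
  finally show "0 \<le> hausdorff_distance A B" unfolding hausdorff_distance_def by simp
qed

lemma unit_interval_piece:
  fixes t :: real
  assumes "m > 0" "t \<in> {0..1}"
  obtains i where "i < m" "real i / real m \<le> t" "t \<le> (real i + 1) / real m"
proof (cases "t = 1")
  case True
  then show ?thesis using that[of "m - 1"] assms by (simp add: of_nat_diff divide_le_eq)
next
  case False
  define i where "i = nat \<lfloor>real m * t\<rfloor>"
  have ri: "real i = of_int \<lfloor>real m * t\<rfloor>" using assms by (simp add: i_def)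
  have b: "real i \<le> real m * t" "real m * t < real i + 1" unfolding ri by linarith+
  have "real m * t < real m * 1" using assms False by (intro mult_strict_left_mono) auto
  then have "real i < real m" using b(1) by linarith
  then show ?thesis using that[of i] b assms by (simp add: field_simps)
qed

lemma graph_paths_steps_pos: "v \<in> graph_paths S r a b \<Longrightarrow> 0 < steps v"
  by (simp add: graph_paths_def steps_def)

lemma graph_paths_nth_in:
  assumes "v \<in> graph_paths S r a b" "i \<le> steps v"
  shows "v ! i \<in> S \<union> {a, b}"
proof -
  have "i < length v" using assms by (auto simp: graph_paths_def steps_def)
  then show ?thesis using assms nth_mem by (fastforce simp: graph_paths_def)
qed

text \<open>
  The vertices of a discrete path lie on its interpolation, and every point of the interpolation is
  within an edge length of a vertex.
\<close>

lemma graph_paths_hausdorff_distance: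
  assumes v: "v \<in> graph_paths S r a b"
    and close: "\<And>t. t \<in> {0..1} \<Longrightarrow> dist (linear_interp v t) (\<eta> t) \<le> e"
  shows graph_paths_hausdorff_distance_nonneg: "0 \<le> hausdorff_distance (set v) (path_image \<eta>)"
    and graph_paths_hausdorff_distance_le: "hausdorff_distance (set v) (path_image \<eta>) \<le> e + r"
proof -
  define m where "m = steps v"
  have m: "0 < m" using graph_paths_steps_pos[OF v] by (simp add: m_def)
  have len: "length v = Suc m" using m by (simp add: m_def steps_def)
  have edge: "norm (v ! i - v ! Suc i) < r" if "i < m" for i
    using v that by (simp add: graph_paths_def m_def)
  have r: "0 < r" using edge[OF m] norm_ge_zero le_less_trans by blast
  have node: "linear_interp v (real i / real m) = v ! i" if "i \<le> m" for i
  proof (cases "i = m")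
    case True
    have "1 \<le> (real (m - 1) + 1) / real m" "real (m - 1) / real m \<le> 1" "real m * 1 - real (m - 1) = 1"
      using m by (auto simp: of_nat_diff divide_le_eq)
    then show ?thesis using linear_interp_piece[of "m - 1" v 1] m True by (simp add: m_def)
  next
    case False
    then show ?thesis using linear_interp_piece[of i v "real i / real m"] that m
      by (simp add: m_def divide_right_mono)
  qed
  have ne: "set v \<noteq> {}" "path_image \<eta> \<noteq> {}" using len by auto
  have 1: "\<exists>y\<in>path_image \<eta>. dist x y \<le> e + r" if "x \<in> set v" for x
  proof -
    obtain i where i: "i < length v" "x = v ! i" using \<open>x \<in> set v\<close> by (auto simp: in_set_conv_nth)
    then have t: "real i / real m \<in> {0..1}" using len m by (auto simp: divide_le_eq)
    then have "dist x (\<eta> (real i / real m)) \<le> e" using close[OF t] node[of i] i len by simp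
    then show ?thesis using t r by (intro bexI[of _ "\<eta> (real i / real m)"]) (auto simp: path_image_def)
  qed
  have 2: "\<exists>x\<in>set v. dist x y \<le> e + r" if "y \<in> path_image \<eta>" for y
  proof -
    obtain t where t: "t \<in> {0..1}" "y = \<eta> t" using \<open>y \<in> path_image \<eta>\<close> by (auto simp: path_image_def)
    obtain i where i: "i < m" "real i / real m \<le> t" "t \<le> (real i + 1) / real m"
      using unit_interval_piece[OF m t(1)] by blast
    let ?s = "real m * t - real i"
    have s: "0 \<le> ?s" "?s \<le> 1" using i m by (auto simp: field_simps)
    have "linear_interp v t - v ! i = ?s *\<^sub>R (v ! Suc i - v ! i)"
      using linear_interp_piece[of i v t] i by (simp add: m_def algebra_simps)
    then have "dist (v ! i) (linear_interp v t) = ?s * norm (v ! i - v ! Suc i)"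
      using s by (simp add: dist_norm norm_minus_commute)
    also have "\<dots> \<le> 1 * norm (v ! i - v ! Suc i)" using s by (intro mult_right_mono) auto
    finally have "dist (v ! i) (linear_interp v t) \<le> r" using edge[OF i(1)] by simp
    then have "dist (v ! i) y \<le> e + r"
      using close[OF t(1)] dist_triangle[of "v ! i" y "linear_interp v t"] t(2) by simp
    then show ?thesis using i len by (intro bexI[of _ "v ! i"]) auto
  qed
  show "0 \<le> hausdorff_distance (set v) (path_image \<eta>)" "hausdorff_distance (set v) (path_image \<eta>) \<le> e + r"
    using hausdorff_distance_nonneg[OF ne 1 2] hausdorff_distance_le[OF ne 1 2] by auto
qed

text \<open>
  Three points of \<open>D\<close> on a segment starting at \<open>x\<close>, at mutual distance at least \<open>2 * \<delta>\<close>, have three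
  different points of \<open>S\<close> near them, of which at most two are forbidden. This is how consecutive vertices
  of a discrete path are kept distinct where the approximated path stands still.
\<close>

lemma exists_near_avoiding_two:
  fixes D S :: "'a::euclidean_space set"
  assumes D: "convex D" and net: "\<And>x. x \<in> D \<Longrightarrow> \<exists>y\<in>S. dist x y < \<delta>"
    and x: "x \<in> D" and z: "z \<in> D" "4 * \<delta> \<le> dist x z"
  obtains y where "y \<in> S" "y \<noteq> u" "y \<noteq> w" "dist x y < 5 * \<delta>"
proof -
  have \<delta>: "0 < \<delta>" using net[OF x] zero_le_dist le_less_trans by blast
  have xz: "0 < dist x z" using z \<delta> by linarith
  define e where "e = (z - x) /\<^sub>R dist x z"
  have e: "norm e = 1" using xz by (simp add: e_def dist_norm norm_minus_commute)
  define X where "X = (\<lambda>k. x + (2 * k * \<delta>) *\<^sub>R e)"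
  have XD: "X k \<in> D" if "0 \<le> k" "k \<le> 2" for k
  proof -
    define q where "q = 2 * k * \<delta> / dist x z"
    have "2 * k * \<delta> \<le> 2 * 2 * \<delta>" using that \<delta> by (intro mult_right_mono mult_left_mono) auto
    then have "2 * k * \<delta> \<le> dist x z" using z(2) by linarith
    then have q: "0 \<le> q" "q \<le> 1" using that \<delta> xz z(2) by (auto simp: q_def divide_le_eq)
    have "X k = (1 - q) *\<^sub>R x + q *\<^sub>R z" by (simp add: X_def e_def q_def divide_inverse algebra_simps)
    then show ?thesis using convexD_alt[OF D x z(1) q] by simp
  qed
  obtain y0 where y0: "y0 \<in> S" "dist (X 0) y0 < \<delta>" using net[OF XD[of 0]] by auto
  obtain y1 where y1: "y1 \<in> S" "dist (X 1) y1 < \<delta>" using net[OF XD[of 1]] by auto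
  obtain y2 where y2: "y2 \<in> S" "dist (X 2) y2 < \<delta>" using net[OF XD[of 2]] by auto
  have dX: "dist (X j) (X k) = 2 * \<bar>j - k\<bar> * \<delta>" for j k
  proof -
    have X: "X j - X k = (2 * (j - k) * \<delta>) *\<^sub>R e" by (simp add: X_def algebra_simps)
    show ?thesis using \<delta> by (simp only: dist_norm X norm_scaleR e abs_mult)
  qed
  have "y0 \<noteq> y1"
    using dist_triangle2[of "X 0" "X 1" y0] y0 y1 dX[of 0 1] by auto
  moreover have "y1 \<noteq> y2"
    using dist_triangle2[of "X 1" "X 2" y1] y1 y2 dX[of 1 2] by auto
  moreover have "y0 \<noteq> y2"
    using dist_triangle2[of "X 0" "X 2" y0] y0 y2 dX[of 0 2] \<delta> by auto
  moreover have "dist x y0 < 5 * \<delta>" "dist x y1 < 5 * \<delta>" "dist x y2 < 5 * \<delta>"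
    using dist_triangle[of x y0 "X 0"] dist_triangle[of x y1 "X 1"] dist_triangle[of x y2 "X 2"]
      dX[of 0 0] dX[of 0 1] dX[of 0 2] y0 y1 y2 \<delta> by (auto simp: X_def)
  ultimately show ?thesis using that y0 y1 y2 by metis
qed

context homogeneous_lagrangian
begin

lemma path_cost_linepath_le:
  assumes x: "x \<in> D" and y: "y \<in> D" and r: "norm (x - y) \<le> r"
  shows "path_cost f (linepath x y) \<le> (1 + c * r / m\<^sub>1) * f x (y - x)"
proof -
  let ?l = "linepath x y"
  have vd: "vector_derivative ?l (at t within {0..1}) = y - x" if "t \<in> {0..1}" for t
    using that by (intro vector_derivative_linepath_within) auto
  have int: "(\<lambda>t. f (?l t) (vector_derivative ?l (at t within {0..1}))) integrable_on {0..1}"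
    by (rule path_cost_integrable[OF linepath_in_lipschitz_paths[OF convex_D x y]])
  have "path_cost f ?l \<le> integral {0..1} (\<lambda>_::real. (1 + c * r / m\<^sub>1) * f x (y - x))"
    unfolding path_cost_def
  proof (rule integral_le[OF int integrable_const_ivl])
    fix t :: real assume t: "t \<in> {0..1}"
    have "x - ?l t = t *\<^sub>R (x - y)" by (simp add: linepath_def algebra_simps)
    then have "norm (x - ?l t) \<le> 1 * norm (x - y)"
      using t by (simp add: mult_left_le_one_le)
    then show "f (?l t) (vector_derivative ?l (at t within {0..1})) \<le> (1 + c * r / m\<^sub>1) * f x (y - x)"
      unfolding vd[OF t] using r lipschitz_path_in_D[OF linepath_in_lipschitz_paths[OF convex_D x y] t]
      by (intro f_le_f_at_nearby_point x) auto
  qed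
  then show ?thesis by simp
qed

lemma linear_interp_in_lipschitz_paths:
  assumes v: "v \<in> graph_paths S r a b" and S: "S \<subseteq> D" and ab: "a \<in> D" "b \<in> D"
  shows "linear_interp v \<in> lipschitz_paths D a b"
proof -
  define m where "m = steps v"
  have m: "0 < m" using graph_paths_steps_pos[OF v] by (simp add: m_def)
  have vD: "v ! i \<in> D" if "i \<le> m" for i
    using graph_paths_nth_in[OF v, of i] that S ab by (auto simp: m_def)
  have edge: "norm (v ! i - v ! Suc i) \<le> r" if "i < m" for i
    using v that by (simp add: graph_paths_def m_def less_imp_le)
  have r: "0 \<le> r" using edge[OF m] norm_ge_zero order_trans by blast
  have piece: "(real m * r)-lipschitz_on {real i / real m..real (Suc i) / real m} (linear_interp v)" if i: "i < m" for i
  proof (rule lipschitz_onI)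
    fix s t assume st: "s \<in> {real i / real m..real (Suc i) / real m}" "t \<in> {real i / real m..real (Suc i) / real m}"
    have l: "linear_interp v s = (1 - (real m * s - real i)) *\<^sub>R v ! i + (real m * s - real i) *\<^sub>R v ! Suc i"
      if "s \<in> {real i / real m..real (Suc i) / real m}" for s
      using that linear_interp_piece[of i v s] i by (simp add: m_def add.commute)
    have "linear_interp v s - linear_interp v t = (real m * (s - t)) *\<^sub>R (v ! Suc i - v ! i)"
      unfolding l[OF st(1)] l[OF st(2)] by (simp add: algebra_simps)
    then have "dist (linear_interp v s) (linear_interp v t) = real m * dist s t * norm (v ! i - v ! Suc i)"
      by (simp add: dist_norm abs_mult norm_minus_commute)
    also have "\<dots> \<le> real m * dist s t * r" using edge[OF i] by (intro mult_left_mono) auto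
    finally show "dist (linear_interp v s) (linear_interp v t) \<le> real m * r * dist s t" by (simp add: mult_ac)
  qed (use r in simp)
  have "(real m * r)-lipschitz_on {0..real k / real m} (linear_interp v)" if "k \<le> m" for k
    using that
  proof (induction k)
    case 0
    then show ?case using r by (auto simp: lipschitz_on_def)
  next
    case (Suc k)
    have "(real m * r)-lipschitz_on {0..real (Suc k) / real m}
        (\<lambda>x. if x \<le> real k / real m then linear_interp v x else linear_interp v x)"
      using Suc piece[of k] by (intro lipschitz_on_concat) auto
    then show ?case by simp
  qed
  from this[of m] have lip: "(real m * r)-lipschitz_on {0..1} (linear_interp v)" using m by simp
  have "linear_interp v t \<in> D" if t: "t \<in> {0..1}" for t
  proof -
    obtain i where i: "i < m" "real i / real m \<le> t" "t \<le> (real i + 1) / real m"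
      using unit_interval_piece[OF m t] by blast
    have s: "0 \<le> real m * t - real i" "real m * t - real i \<le> 1" using i m by (auto simp: field_simps)
    show ?thesis
      using linear_interp_piece[of i v t] i convexD_alt[OF convex_D vD[of i] vD[of "Suc i"] s]
      by (simp add: m_def)
  qed
  moreover have "linear_interp v 0 = a"
    using linear_interp_piece[of 0 v 0] m v by (simp add: m_def graph_paths_def)
  moreover have "linear_interp v 1 = b"
  proof -
    have "1 \<le> (real (m - 1) + 1) / real m" "real (m - 1) / real m \<le> 1" "real m * 1 - real (m - 1) = 1"
      using m by (auto simp: of_nat_diff divide_le_eq)
    then show ?thesis using linear_interp_piece[of "m - 1" v 1] m v by (simp add: m_def graph_paths_def)
  qed
  ultimately show ?thesis using lip unfolding lipschitz_paths_def by blast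
qed

text \<open>
  Each edge is traversed with constant velocity, at a distance of at most \<open>r\<close> from its first vertex.
\<close>

lemma path_cost_linear_interp_le:
  assumes v: "v \<in> graph_paths S r a b" and S: "S \<subseteq> D" and ab: "a \<in> D" "b \<in> D"
  shows "path_cost f (linear_interp v) \<le> (1 + c * r / m\<^sub>1) * discrete_cost f v"
proof -
  define m where "m = steps v"
  have m: "0 < m" using graph_paths_steps_pos[OF v] by (simp add: m_def)
  have vD: "v ! i \<in> D" if "i \<le> m" for i
    using graph_paths_nth_in[OF v, of i] that S ab by (auto simp: m_def)
  have edge: "norm (v ! i - v ! Suc i) \<le> r" if "i < m" for i
    using v that by (simp add: graph_paths_def m_def less_imp_le)
  have l: "linear_interp v \<in> lipschitz_paths D a b"
    by (rule linear_interp_in_lipschitz_paths[OF v S ab])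
  let ?t = "\<lambda>i. real i / real m"
  have "segment_cost (linear_interp v) (?t i) (?t (Suc i))
      \<le> (1 / real m) * ((1 + c * r / m\<^sub>1) * f (v ! i) (real m *\<^sub>R (v ! Suc i - v ! i)))" if i: "i < m" for i
  proof -
    have t: "0 \<le> ?t i" "?t i < ?t (Suc i)" "?t (Suc i) \<le> 1" "?t (Suc i) - ?t i = 1 / real m"
      using i by (auto simp: field_simps)
    have "path_cost f (\<lambda>u. linear_interp v (?t i + (?t (Suc i) - ?t i) * u)) = path_cost f (linepath (v ! i) (v ! Suc i))"
    proof (rule path_cost_cong)
      fix u :: real assume u: "u \<in> {0..1}"
      define s where "s = ?t i + (?t (Suc i) - ?t i) * u"
      have ms: "real m * s = real i + u" using m by (simp add: s_def t(4) field_simps)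
      then have "?t i \<le> s" "s \<le> (real i + 1) / real m" using u m by (auto simp: field_simps)
      then have "linear_interp v s = linepath (v ! i) (v ! Suc i) u"
        using linear_interp_piece[of i v s] i ms by (simp add: m_def linepath_def)
      then show "linear_interp v (?t i + (?t (Suc i) - ?t i) * u) = linepath (v ! i) (v ! Suc i) u"
        by (simp add: s_def)
    qed
    then have "(1 / real m) powr (p - 1) * segment_cost (linear_interp v) (?t i) (?t (Suc i))
        = path_cost f (linepath (v ! i) (v ! Suc i))"
      using path_cost_subpath[OF l t(1-3)] unfolding t(4) by simp
    also have "\<dots> \<le> (1 + c * r / m\<^sub>1) * f (v ! i) (v ! Suc i - v ! i)"
      using i by (intro path_cost_linepath_le vD edge) auto
    finally have *: "(1 / real m) powr (p - 1) * segment_cost (linear_interp v) (?t i) (?t (Suc i))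
        \<le> (1 + c * r / m\<^sub>1) * f (v ! i) (v ! Suc i - v ! i)" .
    have pw: "real m powr (p - 1) * (1 / real m) powr (p - 1) = 1"
      using m by (simp flip: powr_mult)
    have "segment_cost (linear_interp v) (?t i) (?t (Suc i))
        = real m powr (p - 1) * ((1 / real m) powr (p - 1) * segment_cost (linear_interp v) (?t i) (?t (Suc i)))"
      using pw by (simp flip: mult.assoc)
    also have "\<dots> \<le> real m powr (p - 1) * ((1 + c * r / m\<^sub>1) * f (v ! i) (v ! Suc i - v ! i))"
      using * by (intro mult_left_mono) auto
    also have "\<dots> = (1 / real m) * ((1 + c * r / m\<^sub>1) * f (v ! i) (real m *\<^sub>R (v ! Suc i - v ! i)))"
      using m i by (subst homogeneous[OF vD]) (auto simp: powr_diff)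
    finally show ?thesis .
  qed
  then have "path_cost f (linear_interp v)
      \<le> (\<Sum>i<m. (1 / real m) * ((1 + c * r / m\<^sub>1) * f (v ! i) (real m *\<^sub>R (v ! Suc i - v ! i))))"
    unfolding path_cost_eq_sum_segments[OF l m] by (intro sum_mono) auto
  also have "\<dots> = (1 + c * r / m\<^sub>1) * discrete_cost f v"
    by (simp add: discrete_cost_def m_def sum_distrib_left mult_ac)
  finally show ?thesis .
qed

lemma discrete_cost_nonneg:
  assumes "v \<in> graph_paths S r a b" "S \<subseteq> D" "a \<in> D" "b \<in> D"
  shows "0 \<le> discrete_cost f v"
  unfolding discrete_cost_def
proof (intro mult_nonneg_nonneg sum_nonneg f_nonneg)
  fix i assume "i \<in> {..<steps v}"
  then show "v ! i \<in> D" using graph_paths_nth_in[OF assms(1), of i] assms by auto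
qed simp

text \<open>
  The number of steps is arbitrary, but on finitely many vertices the edges have a minimal
  length \<open>\<delta>\<close>, and a path of \<open>m\<close> steps costs at least \<open>m\<^sub>1 * (m * \<delta>) powr p\<close>. Only finitely many paths are
  therefore cheaper than a given one.
\<close>

lemma discrete_minimizer_exists:
  assumes fin: "finite S" and S: "S \<subseteq> D" and ab: "a \<in> D" "b \<in> D" and ne: "graph_paths S r a b \<noteq> {}"
  shows "argmin_set (discrete_cost f) (graph_paths S r a b) \<noteq> {}"
proof -
  let ?V = "S \<union> {a, b}" and ?P = "graph_paths S r a b"
  obtain v0 where v0: "v0 \<in> ?P" using ne by blast
  define E where "E = {(x, y). x \<in> ?V \<and> y \<in> ?V \<and> x \<noteq> y}"
  have finE: "finite E"
    by (rule finite_subset[of _ "?V \<times> ?V"]) (use fin in \<open>auto simp: E_def\<close>)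
  have edgeE: "(v ! i, v ! Suc i) \<in> E" if "v \<in> ?P" "i < steps v" for v i
    using graph_paths_nth_in[OF that(1), of i] graph_paths_nth_in[OF that(1), of "Suc i"] that
    by (auto simp: E_def graph_paths_def)
  define \<delta> where "\<delta> = Min ((\<lambda>(x, y). norm (y - x)) ` E)"
  have neE: "E \<noteq> {}" using edgeE[OF v0 graph_paths_steps_pos[OF v0]] by blast
  have "\<delta> \<in> (\<lambda>(x, y). norm (y - x)) ` E"
    unfolding \<delta>_def using finE neE by (intro Min_in) auto
  then have \<delta>: "0 < \<delta>" by (auto simp: E_def)
  have \<delta>_le: "\<delta> \<le> norm (y - x)" if "(x, y) \<in> E" for x y
    unfolding \<delta>_def using finE that by (intro Min_le) force+
  have grow: "m\<^sub>1 * \<delta> powr p * real (steps v) \<le> discrete_cost f v" if v: "v \<in> ?P" for v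
  proof -
    define m where "m = steps v"
    have m: "0 < m" using graph_paths_steps_pos[OF v] by (simp add: m_def)
    have "m\<^sub>1 * \<delta> powr p * real m \<le> f (v ! i) (real m *\<^sub>R (v ! Suc i - v ! i))" if i: "i < m" for i
    proof -
      have "m\<^sub>1 * \<delta> powr p * real m \<le> m\<^sub>1 * \<delta> powr p * real m powr p"
      proof (rule mult_left_mono)
        show "real m \<le> real m powr p" using powr_mono[of 1 p "real m"] p m by simp
      qed (use m1 in simp)
      also have "\<dots> = m\<^sub>1 * (real m * \<delta>) powr p" by (simp add: powr_mult)
      also have "\<dots> \<le> m\<^sub>1 * norm (real m *\<^sub>R (v ! Suc i - v ! i)) powr p"
        using m1 p \<delta> \<delta>_le[OF edgeE[OF v, of i]] i
        by (intro mult_left_mono powr_mono2) (auto simp: m_def intro!: mult_left_mono)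
      also have "\<dots> \<le> f (v ! i) (real m *\<^sub>R (v ! Suc i - v ! i))"
        using graph_paths_nth_in[OF v, of i] i S ab by (intro lower) (auto simp: m_def)
      finally show ?thesis .
    qed
    then have "(1 / real m) * (\<Sum>i<m. m\<^sub>1 * \<delta> powr p * real m) \<le> discrete_cost f v"
      unfolding discrete_cost_def m_def[symmetric] by (intro mult_left_mono sum_mono) auto
    then show ?thesis using m by (simp add: m_def)
  qed
  define Q where "Q = {v \<in> ?P. discrete_cost f v \<le> discrete_cost f v0}"
  define B where "B = nat \<lceil>discrete_cost f v0 / (m\<^sub>1 * \<delta> powr p)\<rceil>"
  have "finite Q"
  proof (rule finite_subset)
    show "finite {xs. set xs \<subseteq> ?V \<and> length xs \<le> Suc B}"
      using fin by (intro finite_lists_length_le) simp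
    show "Q \<subseteq> {xs. set xs \<subseteq> ?V \<and> length xs \<le> Suc B}"
    proof
      fix v assume v: "v \<in> Q"
      then have "m\<^sub>1 * \<delta> powr p * real (steps v) \<le> discrete_cost f v0" using grow[of v] by (auto simp: Q_def)
      then have "real (steps v) \<le> discrete_cost f v0 / (m\<^sub>1 * \<delta> powr p)"
        using m1 \<delta> by (simp add: pos_le_divide_eq mult.commute)
      then have "real (steps v) \<le> real B" unfolding B_def by linarith
      then show "v \<in> {xs. set xs \<subseteq> ?V \<and> length xs \<le> Suc B}"
        using v by (auto simp: Q_def graph_paths_def steps_def)
    qed
  qed
  moreover have "Q \<noteq> {}" using v0 by (auto simp: Q_def)
  ultimately obtain w where "is_arg_min (discrete_cost f) (\<lambda>v. v \<in> Q) w"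
    using ex_is_arg_min_if_finite by blast
  then have "is_arg_min (discrete_cost f) (\<lambda>v. v \<in> ?P) w"
    unfolding is_arg_min_def Q_def by (auto simp: not_less) (meson less_imp_le less_le_trans not_le)
  then show ?thesis by (auto simp: argmin_set_def)
qed

lemma lagrangian_uniformly_continuous:
  assumes L: "0 \<le> L" and e: "0 < e"
  obtains d where "0 < d"
    "\<And>x y v w. x \<in> D \<Longrightarrow> y \<in> D \<Longrightarrow> norm v \<le> L \<Longrightarrow> norm w \<le> L \<Longrightarrow> dist x y < d \<Longrightarrow> dist v w < d \<Longrightarrow> f x v \<le> f y w + e"
proof -
  have "uniformly_continuous_on (D \<times> cball 0 L) (\<lambda>(x, v). f x v)"
    by (intro compact_uniformly_continuous continuous_on_subset[OF cont_f] compact_Times compact_D) auto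
  then obtain d where d: "0 < d" "\<And>z z'. z \<in> D \<times> cball 0 L \<Longrightarrow> z' \<in> D \<times> cball 0 L \<Longrightarrow> dist z' z < d \<Longrightarrow>
      dist (case z' of (x, v) \<Rightarrow> f x v) (case z of (x, v) \<Rightarrow> f x v) < e"
    unfolding uniformly_continuous_on_def using e by meson
  show ?thesis
  proof (rule that[of "d / 2"])
    fix x y v w :: 'a
    assume *: "x \<in> D" "y \<in> D" "norm v \<le> L" "norm w \<le> L" "dist x y < d / 2" "dist v w < d / 2"
    have "dist (x, v) (y, w) \<le> dist x y + dist v w"
      unfolding dist_Pair_Pair by (rule order_trans[OF sqrt_sum_squares_le_sum_abs]) simp
    then have "dist (x, v) (y, w) < d" using * by linarith
    then show "f x v \<le> f y w + e" using d(2)[of "(y, w)" "(x, v)"] * by (simp add: dist_real_def)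
  qed (use d in simp)
qed

text \<open>
  Take \<open>m\<close> of the order of \<open>1 / \<epsilon> n\<close> and replace the points \<open>\<gamma> (i / m)\<close> by points of \<open>S n\<close> within a
  distance of \<open>5 * \<delta> n\<close>. Since \<open>m * \<delta> n\<close> tends to \<open>0\<close>, this hardly changes the velocities
  \<open>m * (\<gamma> ((i + 1) / m) - \<gamma> (i / m))\<close>, and the discrete cost stays close to the chord cost of \<open>\<gamma>\<close>, hence to
  the cost of \<open>\<gamma>\<close>.
\<close>

lemma recovery_path:
  assumes \<gamma>: "\<gamma> \<in> lipschitz_paths D a b"
    and R: "0 < R" "\<And>x. x \<in> D \<Longrightarrow> \<exists>z\<in>D. R \<le> dist x z"
    and S: "\<And>n. S n \<subseteq> D" and net: "\<forall>\<^sub>F n in sequentially. \<forall>x\<in>D. \<exists>y\<in>S n. dist x y < \<delta> n"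
    and \<epsilon>: "\<forall>\<^sub>F n in sequentially. 0 < \<epsilon> n" "\<epsilon> \<longlonglongrightarrow> 0" and \<delta>: "(\<lambda>n. \<delta> n / \<epsilon> n) \<longlonglongrightarrow> 0"
    and e: "0 < e"
  shows "\<forall>\<^sub>F n in sequentially. \<exists>v\<in>graph_paths (S n) (\<epsilon> n) a b. discrete_cost f v \<le> path_cost f \<gamma> + e"
proof -
  obtain L where L: "L-lipschitz_on {0..1} \<gamma>" using \<gamma> by (auto simp: lipschitz_paths_def)
  have L0: "0 \<le> L" using lipschitz_on_nonneg[OF L] .
  have ends: "\<gamma> 0 = a" "\<gamma> 1 = b" using \<gamma> by (auto simp: lipschitz_paths_def)
  have ab: "a \<in> D" "b \<in> D" using lipschitz_path_in_D[OF \<gamma>, of 0] lipschitz_path_in_D[OF \<gamma>, of 1] ends by auto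
  obtain d where d: "0 < d"
    "\<And>x y v w. x \<in> D \<Longrightarrow> y \<in> D \<Longrightarrow> norm v \<le> L + 1 \<Longrightarrow> norm w \<le> L + 1 \<Longrightarrow> dist x y < d \<Longrightarrow> dist v w < d \<Longrightarrow> f x v \<le> f y w + e / 2"
    using lagrangian_uniformly_continuous[of "L + 1" "e / 2"] L0 e by auto
  \<comment> \<open>With this \<open>m\<close> a step of \<open>\<gamma>\<close> has length at most \<open>\<epsilon> n / 4\<close>, which leaves room for moving both of its
      ends. At least two steps are needed to get from \<open>a\<close> to \<open>b\<close> if \<open>a = b\<close>.\<close>
  define m where "m = (\<lambda>n. nat \<lceil>4 * (L + 1) / \<epsilon> n\<rceil> + 2)"
  have m_ge: "4 * (L + 1) / \<epsilon> n \<le> real (m n)" for n unfolding m_def by linarith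
  have m_le: "real (m n) \<le> 4 * (L + 1) / \<epsilon> n + 3" if "0 < \<epsilon> n" for n
  proof -
    have "0 \<le> 4 * (L + 1) / \<epsilon> n" using L0 that by simp
    then show ?thesis unfolding m_def by linarith
  qed
  have \<delta>0: "\<delta> \<longlonglongrightarrow> 0"
  proof (rule Lim_transform_eventually)
    show "(\<lambda>n. \<delta> n / \<epsilon> n * \<epsilon> n) \<longlonglongrightarrow> 0" using tendsto_mult[OF \<delta> \<epsilon>(2)] by simp
    show "\<forall>\<^sub>F n in sequentially. \<delta> n / \<epsilon> n * \<epsilon> n = \<delta> n" using \<epsilon>(1) by eventually_elim simp
  qed
  have "(\<lambda>n. (4 * (L + 1)) * (\<delta> n / \<epsilon> n) + 3 * \<delta> n) \<longlonglongrightarrow> (4 * (L + 1)) * 0 + 3 * 0"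
    by (intro tendsto_intros \<delta> \<delta>0)
  then have m\<delta>: "\<forall>\<^sub>F n in sequentially. (4 * (L + 1)) * (\<delta> n / \<epsilon> n) + 3 * \<delta> n < min 1 d / 10"
    using d(1) by (intro order_tendstoD(2)) auto
  have m_top: "filterlim m at_top sequentially"
  proof -
    have "filterlim (\<lambda>n. real (m n)) at_top sequentially"
    proof (rule filterlim_at_top_mono[where f="\<lambda>n. 4 * (L + 1) * inverse (\<epsilon> n)"])
      show "filterlim (\<lambda>n. 4 * (L + 1) * inverse (\<epsilon> n)) at_top sequentially"
        using L0 \<epsilon> by (intro filterlim_tendsto_pos_mult_at_top[OF tendsto_const] filterlim_inverse_at_top) auto
      show "\<forall>\<^sub>F n in sequentially. 4 * (L + 1) * inverse (\<epsilon> n) \<le> real (m n)"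
        using m_ge by (intro always_eventually) (simp add: divide_inverse)
    qed
    then show ?thesis using filterlim_sequentially_iff_filterlim_real by blast
  qed
  have chord: "\<forall>\<^sub>F n in sequentially. chord_cost f \<gamma> (m n) < path_cost f \<gamma> + e / 2"
    using filterlim_compose[OF chord_cost_tendsto[OF \<gamma>] m_top] e by (intro order_tendstoD(2)) auto
  have small: "\<forall>\<^sub>F n in sequentially. \<delta> n < min (d / 5) (R / 4)"
    using \<delta>0 d(1) R(1) by (intro order_tendstoD(2)) auto
  have ratio: "\<forall>\<^sub>F n in sequentially. \<delta> n / \<epsilon> n < 1 / 40"
    using \<delta> by (intro order_tendstoD(2)) auto
  show ?thesis
    using net \<epsilon>(1) m\<delta> chord small ratio
  proof eventually_elim
    case (elim n)
    define k where "k = m n"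
    define \<tau> where "\<tau> = \<delta> n"
    have k2: "2 \<le> k" by (simp add: k_def m_def)
    have net: "\<And>x. x \<in> D \<Longrightarrow> \<exists>y\<in>S n. dist x y < \<tau>" using elim by (simp add: \<tau>_def)
    have \<tau>0: "0 < \<tau>" using net[OF ab(1)] zero_le_dist le_less_trans by blast
    have \<tau>s: "5 * \<tau> < d" "4 * \<tau> < R" "10 * \<tau> \<le> \<epsilon> n / 4"
      using elim by (auto simp: \<tau>_def divide_less_eq)
    have k\<tau>: "10 * (real k * \<tau>) < 1" "10 * (real k * \<tau>) < d"
    proof -
      have "real k * \<tau> \<le> (4 * (L + 1) / \<epsilon> n + 3) * \<tau>"
        using m_le[of n] elim \<tau>0 by (intro mult_right_mono) (auto simp: k_def)
      also have "\<dots> = (4 * (L + 1)) * (\<delta> n / \<epsilon> n) + 3 * \<delta> n" by (simp add: \<tau>_def algebra_simps add_divide_distrib)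
      also have "\<dots> < min 1 d / 10" using elim by simp
      finally show "10 * (real k * \<tau>) < 1" "10 * (real k * \<tau>) < d" by auto
    qed
    have Lk: "L * (1 / real k) \<le> \<epsilon> n / 4"
    proof -
      have "4 * (L + 1) \<le> real k * \<epsilon> n" using m_ge[of n] elim by (simp add: k_def divide_le_eq)
      then show ?thesis using k2 by (simp add: divide_le_eq mult.commute)
    qed
    let ?t = "\<lambda>i. real i / real k"
    have tI: "min 1 (?t i) \<in> {0..1}" for i by simp
    \<comment> \<open>The minimum extends the choice to all natural numbers, as dependent choice requires. Avoiding \<open>b\<close>
        throughout makes sure that the last edge joins distinct points.\<close>
    have pick: "\<exists>y. y \<in> S n \<and> y \<noteq> b \<and> y \<noteq> x \<and> dist (\<gamma> (min 1 (?t i))) y < 5 * \<tau>" for i x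
    proof -
      have g: "\<gamma> (min 1 (?t i)) \<in> D" by (rule lipschitz_path_in_D[OF \<gamma> tI])
      obtain z where z: "z \<in> D" "R \<le> dist (\<gamma> (min 1 (?t i))) z" using R(2)[OF g] by blast
      have "4 * \<tau> \<le> dist (\<gamma> (min 1 (?t i))) z" using z \<tau>s by linarith
      then show ?thesis using exists_near_avoiding_two[OF convex_D net g z(1), of b x] by metis
    qed
    have "\<exists>u. \<forall>i. (if i = 0 then u i = a else u i \<in> S n \<and> u i \<noteq> b \<and> dist (\<gamma> (min 1 (?t i))) (u i) < 5 * \<tau>)
        \<and> u (Suc i) \<noteq> u i"
    proof (rule dependent_nat_choice)
      show "\<exists>y. (if Suc i = 0 then y = a else y \<in> S n \<and> y \<noteq> b \<and> dist (\<gamma> (min 1 (?t (Suc i)))) y < 5 * \<tau>) \<and> y \<noteq> x" for x i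
        using pick[where i="Suc i" and x=x] by auto
    qed simp
    then obtain u where U: "\<forall>i. (if i = 0 then u i = a else u i \<in> S n \<and> u i \<noteq> b \<and> dist (\<gamma> (min 1 (?t i))) (u i) < 5 * \<tau>)
        \<and> u (Suc i) \<noteq> u i" by blast
    have u0: "u 0 = a" using spec[OF U, of 0] by simp
    have u: "u i \<in> S n \<and> u i \<noteq> b \<and> dist (\<gamma> (min 1 (?t i))) (u i) < 5 * \<tau>" if "i \<noteq> 0" for i
      using spec[OF U, of i] that by simp
    have u_ne: "u (Suc i) \<noteq> u i" for i using spec[OF U, of i] by simp
    define w where "w = (\<lambda>i. if i = k then b else u i)"
    have w0: "w 0 = a" "w k = b" using k2 u0 by (auto simp: w_def)
    have wS: "w i \<in> S n \<union> {a, b}" for i using u[of i] u0 by (cases "i = 0") (auto simp: w_def)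
    have wD: "w i \<in> D" for i using wS[of i] S[of n] ab by auto
    have w_ne: "w i \<noteq> w (Suc i)" if "i < k" for i
      using u_ne[of i] u[of i] that k2 by (cases "i = 0") (auto simp: w_def)
    have w_near: "dist (\<gamma> (?t i)) (w i) \<le> 5 * \<tau>" if i: "i \<le> k" for i
    proof -
      have "min 1 (?t i) = ?t i" using i k2 by (simp add: min_def divide_le_eq)
      then show ?thesis using u[of i] u0 \<tau>0 ends k2 by (cases "i = 0") (auto simp: w_def)
    qed
    have t01: "?t i \<in> {0..1}" if "i \<le> k" for i using that k2 by (simp add: divide_le_eq)
    have \<gamma>step: "dist (\<gamma> (?t i)) (\<gamma> (?t (Suc i))) \<le> L * (1 / real k)" if i: "i < k" for i
    proof -
      have "dist (?t i) (?t (Suc i)) = 1 / real k" using k2 by (simp add: dist_real_def field_simps)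
      then show ?thesis using lipschitz_onD[OF L t01[of i] t01[of "Suc i"]] i by simp
    qed
    define v where "v = map w [0..<Suc k]"
    have v_nth: "v ! i = w i" if "i \<le> k" for i using that by (simp add: v_def nth_append del: upt_Suc)
    have st: "steps v = k" by (simp add: v_def steps_def)
    have "v \<in> graph_paths (S n) (\<epsilon> n) a b"
      unfolding graph_paths_def mem_Collect_eq st
    proof (intro conjI allI impI)
      show "2 \<le> length v" using k2 by (simp add: v_def)
      show "set v \<subseteq> S n \<union> {a, b}" using wS by (auto simp: v_def)
      show "v ! 0 = a" "v ! k = b" using w0 v_nth by auto
      fix i assume i: "i < k"
      show "0 < norm (v ! i - v ! Suc i)" using w_ne[OF i] i by (simp add: v_nth)
      have "dist (w i) (w (Suc i)) \<le> dist (\<gamma> (?t i)) (w i) + (dist (\<gamma> (?t i)) (\<gamma> (?t (Suc i))) + dist (\<gamma> (?t (Suc i))) (w (Suc i)))"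
        using dist_triangle2[of "w i" "w (Suc i)" "\<gamma> (?t i)"] dist_triangle[of "\<gamma> (?t i)" "w (Suc i)" "\<gamma> (?t (Suc i))"]
        by (simp add: dist_commute)
      also have "\<dots> \<le> 5 * \<tau> + (L * (1 / real k) + 5 * \<tau>)"
        using w_near[of i] w_near[of "Suc i"] \<gamma>step[OF i] i by (intro add_mono) auto
      also have "\<dots> \<le> \<epsilon> n / 4 + \<epsilon> n / 4" using Lk \<tau>s(3) by linarith
      also have "\<dots> < \<epsilon> n" using elim by simp
      finally show "norm (v ! i - v ! Suc i) < \<epsilon> n" using i by (simp add: v_nth dist_norm)
    qed
    moreover have "discrete_cost f v \<le> path_cost f \<gamma> + e"
    proof -
      have "f (w i) (real k *\<^sub>R (w (Suc i) - w i))
          \<le> f (\<gamma> (?t i)) (real k *\<^sub>R (\<gamma> (?t (Suc i)) - \<gamma> (?t i))) + e / 2" if i: "i < k" for i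
      proof (rule d(2)[OF wD])
        show "\<gamma> (?t i) \<in> D" using lipschitz_path_in_D[OF \<gamma> t01[of i]] i by simp
        have gn: "norm (real k *\<^sub>R (\<gamma> (?t (Suc i)) - \<gamma> (?t i))) \<le> L"
          unfolding norm_scaleR using \<gamma>step[OF i] k2 by (simp add: dist_norm norm_minus_commute field_simps)
        then show "norm (real k *\<^sub>R (\<gamma> (?t (Suc i)) - \<gamma> (?t i))) \<le> L + 1" by simp
        have "dist (real k *\<^sub>R (w (Suc i) - w i)) (real k *\<^sub>R (\<gamma> (?t (Suc i)) - \<gamma> (?t i)))
            = norm (real k *\<^sub>R ((w (Suc i) - \<gamma> (?t (Suc i))) - (w i - \<gamma> (?t i))))"
          unfolding dist_norm by (rule arg_cong[where f=norm]) (simp add: algebra_simps)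
        also have "\<dots> \<le> real k * (norm (w (Suc i) - \<gamma> (?t (Suc i))) + norm (w i - \<gamma> (?t i)))"
          by (simp only: norm_scaleR abs_of_nat) (intro mult_left_mono norm_triangle_ineq4, simp)
        also have "\<dots> \<le> real k * (5 * \<tau> + 5 * \<tau>)"
          using w_near[of i] w_near[of "Suc i"] i
          by (intro mult_left_mono add_mono) (auto simp: dist_norm norm_minus_commute)
        also have "\<dots> = 10 * (real k * \<tau>)" by simp
        finally have dd: "dist (real k *\<^sub>R (w (Suc i) - w i)) (real k *\<^sub>R (\<gamma> (?t (Suc i)) - \<gamma> (?t i))) \<le> 10 * (real k * \<tau>)" .
        then show "dist (real k *\<^sub>R (w (Suc i) - w i)) (real k *\<^sub>R (\<gamma> (?t (Suc i)) - \<gamma> (?t i))) < d"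
          using k\<tau> by linarith
        show "norm (real k *\<^sub>R (w (Suc i) - w i)) \<le> L + 1"
          using norm_triangle_sub[of "real k *\<^sub>R (w (Suc i) - w i)" "real k *\<^sub>R (\<gamma> (?t (Suc i)) - \<gamma> (?t i))"]
            dd gn k\<tau> unfolding dist_norm by linarith
        show "dist (w i) (\<gamma> (?t i)) < d" using w_near[of i] i \<tau>s(1) by (simp add: dist_commute)
      qed
      then have "(\<Sum>i<k. f (w i) (real k *\<^sub>R (w (Suc i) - w i)))
          \<le> (\<Sum>i<k. f (\<gamma> (?t i)) (real k *\<^sub>R (\<gamma> (?t (Suc i)) - \<gamma> (?t i))) + e / 2)"
        by (intro sum_mono) auto
      then have "(1 / real k) * (\<Sum>i<k. f (w i) (real k *\<^sub>R (w (Suc i) - w i)))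
          \<le> (1 / real k) * (\<Sum>i<k. f (\<gamma> (?t i)) (real k *\<^sub>R (\<gamma> (?t (Suc i)) - \<gamma> (?t i))) + e / 2)"
        by (intro mult_left_mono) auto
      also have "\<dots> = chord_cost f \<gamma> k + e / 2"
        using k2 by (simp add: chord_cost_def sum.distrib distrib_left)
      also have "(1 / real k) * (\<Sum>i<k. f (w i) (real k *\<^sub>R (w (Suc i) - w i))) = discrete_cost f v"
        by (simp add: discrete_cost_def st v_nth)
      finally show ?thesis using elim by (simp add: k_def)
    qed
    ultimately show ?case by blast
  qed
qed

end

section \<open>Minimizers on graphs with dense vertices\<close>

text \<open>
  What remains of a realization of the random graphs: the vertex set of the \<open>n\<close>-th graph is dense on
  a scale \<open>\<delta> n\<close> which is negligible compared with its connection radius \<open>\<epsilon> n\<close>. The constant \<open>R\<close>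
  expresses that \<open>D\<close> is not a single point.
\<close>

locale dense_proximity_graphs = homogeneous_lagrangian +
  fixes a b :: 'a and S :: "nat \<Rightarrow> 'a set" and \<delta> \<epsilon> :: "nat \<Rightarrow> real" and R :: real
  assumes ab: "a \<in> D" "b \<in> D"
    and far: "0 < R" "\<And>x. x \<in> D \<Longrightarrow> \<exists>z\<in>D. R \<le> dist x z"
    and S: "\<And>n. finite (S n)" "\<And>n. S n \<subseteq> D"
    and net: "\<forall>\<^sub>F n in sequentially. \<forall>x\<in>D. \<exists>y\<in>S n. dist x y < \<delta> n"
    and \<epsilon>_pos: "\<forall>\<^sub>F n in sequentially. 0 < \<epsilon> n" and \<epsilon>_lim: "\<epsilon> \<longlonglongrightarrow> 0"
    and \<delta>_small: "(\<lambda>n. \<delta> n / \<epsilon> n) \<longlonglongrightarrow> 0"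
begin

abbreviation G :: "nat \<Rightarrow> 'a list set" where
  "G n \<equiv> graph_paths (S n) (\<epsilon> n) a b"

lemma eventually_discrete_cost_le_action:
  assumes e: "0 < e"
  shows "\<forall>\<^sub>F n in sequentially. \<exists>v\<in>G n. discrete_cost f v \<le> action a b + e"
proof -
  obtain \<gamma> where "\<gamma> \<in> argmin_set (path_cost f) (lipschitz_paths D a b)"
    using minimizer_exists[OF ab] by blast
  then have \<gamma>: "\<gamma> \<in> lipschitz_paths D a b" "path_cost f \<gamma> = action a b"
    using argmin_path_cost_iff[OF ab] by auto
  show ?thesis
    using recovery_path[OF \<gamma>(1) far S(2) net \<epsilon>_pos \<epsilon>_lim \<delta>_small e] \<gamma>(2) by simp
qed

lemma eventually_discrete_minimizer_exists:
  "\<forall>\<^sub>F n in sequentially. argmin_set (discrete_cost f) (G n) \<noteq> {}"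
  using eventually_discrete_cost_le_action[OF zero_less_one]
  by eventually_elim (use discrete_minimizer_exists[OF S(1,2) ab] in blast)

lemma bdd_below_discrete_cost: "bdd_below (discrete_cost f ` G n)"
  using discrete_cost_nonneg[OF _ S(2) ab] by (intro bdd_belowI[of _ 0]) auto

lemma discretization_factor_tendsto: "(\<lambda>n. 1 + c * \<epsilon> n / m\<^sub>1) \<longlonglongrightarrow> 1"
proof -
  have "(\<lambda>n. 1 + c * \<epsilon> n / m\<^sub>1) \<longlonglongrightarrow> 1 + c * 0 / m\<^sub>1"
    using m1 by (intro tendsto_intros \<epsilon>_lim) auto
  then show ?thesis by simp
qed

lemma action_le_discrete_cost:
  assumes "v \<in> G n"
  shows "action a b \<le> (1 + c * \<epsilon> n / m\<^sub>1) * discrete_cost f v"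
  using action_le[OF linear_interp_in_lipschitz_paths[OF assms S(2) ab]]
    path_cost_linear_interp_le[OF assms S(2) ab] by linarith

theorem discrete_minima_tendsto:
  "(\<lambda>n. INF v\<in>G n. discrete_cost f v) \<longlonglongrightarrow> action a b"
proof (rule order_tendstoI)
  fix B assume B: "B < action a b"
  have "(\<lambda>n. action a b / (1 + c * \<epsilon> n / m\<^sub>1)) \<longlonglongrightarrow> action a b / 1"
    by (intro tendsto_intros discretization_factor_tendsto) auto
  then have "\<forall>\<^sub>F n in sequentially. B < action a b / (1 + c * \<epsilon> n / m\<^sub>1)"
    using B by (intro order_tendstoD(1)) auto
  then show "\<forall>\<^sub>F n in sequentially. B < (INF v\<in>G n. discrete_cost f v)"
    using \<epsilon>_pos eventually_discrete_cost_le_action[OF zero_less_one]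
  proof eventually_elim
    case (elim n)
    have "0 < 1 + c * \<epsilon> n / m\<^sub>1" using c m1 elim by (intro add_pos_nonneg) auto
    then have "action a b / (1 + c * \<epsilon> n / m\<^sub>1) \<le> (INF v\<in>G n. discrete_cost f v)"
      using elim action_le_discrete_cost
      by (intro cINF_greatest) (auto simp: divide_le_eq mult.commute)
    then show ?case using elim by linarith
  qed
next
  fix B assume B: "action a b < B"
  have "\<forall>\<^sub>F n in sequentially. \<exists>v\<in>G n. discrete_cost f v \<le> action a b + (B - action a b) / 2"
    using B by (intro eventually_discrete_cost_le_action) simp
  then show "\<forall>\<^sub>F n in sequentially. (INF v\<in>G n. discrete_cost f v) < B"
  proof eventually_elim
    case (elim n)
    then obtain v where v: "v \<in> G n" "discrete_cost f v \<le> action a b + (B - action a b) / 2" by blast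
    have "(INF v\<in>G n. discrete_cost f v) \<le> discrete_cost f v"
      using v by (intro cINF_lower bdd_below_discrete_cost)
    then show ?case using v B by (simp add: field_simps)
  qed
qed

lemma interpolations_minimizing_sequence:
  assumes w: "\<forall>\<^sub>F n in sequentially. w n \<in> argmin_set (discrete_cost f) (G n)"
  shows "(\<lambda>n. path_cost f (linear_interp (w n))) \<longlonglongrightarrow> action a b"
proof (rule tendsto_sandwich[where f="\<lambda>n. action a b"
      and h="\<lambda>n. (1 + c * \<epsilon> n / m\<^sub>1) * (INF v\<in>G n. discrete_cost f v)"])
  have "(\<lambda>n. (1 + c * \<epsilon> n / m\<^sub>1) * (INF v\<in>G n. discrete_cost f v)) \<longlonglongrightarrow> 1 * action a b"
    by (intro tendsto_mult discretization_factor_tendsto discrete_minima_tendsto)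
  then show "(\<lambda>n. (1 + c * \<epsilon> n / m\<^sub>1) * (INF v\<in>G n. discrete_cost f v)) \<longlonglongrightarrow> action a b" by simp
  show "(\<lambda>n. action a b) \<longlonglongrightarrow> action a b" by simp
  show "\<forall>\<^sub>F n in sequentially. action a b \<le> path_cost f (linear_interp (w n))"
    using w
  proof eventually_elim
    case (elim n)
    then have "w n \<in> G n" by (simp add: argmin_set_def is_arg_min_def)
    then show ?case by (intro action_le linear_interp_in_lipschitz_paths[OF _ S(2) ab])
  qed
  show "\<forall>\<^sub>F n in sequentially. path_cost f (linear_interp (w n)) \<le> (1 + c * \<epsilon> n / m\<^sub>1) * (INF v\<in>G n. discrete_cost f v)"
    using w \<epsilon>_pos
  proof eventually_elim
    case (elim n)
    then have wn: "w n \<in> G n" and min: "\<And>v. v \<in> G n \<Longrightarrow> discrete_cost f (w n) \<le> discrete_cost f v"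
      by (auto simp: argmin_set_def is_arg_min_def not_less)
    have "path_cost f (linear_interp (w n)) \<le> (1 + c * \<epsilon> n / m\<^sub>1) * discrete_cost f (w n)"
      by (rule path_cost_linear_interp_le[OF wn S(2) ab])
    also have "\<dots> \<le> (1 + c * \<epsilon> n / m\<^sub>1) * (INF v\<in>G n. discrete_cost f v)"
      using wn min c m1 elim by (intro mult_left_mono cINF_greatest) auto
    finally show ?case .
  qed
qed

lemma hausdorff_distance_tendsto:
  assumes w: "\<forall>\<^sub>F n in sequentially. w n \<in> G n" and q: "filterlim q sequentially sequentially"
    and lim: "uniform_limit {0..1} (\<lambda>k. linear_interp (w (q k))) \<eta> sequentially"
  shows "(\<lambda>k. hausdorff_distance (set (w (q k))) (path_image \<eta>)) \<longlonglongrightarrow> 0"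
proof (rule tendstoI)
  fix e :: real assume e: "0 < e"
  have "\<forall>\<^sub>F k in sequentially. \<forall>t\<in>{0..1}. dist (linear_interp (w (q k)) t) (\<eta> t) < e / 2"
    using uniform_limitD[OF lim, of "e / 2"] e by simp
  moreover have "\<forall>\<^sub>F k in sequentially. \<epsilon> (q k) < e / 2"
    using filterlim_compose[OF \<epsilon>_lim q] e by (intro order_tendstoD(2)) auto
  moreover have "\<forall>\<^sub>F k in sequentially. w (q k) \<in> G (q k)"
    by (rule eventually_compose_filterlim[OF w q])
  ultimately show "\<forall>\<^sub>F k in sequentially. dist (hausdorff_distance (set (w (q k))) (path_image \<eta>)) 0 < e"
  proof eventually_elim
    case (elim k)
    then have close: "\<And>t. t \<in> {0..1} \<Longrightarrow> dist (linear_interp (w (q k)) t) (\<eta> t) \<le> e / 2"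
      by (intro less_imp_le) blast
    show ?case
      using graph_paths_hausdorff_distance_nonneg[OF elim(3) close]
        graph_paths_hausdorff_distance_le[OF elim(3) close] elim(2) by (simp add: dist_real_def)
  qed
qed

text \<open>
  Compactness of minimizing sequences, applied to the interpolations. Wherever \<open>w n\<close> is not yet a path
  in the graph, its interpolation is replaced by the straight path.
\<close>

theorem discrete_minimizers_subconverge:
  assumes w: "\<forall>\<^sub>F n in sequentially. w n \<in> argmin_set (discrete_cost f) (G n)" and r: "strict_mono r"
  shows "\<exists>s :: nat \<Rightarrow> nat. strict_mono s \<and>
    (\<exists>\<gamma> \<in> argmin_set (path_cost f) (lipschitz_paths D a b).
       uniform_limit {0..1} (\<lambda>k. linear_interp (w (r (s k)))) \<gamma> sequentially \<and>
       (\<lambda>k. hausdorff_distance (set (w (r (s k)))) (path_image \<gamma>)) \<longlonglongrightarrow> 0)"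
proof -
  have wG: "\<forall>\<^sub>F n in sequentially. w n \<in> G n"
    using w by (auto elim!: eventually_mono simp: argmin_set_def is_arg_min_def)
  define \<gamma> where "\<gamma> = (\<lambda>n. if w n \<in> G n then linear_interp (w n) else linepath a b)"
  have \<gamma>: "\<gamma> n \<in> lipschitz_paths D a b" for n
    using linear_interp_in_lipschitz_paths[OF _ S(2) ab] linepath_in_lipschitz_paths[OF convex_D ab]
    by (simp add: \<gamma>_def)
  have ev: "\<forall>\<^sub>F n in sequentially. linear_interp (w n) = \<gamma> n"
    using wG by eventually_elim (simp add: \<gamma>_def)
  have "\<forall>\<^sub>F n in sequentially. path_cost f (linear_interp (w n)) = path_cost f (\<gamma> n)"
    using ev by eventually_elim simp
  then have "(\<lambda>n. path_cost f (\<gamma> n)) \<longlonglongrightarrow> action a b"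
    by (rule Lim_transform_eventually[OF interpolations_minimizing_sequence[OF w]])
  then have cost: "(\<lambda>k. path_cost f (\<gamma> (r k))) \<longlonglongrightarrow> action a b"
    using LIMSEQ_subseq_LIMSEQ[OF _ r] by (simp add: o_def)
  obtain s \<eta> where s: "strict_mono (s :: nat \<Rightarrow> nat)" and \<eta>: "\<eta> \<in> lipschitz_paths D a b"
    "path_cost f \<eta> = action a b" and lim: "uniform_limit {0..1} (\<lambda>k. \<gamma> (r (s k))) \<eta> sequentially"
    using minimizing_sequence_subconverges[where \<gamma>="\<lambda>k. \<gamma> (r k)", OF ab \<gamma> cost] by blast
  have q: "filterlim (\<lambda>k. r (s k)) sequentially sequentially"
    using filterlim_subseq[OF strict_mono_o[OF r s]] by (simp add: o_def)
  have "\<forall>\<^sub>F k in sequentially. linear_interp (w (r (s k))) = \<gamma> (r (s k))"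
    by (rule eventually_compose_filterlim[OF ev q])
  then have "\<forall>\<^sub>F k in sequentially. \<forall>t\<in>{0..1}. linear_interp (w (r (s k))) t = \<gamma> (r (s k)) t"
    by eventually_elim simp
  then have ul: "uniform_limit {0..1} (\<lambda>k. linear_interp (w (r (s k)))) \<eta> sequentially"
    using lim by (subst uniform_limit_cong) auto
  show ?thesis
    using s \<eta> ul hausdorff_distance_tendsto[OF wG q ul] argmin_path_cost_iff[OF ab] by blast
qed

text \<open>
  Otherwise a subsequence stays away from \<open>\<gamma>\<close>, while a further subsequence converges to a minimizer,
  which has to coincide with \<open>\<gamma>\<close>.
\<close>

theorem discrete_minimizers_converge:
  assumes w: "\<forall>\<^sub>F n in sequentially. w n \<in> argmin_set (discrete_cost f) (G n)"
    and unique: "\<And>\<eta> t. \<eta> \<in> argmin_set (path_cost f) (lipschitz_paths D a b) \<Longrightarrow> t \<in> {0..1} \<Longrightarrow> \<eta> t = \<gamma> t"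
  shows "uniform_limit {0..1} (\<lambda>n. linear_interp (w n)) \<gamma> sequentially"
    and "(\<lambda>n. hausdorff_distance (set (w n)) (path_image \<gamma>)) \<longlonglongrightarrow> 0"
proof -
  show lim: "uniform_limit {0..1} (\<lambda>n. linear_interp (w n)) \<gamma> sequentially"
  proof (rule uniform_limitI, rule ccontr)
    fix e :: real assume e: "0 < e" and "\<not> (\<forall>\<^sub>F n in sequentially. \<forall>t\<in>{0..1}. dist (linear_interp (w n) t) (\<gamma> t) < e)"
    then obtain r :: "nat \<Rightarrow> nat" where r: "strict_mono r"
      and bad: "\<And>k. \<not> (\<forall>t\<in>{0..1}. dist (linear_interp (w (r k)) t) (\<gamma> t) < e)"
      using not_eventually_sequentiallyD by blast
    obtain s \<eta> where "strict_mono (s :: nat \<Rightarrow> nat)" and \<eta>: "\<eta> \<in> argmin_set (path_cost f) (lipschitz_paths D a b)"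
      and ul: "uniform_limit {0..1} (\<lambda>k. linear_interp (w (r (s k)))) \<eta> sequentially"
      using discrete_minimizers_subconverge[OF w r] by blast
    have "\<forall>\<^sub>F k in sequentially. \<forall>t\<in>{0..1}. dist (linear_interp (w (r (s k))) t) (\<eta> t) < e"
      using uniform_limitD[OF ul e] .
    then obtain k where "\<forall>t\<in>{0..1}. dist (linear_interp (w (r (s k))) t) (\<eta> t) < e"
      by (auto simp: eventually_sequentially)
    then show False using bad[of "s k"] unique[OF \<eta>] by auto
  qed
  have "\<forall>\<^sub>F n in sequentially. w n \<in> G n"
    using w by (auto elim!: eventually_mono simp: argmin_set_def is_arg_min_def)
  then show "(\<lambda>n. hausdorff_distance (set (w n)) (path_image \<gamma>)) \<longlonglongrightarrow> 0"
    using hausdorff_distance_tendsto[OF _ filterlim_ident lim] by simp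
qed

end

section \<open>Density of the random sample\<close>

text \<open>
  Shrink a ball contained in \<open>D\<close> towards \<open>x\<close>. By convexity it stays inside \<open>D\<close>, also when \<open>x\<close> is on the
  boundary.
\<close>

lemma convex_body_contains_ball_near:
  fixes D :: "'a::euclidean_space set"
  assumes D: "convex D" "bounded D" and ne: "interior D \<noteq> {}"
  obtains \<theta> r0 where "0 < \<theta>" "0 < r0"
    "\<And>x r. x \<in> D \<Longrightarrow> 0 < r \<Longrightarrow> r \<le> r0 \<Longrightarrow> \<exists>z. ball z (\<theta> * r) \<subseteq> D \<inter> ball x r"
proof -
  obtain u \<rho> where \<rho>: "0 < \<rho>" "ball u \<rho> \<subseteq> D" using ne mem_interior by blast
  obtain B where B: "\<And>x. x \<in> D \<Longrightarrow> norm x \<le> B" using D(2) by (auto simp: bounded_iff)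
  define \<Delta> where "\<Delta> = 2 * \<bar>B\<bar> + 1"
  have \<Delta>: "0 < \<Delta>" by (simp add: \<Delta>_def)
  have diam: "norm (y - x) < \<Delta>" if "x \<in> D" "y \<in> D" for x y
    using norm_triangle_ineq4[of y x] B[of x] B[of y] that by (simp add: \<Delta>_def)
  show ?thesis
  proof (rule that[of "\<rho> / \<Delta>" \<Delta>])
    fix x r assume x: "x \<in> D" and r: "0 < r" "r \<le> \<Delta>"
    define l where "l = r / \<Delta>"
    have l: "0 < l" "l \<le> 1" using r \<Delta> by (auto simp: l_def)
    show "\<exists>z. ball z (\<rho> / \<Delta> * r) \<subseteq> D \<inter> ball x r"
    proof (intro exI subsetI)
      fix y assume y: "y \<in> ball (x + l *\<^sub>R (u - x)) (\<rho> / \<Delta> * r)"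
      define q where "q = x + (1 / l) *\<^sub>R (y - x)"
      have "u - q = (1 / l) *\<^sub>R ((x + l *\<^sub>R (u - x)) - y)" using l by (simp add: q_def algebra_simps)
      then have "dist u q = dist (x + l *\<^sub>R (u - x)) y / l" using l by (simp add: dist_norm)
      also have "\<dots> < \<rho>"
      proof -
        have "dist (x + l *\<^sub>R (u - x)) y < \<rho> * l" using y by (simp add: l_def)
        then show ?thesis using l by (simp only: pos_divide_less_eq)
      qed
      finally have q: "q \<in> D" using \<rho> by auto
      have y_eq: "y = (1 - l) *\<^sub>R x + l *\<^sub>R q" using l by (simp add: q_def algebra_simps)
      have "y \<in> D" unfolding y_eq using convexD_alt[OF D(1) x q, of l] l by simp
      moreover have "dist x y < r"
      proof -
        have "y - x = l *\<^sub>R (q - x)" using l by (simp add: q_def)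
        then have "dist x y = l * norm (q - x)"
          using l norm_minus_commute[of x y] by (simp only: dist_norm norm_scaleR abs_of_pos)
        also have "\<dots> < l * \<Delta>" using diam[OF x q] l by simp
        finally show ?thesis using \<Delta> by (simp add: l_def)
      qed
      ultimately show "y \<in> D \<inter> ball x r" by simp
    qed
  qed (use \<rho> \<Delta> in auto)
qed

lemma far_point_exists:
  fixes D :: "'a::euclidean_space set"
  assumes ne: "interior D \<noteq> {}"
  obtains R where "0 < R" "\<And>x. x \<in> D \<Longrightarrow> \<exists>z\<in>D. R \<le> dist x z"
proof -
  obtain u \<rho> where \<rho>: "0 < \<rho>" "ball u \<rho> \<subseteq> D" using ne mem_interior by blast
  obtain e :: 'a where e: "e \<in> Basis" using nonempty_Basis by blast
  define z1 z2 where "z1 = u + (\<rho> / 2) *\<^sub>R e" and "z2 = u - (\<rho> / 2) *\<^sub>R e"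
  have z: "z1 \<in> D" "z2 \<in> D" using \<rho> e by (auto simp: z1_def z2_def dist_norm subset_iff)
  have "z1 - z2 = \<rho> *\<^sub>R e" by (simp add: z1_def z2_def flip: scaleR_add_left)
  then have d: "dist z1 z2 = \<rho>" using \<rho> e by (simp add: dist_norm)
  show ?thesis
  proof (rule that[of "\<rho> / 2"])
    fix x assume "x \<in> D"
    show "\<exists>z\<in>D. \<rho> / 2 \<le> dist x z"
    proof (rule ccontr)
      assume "\<not> (\<exists>z\<in>D. \<rho> / 2 \<le> dist x z)"
      then have "dist x z1 < \<rho> / 2" "dist x z2 < \<rho> / 2" using z by (simp_all add: not_le)
      then show False using dist_triangle3[of z1 z2 x] d by linarith
    qed
  qed (use \<rho> in simp)
qed

text \<open>
  Choose one point of \<open>D\<close> in each nonempty cell of a cubic grid of mesh \<open>r / d\<close>.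
\<close>

lemma exists_small_net:
  fixes D :: "'a::euclidean_space set"
  assumes D: "bounded D"
  obtains C where "0 < C" "\<And>r. 0 < r \<Longrightarrow> r \<le> 1 \<Longrightarrow>
    \<exists>P. finite P \<and> P \<subseteq> D \<and> (\<forall>x\<in>D. \<exists>q\<in>P. dist x q \<le> r) \<and> real (card P) \<le> C / r ^ DIM('a)"
proof -
  let ?d = "real DIM('a)"
  obtain B where B: "\<And>x. x \<in> D \<Longrightarrow> norm x \<le> B" using D by (auto simp: bounded_iff)
  define C where "C = (2 * ?d * \<bar>B\<bar> + 5) ^ DIM('a)"
  show ?thesis
  proof (rule that[of C])
    show "0 < C" by (simp add: C_def add_nonneg_pos)
    fix r :: real assume r: "0 < r" "r \<le> 1"
    define h where "h = r / ?d"
    have h: "0 < h" using r by (simp add: h_def)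
    define F where "F = (\<lambda>x::'a. \<lambda>b\<in>Basis. \<lfloor>x \<bullet> b / h\<rfloor>)"
    define N where "N = \<lceil>\<bar>B\<bar> / h\<rceil> + 1"
    define P where "P = inv_into D F ` (F ` D)"
    have "0 \<le> \<bar>B\<bar> / h" using h by simp
    then have N: "0 \<le> N" unfolding N_def by linarith
    have sub: "F ` D \<subseteq> PiE Basis (\<lambda>_. {-N..N})"
    proof safe
      fix x b assume x: "x \<in> D" and b: "b \<in> (Basis :: 'a set)"
      have "\<bar>x \<bullet> b\<bar> \<le> \<bar>B\<bar>" using Basis_le_norm[OF b, of x] B[OF x] by linarith
      then have "\<bar>x \<bullet> b / h\<bar> \<le> \<bar>B\<bar> / h" using h by (simp add: divide_right_mono)
      then show "F x b \<in> {-N..N}" using b unfolding F_def N_def by (simp, linarith)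
    qed (simp add: F_def)
    have fin: "finite (PiE (Basis :: 'a set) (\<lambda>_. {-N..N}))" by (intro finite_PiE) auto
    then have finF: "finite (F ` D)" using sub finite_subset by blast
    have "card P \<le> card (F ` D)" unfolding P_def by (intro card_image_le finF)
    also have "\<dots> \<le> card (PiE (Basis :: 'a set) (\<lambda>_. {-N..N}))" by (intro card_mono fin sub)
    also have "\<dots> = nat (2 * N + 1) ^ DIM('a)" by (simp add: card_PiE)
    finally have "real (card P) \<le> real (nat (2 * N + 1) ^ DIM('a))" by (simp only: of_nat_le_iff)
    also have "\<dots> = real_of_int (2 * N + 1) ^ DIM('a)" using N by simp
    also have "\<dots> \<le> ((2 * ?d * \<bar>B\<bar> + 5) / r) ^ DIM('a)"
    proof (rule power_mono)
      have "real_of_int N \<le> \<bar>B\<bar> / h + 2" unfolding N_def by linarith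
      then have "real_of_int (2 * N + 1) \<le> 2 * (\<bar>B\<bar> / h) + 5" by simp
      also have "2 * (\<bar>B\<bar> / h) + 5 \<le> 2 * (\<bar>B\<bar> / h) + 5 / r" using r by (simp add: pos_le_divide_eq)
      also have "\<dots> = (2 * ?d * \<bar>B\<bar> + 5) / r" by (simp add: h_def add_divide_distrib mult_ac)
      finally show "real_of_int (2 * N + 1) \<le> (2 * ?d * \<bar>B\<bar> + 5) / r" .
      show "0 \<le> real_of_int (2 * N + 1)" using N by simp
    qed
    also have "\<dots> = C / r ^ DIM('a)" by (simp add: C_def power_divide)
    finally have card: "real (card P) \<le> C / r ^ DIM('a)" .
    have "\<exists>q\<in>P. dist x q \<le> r" if x: "x \<in> D" for x
    proof
      let ?q = "inv_into D F (F x)"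
      show "?q \<in> P" using x by (auto simp: P_def)
      have eq: "F ?q = F x" using x by (intro f_inv_into_f) auto
      have "\<bar>(x - ?q) \<bullet> b\<bar> \<le> h" if b: "b \<in> Basis" for b
      proof -
        have "\<lfloor>x \<bullet> b / h\<rfloor> = \<lfloor>?q \<bullet> b / h\<rfloor>" using fun_cong[OF eq, of b] b by (simp add: F_def)
        then have "\<bar>x \<bullet> b / h - ?q \<bullet> b / h\<bar> < 1" by linarith
        also have "x \<bullet> b / h - ?q \<bullet> b / h = (x - ?q) \<bullet> b / h" by (simp add: inner_diff_left diff_divide_distrib)
        finally show ?thesis using h by (simp add: divide_less_eq)
      qed
      then have "(\<Sum>b\<in>Basis. \<bar>(x - ?q) \<bullet> b\<bar>) \<le> of_nat DIM('a) * h" by (intro sum_bounded_above) auto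
      then show "dist x ?q \<le> r"
        using norm_le_l1[of "x - ?q"] by (simp add: dist_norm h_def)
    qed
    moreover have "finite P" using finF by (simp add: P_def)
    moreover have "P \<subseteq> D" unfolding P_def by (auto intro: inv_into_into)
    ultimately show "\<exists>P. finite P \<and> P \<subseteq> D \<and> (\<forall>x\<in>D. \<exists>q\<in>P. dist x q \<le> r) \<and> real (card P) \<le> C / r ^ DIM('a)"
      using card by blast
  qed
qed

text \<open>
  A ball of radius \<open>s\<close> around a point of \<open>D\<close> is missed by all of the first \<open>n\<close> points with probability
  at most \<open>exp (- \<kappa> * s ^ d * n)\<close>. For \<open>s\<close> equal to half of \<open>(K * ln n / n) powr (1 / d)\<close> this is a power
  of \<open>1 / n\<close> with an exponent proportional to \<open>K\<close>. A large \<open>K\<close> beats the number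
  of points of a net of mesh \<open>s\<close>, at most of order \<open>n\<close>. If no
  ball around a point of the net is missed, then no point of \<open>D\<close> is further than \<open>2 * s\<close> from the
  sample.
\<close>

lemma (in prob_space) sample_dense_ae:
  fixes X :: "nat \<Rightarrow> 'a \<Rightarrow> 'b::euclidean_space" and D :: "'b set" and \<rho> :: "'b \<Rightarrow> real"
  assumes D: "convex D" "bounded D" "interior D \<noteq> {}"
    and indep: "indep_vars (\<lambda>_. borel) X {1..}"
    and density: "\<And>i. i \<ge> 1 \<Longrightarrow> distributed M lborel (X i) (\<lambda>x. ennreal (indicator D x * \<rho> x))"
    and c0: "c0 > 0" and \<rho>: "\<And>x. x \<in> D \<Longrightarrow> c0 \<le> \<rho> x"
  obtains K where "0 < K"
    "AE \<omega> in M. \<forall>\<^sub>F n in sequentially. \<forall>x\<in>D. \<exists>y\<in>sample_points X n \<omega>.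
       dist x y < (K * (ln (real n) / real n)) powr (1 / real DIM('b))"
proof -
  let ?d = "DIM('b)"
  have d: "0 < real ?d" by simp
  obtain \<theta> r0 where \<theta>: "0 < \<theta>" "0 < r0"
    and inner: "\<And>x r. x \<in> D \<Longrightarrow> 0 < r \<Longrightarrow> r \<le> r0 \<Longrightarrow> \<exists>z. ball z (\<theta> * r) \<subseteq> D \<inter> ball x r"
    by (rule convex_body_contains_ball_near[OF D]) (rule that)
  obtain C where C: "0 < C" and cover: "\<And>r. 0 < r \<Longrightarrow> r \<le> 1 \<Longrightarrow>
    \<exists>P. finite P \<and> P \<subseteq> D \<and> (\<forall>x\<in>D. \<exists>q\<in>P. dist x q \<le> r) \<and> real (card P) \<le> C / r ^ ?d"
    by (rule exists_small_net[OF D(2)]) (rule that)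
  define \<kappa> where "\<kappa> = c0 * (\<theta> ^ ?d * measure lborel (ball (0::'b) 1))"
  have \<kappa>: "0 < \<kappa>" using c0 \<theta> content_ball_pos[of 1 "0::'b"] by (simp add: \<kappa>_def)
  have Xm: "X i \<in> measurable M borel" if "i \<ge> 1" for i
    using indep that by (auto simp: indep_vars_def)
  have hit: "\<kappa> * r ^ ?d \<le> prob (X i -` ball q r \<inter> space M)" if i: "i \<ge> 1" and q: "q \<in> D" and r: "0 < r" "r \<le> r0" for i q r
  proof -
    obtain z where z: "ball z (\<theta> * r) \<subseteq> D \<inter> ball q r" using inner[OF q r] by blast
    have "ennreal (\<kappa> * r ^ ?d) = ennreal c0 * ennreal (measure lborel (ball z (\<theta> * r)))"
    proof -
      have "measure lborel (ball z (\<theta> * r)) = (\<theta> * r) ^ ?d * measure lborel (ball (0::'b) 1)"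
        using \<theta> r by (intro content_ball_conv_unit_ball) simp
      then have "\<kappa> * r ^ ?d = c0 * measure lborel (ball z (\<theta> * r))"
        unfolding \<kappa>_def by (simp add: power_mult_distrib)
      then show ?thesis using c0 by (simp add: ennreal_mult)
    qed
    also have "\<dots> = (\<integral>\<^sup>+x. ennreal c0 * indicator (ball z (\<theta> * r)) x \<partial>lborel)"
    proof -
      have "emeasure lborel (ball z (\<theta> * r)) = ennreal (measure lborel (ball z (\<theta> * r)))"
        by (rule emeasure_eq_ennreal_measure) (use emeasure_lborel_ball_finite[of z "\<theta> * r"] in auto)
      then show ?thesis by (subst nn_integral_cmult_indicator) auto
    qed
    also have "\<dots> \<le> (\<integral>\<^sup>+x. ennreal (indicator D x * \<rho> x) * indicator (ball q r) x \<partial>lborel)"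
      using z \<rho> by (intro nn_integral_mono) (auto simp: indicator_def subset_iff intro!: ennreal_leI)
    also have "\<dots> = emeasure M (X i -` ball q r \<inter> space M)"
      using distributed_emeasure[OF density[OF i], of "ball q r"] by simp
    also have "\<dots> = ennreal (prob (X i -` ball q r \<inter> space M))" by (rule emeasure_eq_measure)
    finally show ?thesis by (simp add: measure_nonneg)
  qed
  define E where "E = (\<lambda>n q s. \<Inter>i\<in>{1..n}. X i -` (- ball q s) \<inter> space M)"
  have miss: "prob (E n q r) \<le> exp (- \<kappa> * r ^ ?d * real n)"
    if n: "n \<ge> 1" and q: "q \<in> D" and r: "0 < r" "r \<le> r0" for n q r
  proof -
    have "prob (E n q r) = (\<Prod>i\<in>{1..n}. prob (X i -` (- ball q r) \<inter> space M))"
      unfolding E_def using n by (intro indep_varsD[OF indep]) auto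
    also have "\<dots> \<le> (\<Prod>i\<in>{1..n}. exp (- \<kappa> * r ^ ?d))"
    proof (intro prod_mono conjI measure_nonneg)
      fix i assume "i \<in> {1..n}"
      then have i: "i \<ge> 1" by simp
      have "X i -` (- ball q r) \<inter> space M = space M - (X i -` ball q r \<inter> space M)" by auto
      then have "prob (X i -` (- ball q r) \<inter> space M) = 1 - prob (X i -` ball q r \<inter> space M)"
        using Xm[OF i] by (simp add: prob_compl)
      also have "\<dots> \<le> 1 + (- \<kappa> * r ^ ?d)" using hit[OF i q r] by simp
      also have "\<dots> \<le> exp (- \<kappa> * r ^ ?d)" by (rule exp_ge_add_one_self)
      finally show "prob (X i -` (- ball q r) \<inter> space M) \<le> exp (- \<kappa> * r ^ ?d)" .
    qed
    also have "\<dots> = exp (- \<kappa> * r ^ ?d * real n)"       using exp_of_nat_mult[of n "- \<kappa> * r ^ ?d"] by (simp add: mult.commute)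
    finally show ?thesis .
  qed
  \<comment> \<open>The factor \<open>3\<close> makes the probability of missing one ball \<open>1 / n ^ 3\<close>, so that the union bound
      is still summable. The factor \<open>2 ^ d\<close> makes up for the balls having radius \<open>r n / 2\<close>.\<close>
  define K where "K = 3 * 2 ^ ?d / \<kappa>"
  have K: "0 < K" using \<kappa> by (simp add: K_def)
  define r where "r = (\<lambda>n. (K * (ln (real n) / real n)) powr (1 / real ?d))"
  have r_pow: "r n ^ ?d = K * (ln (real n) / real n)" if "n \<ge> 3" for n
  proof -
    have root: "(q powr (1 / real ?d)) ^ ?d = q" if "0 < q" for q :: real
    proof -
      have "(q powr (1 / real ?d)) ^ ?d = (q powr (1 / real ?d)) powr real ?d"
        using that by (intro powr_realpow[symmetric]) simp
      then show ?thesis using that by (simp add: powr_powr)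
    qed
    show ?thesis unfolding r_def using K that by (intro root) simp
  qed
  have r_pos: "0 < r n" if "n \<ge> 3" for n using K that by (simp add: r_def)
  have "(\<lambda>n. ln (real n) / real n) \<longlonglongrightarrow> 0"
    by real_asymp
  then have "(\<lambda>n. K * (ln (real n) / real n)) \<longlonglongrightarrow> K * 0" by (rule tendsto_mult_left)
  then have "(\<lambda>n. K * (ln (real n) / real n)) \<longlonglongrightarrow> 0" by (simp only: mult_zero_right)
  moreover have "\<forall>\<^sub>F n in sequentially. 0 \<le> K * (ln (real n) / real n)"
    using eventually_ge_at_top[of 1] by eventually_elim (use K in simp)
  ultimately have "r \<longlonglongrightarrow> 0"
    unfolding r_def by (intro tendsto_zero_powrI tendsto_const) auto
  then have "\<forall>\<^sub>F n in sequentially. r n < min 1 r0" using \<theta> by (intro order_tendstoD(2)) auto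
  then obtain n1 where n1: "\<And>n. n \<ge> n1 \<Longrightarrow> r n < min 1 r0" by (auto simp: eventually_sequentially)
  define n0 where "n0 = max 3 n1"
  have "\<forall>n. \<exists>P. n \<ge> n0 \<longrightarrow> finite P \<and> P \<subseteq> D \<and> (\<forall>x\<in>D. \<exists>q\<in>P. dist x q \<le> r n / 2) \<and> real (card P) \<le> C / (r n / 2) ^ ?d"
  proof
    fix n
    show "\<exists>P. n \<ge> n0 \<longrightarrow> finite P \<and> P \<subseteq> D \<and> (\<forall>x\<in>D. \<exists>q\<in>P. dist x q \<le> r n / 2) \<and> real (card P) \<le> C / (r n / 2) ^ ?d"
      using cover[of "r n / 2"] n1[of n] r_pos[of n] by (cases "n \<ge> n0") (auto simp: n0_def)
  qed
  from choice[OF this] obtain P where P': "\<forall>n. n \<ge> n0 \<longrightarrow> finite (P n) \<and> P n \<subseteq> D \<and>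
    (\<forall>x\<in>D. \<exists>q\<in>P n. dist x q \<le> r n / 2) \<and> real (card (P n)) \<le> C / (r n / 2) ^ ?d" by blast
  have P: "finite (P n)" "P n \<subseteq> D" "\<And>x. x \<in> D \<Longrightarrow> \<exists>q\<in>P n. dist x q \<le> r n / 2"
    "real (card (P n)) \<le> C / (r n / 2) ^ ?d" if "n \<ge> n0" for n
    using spec[OF P', of n] that by auto
  define A where "A = (\<lambda>n. if n \<ge> n0 then (\<Union>q\<in>P n. E n q (r n / 2)) else {})"
  have Q: "E n q s \<in> events" if "n \<ge> n0" for n q s
    unfolding E_def using that by (intro sets.finite_INT measurable_sets[OF Xm]) (auto simp: n0_def)
  have A_sets: "A n \<in> events" for n
    unfolding A_def using P(1) Q by (auto intro!: sets.finite_UN)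
  have A_prob: "prob (A n) \<le> C * 2 ^ ?d / K * (1 / real n ^ 2)" if n: "n \<ge> n0" for n
  proof -
    have n3: "n \<ge> 3" using n by (simp add: n0_def)
    have ln1: "1 \<le> ln (real n)"
      using n3 exp_le by (subst ln_ge_iff) auto
    have rn: "0 < r n / 2" "r n / 2 \<le> r0" using r_pos[OF n3] n1[of n] n by (auto simp: n0_def)
    have pw: "(r n / 2) ^ ?d = K * (ln (real n) / real n) / 2 ^ ?d" by (simp add: power_divide r_pow[OF n3])
    have ex: "exp (- \<kappa> * (r n / 2) ^ ?d * real n) = 1 / real n ^ 3"
    proof -
      have "- \<kappa> * (r n / 2) ^ ?d * real n = - (3 * ln (real n))"
        unfolding pw using \<kappa> n3 by (simp add: K_def)
      also have "exp \<dots> = 1 / exp (real 3 * ln (real n))" by (simp add: exp_minus divide_inverse)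
      also have "exp (real 3 * ln (real n)) = real n ^ 3" using n3 by (subst exp_of_nat_mult) simp
      finally show ?thesis .
    qed
    have "prob (A n) \<le> (\<Sum>q\<in>P n. prob (E n q (r n / 2)))"
      using n Q P(1) unfolding A_def by (simp, intro finite_measure_subadditive_finite) auto
    also have "\<dots> \<le> (\<Sum>q\<in>P n. 1 / real n ^ 3)"
    proof (rule sum_mono)
      fix q assume "q \<in> P n"
      then have "q \<in> D" using P(2)[OF n] by blast
      then show "prob (E n q (r n / 2)) \<le> 1 / real n ^ 3"
        using miss[of n q "r n / 2"] n3 rn ex by simp
    qed
    also have "\<dots> = real (card (P n)) * (1 / real n ^ 3)" by simp
    also have "\<dots> \<le> (C * 2 ^ ?d / K * real n) * (1 / real n ^ 3)"
    proof (rule mult_right_mono)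
      have "real (card (P n)) \<le> C / (r n / 2) ^ ?d" by (rule P(4)[OF n])
      also have "\<dots> = (C * 2 ^ ?d / K * real n) / ln (real n)" unfolding pw by simp
      also have "\<dots> \<le> (C * 2 ^ ?d / K * real n) / 1"
        using ln1 C K by (intro divide_left_mono) auto
      finally show "real (card (P n)) \<le> C * 2 ^ ?d / K * real n" by simp
    qed simp
    also have "\<dots> = C * 2 ^ ?d / K * (1 / real n ^ 2)"
      using n3 by (simp add: power3_eq_cube power2_eq_square)
    finally show ?thesis .
  qed
  have "summable (\<lambda>n. prob (A n))"
  proof (rule summable_comparison_test')
    show "summable (\<lambda>n. C * 2 ^ ?d / K * (1 / real n ^ 2))"
      using inverse_power_summable[of 2, where 'a=real]
      by (intro summable_mult) (simp add: divide_inverse power_inverse)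
    show "norm (prob (A n)) \<le> C * 2 ^ ?d / K * (1 / real n ^ 2)" if "n \<ge> n0" for n
      using A_prob[OF that] by (simp add: measure_nonneg)
  qed
  then have "AE \<omega> in M. \<forall>\<^sub>F n in sequentially. \<omega> \<in> space M - A n"
    by (intro borel_cantelli_AE1 A_sets) (auto simp: emeasure_eq_measure)
  then have "AE \<omega> in M. \<forall>\<^sub>F n in sequentially. \<forall>x\<in>D. \<exists>y\<in>sample_points X n \<omega>. dist x y < r n"
  proof eventually_elim
    case (elim \<omega>)
    show ?case
      using elim eventually_ge_at_top[of n0]
    proof eventually_elim
      case (elim n)
      show ?case
      proof
        fix x assume x: "x \<in> D"
        obtain q where q: "q \<in> P n" "dist x q \<le> r n / 2" using P(3)[OF elim(2) x] by blast
        have "\<omega> \<notin> (E n q (r n / 2))"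
          using elim q(1) by (auto simp: A_def)
        then obtain i where i: "i \<in> {1..n}" "\<not> (X i \<omega> \<in> - ball q (r n / 2) \<and> \<omega> \<in> space M)"
          unfolding E_def by blast
        then have "dist q (X i \<omega>) < r n / 2" using elim(1) by simp
        then have "dist x (X i \<omega>) < r n"
          using q(2) dist_triangle[of x "X i \<omega>" q] by linarith
        then show "\<exists>y\<in>sample_points X n \<omega>. dist x y < r n"
          using i by (auto simp: sample_points_def)
      qed
    qed
  qed
  then show ?thesis using that[OF K] by (simp add: r_def)
qed


section \<open>Optimal paths in random geometric graphs\<close>

lemma net_radius_ratio_tendsto:
  fixes \<epsilon> :: "nat \<Rightarrow> real" and d :: real
  assumes pos: "\<And>n. n \<ge> 1 \<Longrightarrow> \<epsilon> n > 0" and K: "K \<ge> 0"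
    and rate: "limsup (\<lambda>n. ereal (ln (real n) powr (1 / d) / real n powr (1 / d) * (1 / \<epsilon> n))) = 0"
  shows "(\<lambda>n. (K * (ln (real n) / real n)) powr (1 / d) / \<epsilon> n) \<longlonglongrightarrow> 0"
proof -
  let ?q = "\<lambda>n. ln (real n) powr (1 / d) / real n powr (1 / d) * (1 / \<epsilon> n)"
  have "?q \<longlonglongrightarrow> 0"
  proof (rule order_tendstoI)
    fix e :: real assume e: "e < 0"
    show "\<forall>\<^sub>F n in sequentially. e < ?q n"
      using eventually_ge_at_top[of 1]
    proof eventually_elim
      case (elim n)
      have "0 \<le> ?q n" using pos[of n] elim by simp
      then show ?case using e by linarith
    qed
  next
    fix e :: real assume "0 < e"
    then have "limsup (\<lambda>n. ereal (?q n)) < ereal e" unfolding rate by simp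
    then have "\<forall>\<^sub>F n in sequentially. ereal (?q n) < ereal e" by (rule Limsup_lessD)
    then show "\<forall>\<^sub>F n in sequentially. ?q n < e" by simp
  qed
  then have "(\<lambda>n. K powr (1 / d) * ?q n) \<longlonglongrightarrow> K powr (1 / d) * 0" by (intro tendsto_mult_left)
  moreover have "\<forall>\<^sub>F n in sequentially. K powr (1 / d) * ?q n = (K * (ln (real n) / real n)) powr (1 / d) / \<epsilon> n"
    using eventually_ge_at_top[of 1]
    by eventually_elim (use K in \<open>simp add: powr_mult powr_divide\<close>)
  ultimately show ?thesis using Lim_transform_eventually by fastforce
qed

theorem theorem2p4:
  fixes D :: "'a::euclidean_space set"
    and f :: "'a \<Rightarrow> 'a \<Rightarrow> real"
    and a b :: 'a
    and p m\<^sub>1 m\<^sub>2 c c\<^sub>0 :: real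
    and M :: "'w measure"
    and X :: "nat \<Rightarrow> 'w \<Rightarrow> 'a"
    and \<rho> :: "'a \<Rightarrow> real"
    and \<epsilon> :: "nat \<Rightarrow> real"
  assumes D: "\<exists>U. open U \<and> U \<noteq> {} \<and> bounded U \<and> convex U \<and> D = closure U"
    and f_nonneg: "\<And>x v. x \<in> D \<Longrightarrow> 0 \<le> f x v"
    and p: "p > 1"
    and A0_cont: "continuous_on (D \<times> UNIV) (\<lambda>(x, v). f x v)"
    and A0_C1: "C1_on (D \<times> (UNIV - {0})) (\<lambda>(x, v). f x v)"
    and A1: "\<And>x. x \<in> D \<Longrightarrow> convex_on UNIV (f x)"
    and A2: "\<And>x v r. x \<in> D \<Longrightarrow> r > 0 \<Longrightarrow> f x (r *\<^sub>R v) = r powr p * f x v"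
    and A3_pos: "m\<^sub>1 > 0" "m\<^sub>2 > 0"
    and A3: "\<And>x v. x \<in> D \<Longrightarrow> m\<^sub>1 * norm v powr p \<le> f x v \<and> f x v \<le> m\<^sub>2 * norm v powr p"
    and Lip: "\<And>x y v. x \<in> D \<Longrightarrow> y \<in> D \<Longrightarrow>
      \<bar>f x v - f y v\<bar> \<le> c * norm (x - y) * norm v powr p"
    and ab: "a \<in> D" "b \<in> D"
    and M: "prob_space M"
    and X_indep: "prob_space.indep_vars M (\<lambda>_. borel) X {1..}"
    and X_in_D: "\<And>i \<omega>. i \<ge> 1 \<Longrightarrow> \<omega> \<in> space M \<Longrightarrow> X i \<omega> \<in> D"
    and X_density: "\<And>i. i \<ge> 1 \<Longrightarrow>
      distributed M lborel (X i) (\<lambda>x. ennreal (indicator D x * \<rho> x))"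
    and c\<^sub>0: "c\<^sub>0 > 0"
    and \<rho>_bounds: "\<And>x. x \<in> D \<Longrightarrow> c\<^sub>0 \<le> \<rho> x \<and> \<rho> x \<le> 1 / c\<^sub>0"
    and \<epsilon>_pos: "\<And>n. n \<ge> 1 \<Longrightarrow> \<epsilon> n > 0"
    and \<epsilon>_lim: "\<epsilon> \<longlonglongrightarrow> 0"
    and \<epsilon>_rate: "limsup (\<lambda>n. ereal (ln (real n) powr (1 / real DIM('a)) /
      real n powr (1 / real DIM('a)) * (1 / \<epsilon> n))) = 0"
  shows "AE \<omega> in M.
    \<comment> \<open>(1) both minima are attained and the discrete minima converge\<close>
    ((\<forall>\<^sub>F n in sequentially.
        argmin_set (discrete_cost f) (graph_paths (sample_points X n \<omega>) (\<epsilon> n) a b) \<noteq> {}) \<and>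
     argmin_set (path_cost f) (lipschitz_paths D a b) \<noteq> {} \<and>
     (\<lambda>n. INF v\<in>graph_paths (sample_points X n \<omega>) (\<epsilon> n) a b. discrete_cost f v)
       \<longlonglongrightarrow> (INF \<gamma>\<in>lipschitz_paths D a b. path_cost f \<gamma>)) \<and>
    (\<forall>w :: nat \<Rightarrow> 'a list.
      (\<forall>\<^sub>F n in sequentially.
         w n \<in> argmin_set (discrete_cost f)
                 (graph_paths (sample_points X n \<omega>) (\<epsilon> n) a b)) \<longrightarrow>
      \<comment> \<open>(2) subsequential convergence to a minimizer\<close>
      (\<forall>r :: nat \<Rightarrow> nat. strict_mono r \<longrightarrow>
        (\<exists>s :: nat \<Rightarrow> nat. strict_mono s \<and>
          (\<exists>\<gamma> \<in> argmin_set (path_cost f) (lipschitz_paths D a b).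
             uniform_limit {0..1} (\<lambda>k. linear_interp (w (r (s k)))) \<gamma> sequentially \<and>
             (\<lambda>k. hausdorff_distance (set (w (r (s k)))) (path_image \<gamma>)) \<longlonglongrightarrow> 0))) \<and>
      \<comment> \<open>(3) convergence of the whole sequence if the minimizer is unique (as a path on [0,1])\<close>
      (\<forall>\<gamma> \<in> argmin_set (path_cost f) (lipschitz_paths D a b).
        (\<forall>\<eta> \<in> argmin_set (path_cost f) (lipschitz_paths D a b). \<forall>t\<in>{0..1}. \<eta> t = \<gamma> t) \<longrightarrow>
        uniform_limit {0..1} (\<lambda>n. linear_interp (w n)) \<gamma> sequentially \<and>
        (\<lambda>n. hausdorff_distance (set (w n)) (path_image \<gamma>)) \<longlonglongrightarrow> 0))"
proof -
  obtain U where U: "open U" "U \<noteq> {}" "bounded U" "convex U" "D = closure U" using D by blast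
  have bD: "bounded D" and cD: "convex D" using U by (auto simp: convex_closure)
  have iD: "interior D \<noteq> {}" using U interior_maximal[of U D] closure_subset by blast
  have lag: "homogeneous_lagrangian D f p m\<^sub>1 m\<^sub>2 \<bar>c\<bar>"
  proof
    show "compact D" using bD U(5) by (simp add: compact_eq_bounded_closed)
    show "\<bar>f x v - f y v\<bar> \<le> \<bar>c\<bar> * norm (x - y) * norm v powr p" if "x \<in> D" "y \<in> D" for x y v
      using Lip[OF that, of v] by (rule order_trans) (intro mult_right_mono, auto)
  qed (use cD p A0_cont A1 A2 A3_pos A3 in auto)
  obtain R where R: "0 < R" "\<And>x. x \<in> D \<Longrightarrow> \<exists>z\<in>D. R \<le> dist x z"
    by (rule far_point_exists[OF iD]) (rule that)
  interpret M: prob_space M by (rule M)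
  obtain K where K: "0 < K" and net: "AE \<omega> in M. \<forall>\<^sub>F n in sequentially. \<forall>x\<in>D. \<exists>y\<in>sample_points X n \<omega>.
      dist x y < (K * (ln (real n) / real n)) powr (1 / real DIM('a))"
    by (rule M.sample_dense_ae[OF cD bD iD X_indep X_density c\<^sub>0]) (use \<rho>_bounds that in auto)
  show ?thesis
    using net AE_space
  proof eventually_elim
    case (elim \<omega>)
    \<comment> \<open>From here on \<open>\<omega>\<close> is fixed and no probability is left.\<close>
    interpret dense_proximity_graphs D f p m\<^sub>1 m\<^sub>2 "\<bar>c\<bar>" a b "\<lambda>n. sample_points X n \<omega>"
      "\<lambda>n. (K * (ln (real n) / real n)) powr (1 / real DIM('a))" \<epsilon> R
    proof (intro dense_proximity_graphs.intro[OF lag] dense_proximity_graphs_axioms.intro ab R \<epsilon>_lim elim(1))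
      show "finite (sample_points X n \<omega>)" for n by (simp add: sample_points_def)
      show "sample_points X n \<omega> \<subseteq> D" for n using X_in_D elim(2) by (auto simp: sample_points_def)
      show "\<forall>\<^sub>F n in sequentially. 0 < \<epsilon> n"
        using eventually_ge_at_top[of 1] by eventually_elim (rule \<epsilon>_pos)
      show "(\<lambda>n. (K * (ln (real n) / real n)) powr (1 / real DIM('a)) / \<epsilon> n) \<longlonglongrightarrow> 0"
        by (rule net_radius_ratio_tendsto[OF \<epsilon>_pos _ \<epsilon>_rate]) (use K in auto)
    qed
    show ?case
      using eventually_discrete_minimizer_exists minimizer_exists[OF ab] discrete_minima_tendsto
        discrete_minimizers_subconverge discrete_minimizers_converge
      unfolding action_def by (intro conjI allI impI ballI) blast+
  qed
qed

end
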